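(* Let $\mathcal{O}$ be a Euclidean oriented matroid and let $f$ be an element of its ground set lying in general position. Then $\mathcal{O}\setminus f$ is vertex-shellable, and every tope cell of $\mathcal{O}\setminus f$ is vertex-shellable.
   Context: Oriented matroids are given by covectors in $\{+,-,0\}^E$, cocircuits being minimal nonzero covectors, topes maximal covectors; covectors are ordered by $X\le Y$ iff $X_e\in\{0,Y_e\}$ for all $e$. With $z(X)=\{e:X_e=0\}$, $\mathrm{sep}(X,Y)=\{e:X_e=-Y_e\ne0\}$, conformal meaning $\mathrm{sep}=\emptyset$, and $r$ the rank: cocircuits $X\ne\pm Y$ are comodular if $z(X\circ Y)$ is a flat of rank $r-2$; then elimination of $e\in\mathrm{sep}(X,Y)$ yields the unique cocircuit $Z$ with $Z_e=0$, $\mathrm{supp}(Z)\subseteq\mathrm{supp}(X\circ Y)\setminus\{e\}$. An oriented matroid program $(\mathcal{O},g,f)$: distinct $g,f$, $g$ not a loop, $f$ not a coloop; for comodular cocircuits $X,Y$ with $X_g=Y_g\ne0$, elimination of $g$ between $-X$ and $Y$ yields $Z$ and the pair is directed $X\to Y$, $X\leftarrow Y$ or undirected according as $Z_f=+,-,0$. $G_f$: vertices the cocircuits with $g=+$, edges the conformal comodular pairs, directed so. The program is Euclidean if $G_f$ has no directed cycle (closed sequence of distinct vertices along edges each forward or undirected, at least one forward); $\mathcal{O}$ is Euclidean if all its programs are. $f$ is in general position if $f\notin\mathrm{cl}(S)$ for every $S\subseteq E\setminus\{f\}$ of rank $<r$. A linear ordering $x_1,\dots,x_s$ of the atoms of a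 graded poset $P$ with top element $\hat1$ is a recursive atom-ordering if $P$ has length $\le2$, or if for each $j$ there is a subset $Q_j$ of the atoms of $[x_j,\hat1]$ with (i) $[x_j,\hat1]\cap\bigcup_{i<j}[x_i,\hat1]=\bigcup_{y\in Q_j}[y,\hat1]$ and (ii) $[x_j,\hat1]$ has a recursive atom-ordering in which the elements of $Q_j$ come first. An oriented matroid is vertex-shellable if its face lattice (covectors with a top element $\hat1$ adjoined) has a recursive atom-ordering (whose atoms are the cocircuits); a tope cell, i.e. the interval $[0,T]$ for a tope $T$, is vertex-shellable if it has a recursive atom-ordering. *)

theory Defs
  imports Main
begin

section \<open>Oriented matroids given by covectors\<close>

text \<open>A sign vector on a ground set \<open>E\<close> is a function with values in \<open>{-1, 0, 1}\<close> that vanishes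
  outside \<open>E\<close>; the latter makes equality of functions coincide with equality on \<open>E\<close>.\<close>

type_synonym 'a signvec = "'a \<Rightarrow> int"

definition sign_vectors :: "'a set \<Rightarrow> 'a signvec set" where
  "sign_vectors E = {X. (\<forall>e\<in>E. X e \<in> {-1, 0, 1}) \<and> (\<forall>e. e \<notin> E \<longrightarrow> X e = 0)}"

definition zero_vec :: "'a signvec" where
  "zero_vec = (\<lambda>_. 0)"

definition supp :: "'a signvec \<Rightarrow> 'a set" where
  "supp X = {e. X e \<noteq> 0}"

definition zset :: "'a set \<Rightarrow> 'a signvec \<Rightarrow> 'a set" where
  "zset E X = {e \<in> E. X e = 0}"

definition sep :: "'a signvec \<Rightarrow> 'a signvec \<Rightarrow> 'a set" where
  "sep X Y = {e. X e = - Y e \<and> X e \<noteq> 0}"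

definition conformal :: "'a signvec \<Rightarrow> 'a signvec \<Rightarrow> bool" where
  "conformal X Y \<longleftrightarrow> sep X Y = {}"

definition compose :: "'a signvec \<Rightarrow> 'a signvec \<Rightarrow> 'a signvec" where
  "compose X Y = (\<lambda>e. if X e \<noteq> 0 then X e else Y e)"

definition sle :: "'a signvec \<Rightarrow> 'a signvec \<Rightarrow> bool" where
  "sle X Y \<longleftrightarrow> (\<forall>e. X e = 0 \<or> X e = Y e)"

locale oriented_matroid =
  fixes E :: "'a set" and L :: "'a signvec set"
  assumes finite_ground: "finite E"
    and covectors_sign: "L \<subseteq> sign_vectors E"
    and zero_covector: "zero_vec \<in> L"
    and neg_covector: "X \<in> L \<Longrightarrow> - X \<in> L"
    and compose_covector: "X \<in> L \<Longrightarrow> Y \<in> L \<Longrightarrow> compose X Y \<in> L"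
    and elim_covector: "X \<in> L \<Longrightarrow> Y \<in> L \<Longrightarrow> e \<in> sep X Y \<Longrightarrow>
      \<exists>Z\<in>L. Z e = 0 \<and> (\<forall>h\<in>E - sep X Y. Z h = compose X Y h)"

definition cocircuit :: "'a signvec set \<Rightarrow> 'a signvec \<Rightarrow> bool" where
  "cocircuit L X \<longleftrightarrow> X \<in> L \<and> X \<noteq> zero_vec \<and> (\<forall>Y\<in>L. Y \<noteq> zero_vec \<and> sle Y X \<longrightarrow> Y = X)"

definition tope :: "'a signvec set \<Rightarrow> 'a signvec \<Rightarrow> bool" where
  "tope L T \<longleftrightarrow> T \<in> L \<and> (\<forall>Y\<in>L. sle T Y \<longrightarrow> Y = T)"

definition deletion :: "'a signvec set \<Rightarrow> 'a \<Rightarrow> 'a signvec set" where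
  "deletion L f = (\<lambda>X. X(f := 0)) ` L"


subsection \<open>The underlying matroid\<close>

text \<open>The flats of the underlying matroid are the zero sets of the covectors.\<close>

definition flat :: "'a set \<Rightarrow> 'a signvec set \<Rightarrow> 'a set \<Rightarrow> bool" where
  "flat E L F \<longleftrightarrow> (\<exists>X\<in>L. F = zset E X)"

definition closure_om :: "'a set \<Rightarrow> 'a signvec set \<Rightarrow> 'a set \<Rightarrow> 'a set" where
  "closure_om E L S = \<Inter>{F. flat E L F \<and> S \<subseteq> F}"

definition indep_om :: "'a set \<Rightarrow> 'a signvec set \<Rightarrow> 'a set \<Rightarrow> bool" where
  "indep_om E L I \<longleftrightarrow> I \<subseteq> E \<and> (\<forall>e\<in>I. e \<notin> closure_om E L (I - {e}))"

definition rank_om :: "'a set \<Rightarrow> 'a signvec set \<Rightarrow> 'a set \<Rightarrow> nat" where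
  "rank_om E L S = Max (card ` {I. I \<subseteq> S \<and> indep_om E L I})"

definition loop_om :: "'a set \<Rightarrow> 'a signvec set \<Rightarrow> 'a \<Rightarrow> bool" where
  "loop_om E L e \<longleftrightarrow> e \<in> closure_om E L {}"

definition coloop_om :: "'a set \<Rightarrow> 'a signvec set \<Rightarrow> 'a \<Rightarrow> bool" where
  "coloop_om E L e \<longleftrightarrow> e \<in> E \<and> e \<notin> closure_om E L (E - {e})"

definition general_position :: "'a set \<Rightarrow> 'a signvec set \<Rightarrow> 'a \<Rightarrow> bool" where
  "general_position E L f \<longleftrightarrow>
     (\<forall>S. S \<subseteq> E - {f} \<and> rank_om E L S < rank_om E L E \<longrightarrow> f \<notin> closure_om E L S)"


subsection \<open>Oriented matroid programs\<close>

definition comodular :: "'a set \<Rightarrow> 'a signvec set \<Rightarrow> 'a signvec \<Rightarrow> 'a signvec \<Rightarrow> bool" where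
  "comodular E L X Y \<longleftrightarrow> cocircuit L X \<and> cocircuit L Y \<and> X \<noteq> Y \<and> X \<noteq> - Y \<and>
     flat E L (zset E (compose X Y)) \<and>
     rank_om E L (zset E (compose X Y)) + 2 = rank_om E L E"

text \<open>\<open>Z\<close> results from eliminating \<open>e \<in> sep X Y\<close> between the cocircuits \<open>X\<close> and \<open>Y\<close>. The support
  condition alone determines a cocircuit of a comodular pair only up to sign; the last conjunct
  is the usual signed condition of cocircuit elimination, \<open>Z\<^sup>+ \<subseteq> X\<^sup>+ \<union> Y\<^sup>+\<close> and
  \<open>Z\<^sup>- \<subseteq> X\<^sup>- \<union> Y\<^sup>-\<close>, which selects one of the two.\<close>

definition eliminates :: "'a signvec set \<Rightarrow> 'a \<Rightarrow> 'a signvec \<Rightarrow> 'a signvec \<Rightarrow> 'a signvec \<Rightarrow> bool" where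
  "eliminates L e X Y Z \<longleftrightarrow> cocircuit L Z \<and> Z e = 0 \<and>
     supp Z \<subseteq> supp (compose X Y) - {e} \<and> (\<forall>h. Z h \<in> {0, X h, Y h})"

definition om_program :: "'a set \<Rightarrow> 'a signvec set \<Rightarrow> 'a \<Rightarrow> 'a \<Rightarrow> bool" where
  "om_program E L g f \<longleftrightarrow>
     g \<in> E \<and> f \<in> E \<and> g \<noteq> f \<and> \<not> loop_om E L g \<and> \<not> coloop_om E L f"

definition Gf_vertex :: "'a signvec set \<Rightarrow> 'a \<Rightarrow> 'a signvec \<Rightarrow> bool" where
  "Gf_vertex L g X \<longleftrightarrow> cocircuit L X \<and> X g = 1"

definition Gf_edge :: "'a set \<Rightarrow> 'a signvec set \<Rightarrow> 'a \<Rightarrow> 'a signvec \<Rightarrow> 'a signvec \<Rightarrow> bool" where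
  "Gf_edge E L g X Y \<longleftrightarrow>
     Gf_vertex L g X \<and> Gf_vertex L g Y \<and> comodular E L X Y \<and> conformal X Y"

text \<open>\<open>X \<leftarrow> Y\<close> is not defined separately: eliminating \<open>g\<close> between \<open>-Y\<close> and \<open>X\<close> yields the negative
  of what eliminating \<open>g\<close> between \<open>-X\<close> and \<open>Y\<close> yields, so \<open>X \<leftarrow> Y\<close> is the same as \<open>Y \<rightarrow> X\<close>.\<close>

definition Gf_forward ::
  "'a set \<Rightarrow> 'a signvec set \<Rightarrow> 'a \<Rightarrow> 'a \<Rightarrow> 'a signvec \<Rightarrow> 'a signvec \<Rightarrow> bool" where
  "Gf_forward E L g f X Y \<longleftrightarrow> Gf_edge E L g X Y \<and> (\<exists>Z. eliminates L g (- X) Y Z \<and> Z f = 1)"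

definition Gf_undirected ::
  "'a set \<Rightarrow> 'a signvec set \<Rightarrow> 'a \<Rightarrow> 'a \<Rightarrow> 'a signvec \<Rightarrow> 'a signvec \<Rightarrow> bool" where
  "Gf_undirected E L g f X Y \<longleftrightarrow> Gf_edge E L g X Y \<and> (\<exists>Z. eliminates L g (- X) Y Z \<and> Z f = 0)"

definition directed_cycle ::
  "'a set \<Rightarrow> 'a signvec set \<Rightarrow> 'a \<Rightarrow> 'a \<Rightarrow> 'a signvec list \<Rightarrow> bool" where
  "directed_cycle E L g f c \<longleftrightarrow> distinct c \<and>
     (\<forall>i<length c. Gf_forward E L g f (c ! i) (c ! ((i + 1) mod length c)) \<or>
                   Gf_undirected E L g f (c ! i) (c ! ((i + 1) mod length c))) \<and>
     (\<exists>i<length c. Gf_forward E L g f (c ! i) (c ! ((i + 1) mod length c)))"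

definition euclidean_program :: "'a set \<Rightarrow> 'a signvec set \<Rightarrow> 'a \<Rightarrow> 'a \<Rightarrow> bool" where
  "euclidean_program E L g f \<longleftrightarrow> (\<nexists>c. directed_cycle E L g f c)"

definition euclidean :: "'a set \<Rightarrow> 'a signvec set \<Rightarrow> bool" where
  "euclidean E L \<longleftrightarrow> (\<forall>g f. om_program E L g f \<longrightarrow> euclidean_program E L g f)"


section \<open>Recursive atom-orderings\<close>

text \<open>A poset is a carrier \<open>P\<close> together with an order \<open>le\<close>, of which only the restriction to \<open>P\<close>
  matters.\<close>

definition is_least :: "('b \<Rightarrow> 'b \<Rightarrow> bool) \<Rightarrow> 'b set \<Rightarrow> 'b \<Rightarrow> bool" where
  "is_least le P b \<longleftrightarrow> b \<in> P \<and> (\<forall>x\<in>P. le b x)"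

definition is_greatest :: "('b \<Rightarrow> 'b \<Rightarrow> bool) \<Rightarrow> 'b set \<Rightarrow> 'b \<Rightarrow> bool" where
  "is_greatest le P t \<longleftrightarrow> t \<in> P \<and> (\<forall>x\<in>P. le x t)"

definition covers :: "('b \<Rightarrow> 'b \<Rightarrow> bool) \<Rightarrow> 'b set \<Rightarrow> 'b \<Rightarrow> 'b \<Rightarrow> bool" where
  "covers le P y x \<longleftrightarrow> x \<in> P \<and> y \<in> P \<and> le x y \<and> x \<noteq> y \<and>
     (\<forall>z\<in>P. le x z \<and> le z y \<longrightarrow> z = x \<or> z = y)"

definition atoms :: "('b \<Rightarrow> 'b \<Rightarrow> bool) \<Rightarrow> 'b set \<Rightarrow> 'b set" where
  "atoms le P = {x. \<exists>b. is_least le P b \<and> covers le P x b}"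

definition graded_poset :: "('b \<Rightarrow> 'b \<Rightarrow> bool) \<Rightarrow> 'b set \<Rightarrow> bool" where
  "graded_poset le P \<longleftrightarrow> finite P \<and> reflp_on P le \<and> transp_on P le \<and> antisymp_on P le \<and>
     (\<exists>b. is_least le P b) \<and> (\<exists>t. is_greatest le P t) \<and>
     (\<forall>C D. pred_on.maxchain P le C \<and> pred_on.maxchain P le D \<longrightarrow> card C = card D)"

definition poset_length :: "('b \<Rightarrow> 'b \<Rightarrow> bool) \<Rightarrow> 'b set \<Rightarrow> nat" where
  "poset_length le P = Max ((\<lambda>C. card C - 1) ` {C. pred_on.chain P le C})"

text \<open>In a poset \<open>P\<close> with top element this is the interval from \<open>x\<close> to the top.\<close>

definition upper :: "('b \<Rightarrow> 'b \<Rightarrow> bool) \<Rightarrow> 'b set \<Rightarrow> 'b \<Rightarrow> 'b set" where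
  "upper le P x = {y \<in> P. le x y}"

inductive recursive_atom_ordering ::
    "('b \<Rightarrow> 'b \<Rightarrow> bool) \<Rightarrow> 'b set \<Rightarrow> 'b list \<Rightarrow> bool" for le where
  "graded_poset le P \<Longrightarrow> distinct xs \<Longrightarrow> set xs = atoms le P \<Longrightarrow>
   poset_length le P \<le> 2 \<or>
   (\<forall>j<length xs. \<exists>Q \<subseteq> atoms le (upper le P (xs ! j)).
      upper le P (xs ! j) \<inter> (\<Union>i<j. upper le P (xs ! i)) = (\<Union>y\<in>Q. upper le P y) \<and>
      (\<exists>ys. recursive_atom_ordering le (upper le P (xs ! j)) ys \<and> Q = set (take (card Q) ys))) \<Longrightarrow>
   recursive_atom_ordering le P xs"

definition has_recursive_atom_ordering :: "('b \<Rightarrow> 'b \<Rightarrow> bool) \<Rightarrow> 'b set \<Rightarrow> bool" where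
  "has_recursive_atom_ordering le P \<longleftrightarrow> (\<exists>xs. recursive_atom_ordering le P xs)"


subsection \<open>Vertex-shellability\<close>

text \<open>\<open>None\<close> is the adjoined top element of the face lattice.\<close>

fun face_le :: "'a signvec option \<Rightarrow> 'a signvec option \<Rightarrow> bool" where
  "face_le _ None = True"
| "face_le None (Some Y) = False"
| "face_le (Some X) (Some Y) = sle X Y"

definition face_lattice :: "'a signvec set \<Rightarrow> 'a signvec option set" where
  "face_lattice L = insert None (Some ` L)"

definition vertex_shellable :: "'a signvec set \<Rightarrow> bool" where
  "vertex_shellable L \<longleftrightarrow> has_recursive_atom_ordering face_le (face_lattice L)"

definition tope_cell :: "'a signvec set \<Rightarrow> 'a signvec \<Rightarrow> 'a signvec set" where
  "tope_cell L T = {X \<in> L. sle X T}"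

definition vertex_shellable_cell :: "'a signvec set \<Rightarrow> 'a signvec \<Rightarrow> bool" where
  "vertex_shellable_cell L T \<longleftrightarrow> has_recursive_atom_ordering sle (tope_cell L T)"

end

(* If f is a coloop, deleting it amounts to contracting it; otherwise only the zero covector of L
   vanishes on E - {f}. So let gs list E - {f}, and let es list E. The first nonzero entry along es
   serves as a generic linear objective. By Euclideanness, the graph of every program (L, g, e) with e
   in es has no directed cycle, so the graph directed by the generic objective is acyclic.

   Sort the cocircuits first by the sign of the objective (negative first). Among the negative ones,
   those whose first nonzero element of gs comes last are put first; among the positive ones, those
   whose first nonzero element of gs comes first. Ties are broken by reachability in the graph for that
   element g of gs. No cell crosses the hyperplane g = 0, so within a cell this is a sweep by pseudo-
   hyperplanes. As in linear programming, a vertex X of a cell F that is not the first vertex of F has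
   an edge in F to an earlier vertex.

   The link of X is the contraction by g, restricted to the zero set of X. With the induced list of
   elements and the same objective, the edges from X to earlier vertices form an initial segment of the
   order of the link, and so the recursion goes through. *)

theory Submission
  imports Defs
begin

text \<open>Cocircuits of the deletion stay covectors of \<open>L\<close> and are compared only on
  \<open>gs\<close>, because Euclideanness speaks about programs of \<open>L\<close>, also about
  those that involve \<open>f\<close>. A link is likewise a subset of \<open>L\<close>: its forward
  edges are forward edges of \<open>L\<close>, so acyclicity and the generic objective pass to it. A
  single hyperplane \<open>g\<close> would not order the vertices lying on \<open>g\<close>, which
  is why a whole list \<open>gs\<close> is used. Let \<open>g\<close> stand at position
  \<open>k\<close> and be the first element of \<open>gs\<close> at which \<open>X\<close> is
  nonzero. The elements before \<open>g\<close> keep their positions in the link, since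
  \<open>X\<close> vanishes on them. A direction that is nonzero on one of them leads into an
  earlier block of \<open>gs\<close>; with the reversed block order on the negative side, this edge
  descends if \<open>X\<close> is positive and ascends if \<open>X\<close> is negative, whatever the
  sign of the direction. The other directions descend exactly when the objective is negative on
  them. In terms of \<open>key\<close>, sign times (index + 1), both rules together become one upper
  bound: \<open>k + 1\<close> for positive and \<open>- k\<close> for negative \<open>X\<close>.
  Hence the descending edges form an initial segment of the link.\<close>

lemma signD: "X \<in> sign_vectors E \<Longrightarrow> X e = -1 \<or> X e = 0 \<or> X e = 1"
  by (cases "e \<in> E") (auto simp: sign_vectors_def)

lemma sle_zero: "sle X Y \<Longrightarrow> Y e = 0 \<Longrightarrow> X e = 0"
  unfolding sle_def by metis

lemma sle_eq: "sle X Y \<Longrightarrow> X e \<noteq> 0 \<Longrightarrow> Y e = X e"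
  unfolding sle_def by metis

section \<open>Covectors: elimination and finiteness\<close>

context oriented_matroid
begin

lemma covector_cases: "X \<in> L \<Longrightarrow> X e = -1 \<or> X e = 0 \<or> X e = 1"
  by (rule signD[OF subsetD[OF covectors_sign]])

lemma covector_outside: "X \<in> L \<Longrightarrow> e \<notin> E \<Longrightarrow> X e = 0"
  using covectors_sign by (auto simp: sign_vectors_def)

lemma covector_eq_or_neg: "X \<in> L \<Longrightarrow> Y \<in> L \<Longrightarrow> X e \<noteq> 0 \<Longrightarrow> Y e \<noteq> 0 \<Longrightarrow> Y e = X e \<or> Y e = - X e"
  using covector_cases[of X e] covector_cases[of Y e] by auto

lemma elimination:
  assumes "X \<in> L" "Y \<in> L" "X e = - Y e" "X e \<noteq> 0"
  obtains Z where "Z \<in> L" "Z e = 0"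
    "\<And>h. X h \<noteq> - Y h \<or> X h = 0 \<Longrightarrow> Z h = (if X h \<noteq> 0 then X h else Y h)"
proof -
  have "e \<in> sep X Y" using assms by (simp add: sep_def)
  then obtain Z where Z: "Z \<in> L" "Z e = 0" "\<forall>h\<in>E - sep X Y. Z h = compose X Y h"
    using elim_covector assms by blast
  show ?thesis
  proof (rule that[OF Z(1,2)])
    fix h assume h: "X h \<noteq> - Y h \<or> X h = 0"
    show "Z h = (if X h \<noteq> 0 then X h else Y h)"
    proof (cases "h \<in> E")
      case True
      then have "h \<in> E - sep X Y" using h by (simp add: sep_def)
      then show ?thesis using Z(3) by (simp add: compose_def)
    next
      case False
      then show ?thesis
        using covector_outside[of X h] covector_outside[of Y h] covector_outside[of Z h] assms(1,2) Z(1)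
        by simp
    qed
  qed
qed

lemma finite_covectors: "finite L"
proof -
  have "finite {X. \<forall>e. (e \<in> E \<longrightarrow> X e \<in> {-1,0,1::int}) \<and> (e \<notin> E \<longrightarrow> X e = 0)}"
    by (rule finite_set_of_finite_funs) (simp_all add: finite_ground)
  moreover have "sign_vectors E \<subseteq> {X. \<forall>e. (e \<in> E \<longrightarrow> X e \<in> {-1,0,1::int}) \<and> (e \<notin> E \<longrightarrow> X e = 0)}"
    by (auto simp: sign_vectors_def)
  ultimately show ?thesis using covectors_sign by (meson finite_subset subset_trans)
qed

subsection \<open>Matroid rank\<close>

lemma closure_iff:
  assumes "S \<subseteq> E"
  shows "e \<in> closure_om E L S \<longleftrightarrow> e \<in> E \<and> (\<forall>X\<in>L. (\<forall>s\<in>S. X s = 0) \<longrightarrow> X e = 0)"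
proof
  assume e: "e \<in> closure_om E L S"
  have *: "e \<in> zset E X" if "X \<in> L" "\<forall>s\<in>S. X s = 0" for X
    using e that assms by (auto simp: closure_om_def flat_def zset_def)
  show "e \<in> E \<and> (\<forall>X\<in>L. (\<forall>s\<in>S. X s = 0) \<longrightarrow> X e = 0)"
    using * *[OF zero_covector] by (auto simp: zset_def zero_vec_def)
qed (auto simp: closure_om_def flat_def zset_def)

lemma closure_extensive: "S \<subseteq> E \<Longrightarrow> S \<subseteq> closure_om E L S"
  by (auto simp: closure_iff)

lemma closure_mono: "S \<subseteq> T \<Longrightarrow> closure_om E L S \<subseteq> closure_om E L T"
  by (auto simp: closure_om_def)

lemma closure_subset_ground: "S \<subseteq> E \<Longrightarrow> closure_om E L S \<subseteq> E"
  by (auto simp: closure_iff)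

lemma closure_least:
  assumes "S \<subseteq> closure_om E L T" "T \<subseteq> E"
  shows "closure_om E L S \<subseteq> closure_om E L T"
proof -
  have "S \<subseteq> E" using assms closure_subset_ground by blast
  then show ?thesis using assms by (auto simp: closure_iff subset_iff)
qed

text \<open>If the exchange failed, covectors \<open>X\<close> and \<open>Y\<close> would vanish on
  \<open>S\<close> with \<open>X x\<close> nonzero, \<open>Y x\<close> zero and both nonzero at
  \<open>b\<close>. Eliminating \<open>b\<close> gives a covector that vanishes on
  \<open>insert b S\<close> but not at \<open>x\<close>.\<close>

lemma closure_exchange:
  assumes "S \<subseteq> E" "b \<in> E" and x: "x \<notin> closure_om E L S" "x \<in> closure_om E L (insert b S)"
  shows "b \<in> closure_om E L (insert x S)"
proof (rule ccontr)
  have xE: "x \<in> E" using assms closure_subset_ground[of "insert b S"] by blast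
  assume "b \<notin> closure_om E L (insert x S)"
  then obtain Y where Y: "Y \<in> L" "\<forall>s\<in>S. Y s = 0" "Y x = 0" "Y b \<noteq> 0"
    using assms xE by (auto simp: closure_iff)
  obtain X where X: "X \<in> L" "\<forall>s\<in>S. X s = 0" "X x \<noteq> 0"
    using assms xE by (auto simp: closure_iff)
  have Xb: "X b \<noteq> 0" using X x(2) assms by (auto simp: closure_iff)
  define Y' where "Y' = (if X b = Y b then - Y else Y)"
  have Y': "Y' \<in> L" "\<forall>s\<in>S. Y' s = 0" "Y' x = 0" "X b = - Y' b"
    using Y neg_covector covector_eq_or_neg[OF X(1) Y(1) Xb Y(4)] by (auto simp: Y'_def)
  obtain Z where Z: "Z \<in> L" "Z b = 0"
    "\<And>h. X h \<noteq> - Y' h \<or> X h = 0 \<Longrightarrow> Z h = (if X h \<noteq> 0 then X h else Y' h)"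
    using elimination[OF X(1) Y'(1,4) Xb] by blast
  have "\<forall>s\<in>insert b S. Z s = 0" using Z X Y' by auto
  then have "Z x = 0" using x(2) Z(1) assms by (auto simp: closure_iff)
  moreover have "Z x = X x" using Z(3)[of x] X Y' by auto
  ultimately show False using X by simp
qed

text \<open>Steinitz exchange: an element of \<open>B - J\<close> is dropped if the rest still spans
  \<open>J\<close>, and otherwise replaced by an element of \<open>J\<close> outside the closure of
  the rest.\<close>

lemma indep_card_le:
  assumes "finite B" "B \<subseteq> E" "indep_om E L J" "J \<subseteq> closure_om E L B"
  shows "card J \<le> card B"
  using assms
proof (induction "card (B - J)" arbitrary: B rule: less_induct)
  case less
  have finJ: "finite J"
    using less.prems(3) finite_ground finite_subset by (auto simp: indep_om_def)
  show ?case
  proof (cases "B \<subseteq> J")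
    case True
    have "J \<subseteq> B"
    proof
      fix x assume x: "x \<in> J"
      show "x \<in> B"
      proof (rule ccontr)
        assume "x \<notin> B"
        then have "closure_om E L B \<subseteq> closure_om E L (J - {x})"
          using True by (intro closure_mono) auto
        then show False using x less.prems by (auto simp: indep_om_def)
      qed
    qed
    then show ?thesis using less.prems(1) by (simp add: card_mono)
  next
    case False
    then obtain b where b: "b \<in> B" "b \<notin> J" by blast
    have smaller: "card (B - {b} - J) < card (B - J)"
      using b less.prems(1) by (intro psubset_card_mono) auto
    show ?thesis
    proof (cases "J \<subseteq> closure_om E L (B - {b})")
      case True
      have "card J \<le> card (B - {b})"
        using smaller True less.prems by (intro less.hyps) auto
      then show ?thesis using b less.prems(1) by (meson card_Diff1_le le_trans)
    next
      case False
      then obtain x where x: "x \<in> J" "x \<notin> closure_om E L (B - {b})" by blast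
      define B' where "B' = insert x (B - {b})"
      have xE: "x \<in> E" using x less.prems by (auto simp: indep_om_def)
      have ins: "insert b (B - {b}) = B" using b by auto
      have "b \<in> closure_om E L B'"
        unfolding B'_def
      proof (rule closure_exchange)
        show "B - {b} \<subseteq> E" "b \<in> E" using b less.prems(2) by auto
        show "x \<notin> closure_om E L (B - {b})" by (rule x(2))
        show "x \<in> closure_om E L (insert b (B - {b}))" using ins x(1) less.prems(4) by auto
      qed
      moreover have B'E: "B' \<subseteq> E" using less.prems xE by (auto simp: B'_def)
      ultimately have "B \<subseteq> closure_om E L B'"
        using closure_extensive[OF B'E] by (auto simp: B'_def)
      then have J: "J \<subseteq> closure_om E L B'"
        using closure_least[OF _ B'E] less.prems by blast
      have "B - {b} \<subseteq> closure_om E L (B - {b})"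
        using less.prems(2) by (intro closure_extensive) auto
      then have "x \<notin> B - {b}" using x(2) by auto
      then have card: "card B' = card B"
        using card.remove[OF less.prems(1) b(1)] less.prems(1) by (simp add: B'_def)
      have "B' - J = B - {b} - J" using x by (auto simp: B'_def)
      then have "card J \<le> card B'"
        using smaller J B'E less.prems by (intro less.hyps) (auto simp: B'_def)
      then show ?thesis using card by simp
    qed
  qed
qed

lemma indep_insert:
  assumes "indep_om E L I" "x \<in> E" "x \<notin> closure_om E L I"
  shows "indep_om E L (insert x I)"
proof -
  have IE: "I \<subseteq> E" using assms by (simp add: indep_om_def)
  have xI: "x \<notin> I" using closure_extensive[OF IE] assms by blast
  have "e \<notin> closure_om E L (insert x I - {e})" if e: "e \<in> I" for e
  proof
    assume a: "e \<in> closure_om E L (insert x I - {e})"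
    have eq: "insert x I - {e} = insert x (I - {e})" "insert e (I - {e}) = I"
      using e xI by auto
    have "x \<in> closure_om E L (insert e (I - {e}))"
    proof (rule closure_exchange)
      show "I - {e} \<subseteq> E" "x \<in> E" using IE assms(2) by auto
      show "e \<notin> closure_om E L (I - {e})" using e assms(1) by (simp add: indep_om_def)
      show "e \<in> closure_om E L (insert x (I - {e}))" using a eq(1) by simp
    qed
    then show False using assms eq by simp
  qed
  moreover have "insert x I - {x} = I" using xI by auto
  ultimately show ?thesis using assms IE by (auto simp: indep_om_def)
qed

lemma indep_empty: "indep_om E L {}"
  by (simp add: indep_om_def)

lemma basis_exists:
  assumes "S \<subseteq> E"
  obtains I where "I \<subseteq> S" "indep_om E L I" "card I = rank_om E L S" "S \<subseteq> closure_om E L I"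
proof -
  define F where "F = {I. I \<subseteq> S \<and> indep_om E L I}"
  have finS: "finite S" using assms finite_ground finite_subset by blast
  have fin: "finite F" using finS by (auto simp: F_def)
  have "{} \<in> F" by (simp add: F_def indep_empty)
  then have "Max (card ` F) \<in> card ` F" using fin by (intro Max_in) auto
  then obtain I where I: "I \<in> F" "card I = Max (card ` F)" by auto
  have "S \<subseteq> closure_om E L I"
  proof
    fix x assume x: "x \<in> S"
    show "x \<in> closure_om E L I"
    proof (rule ccontr)
      assume n: "x \<notin> closure_om E L I"
      then have "insert x I \<in> F"
        using indep_insert[of I x] I x assms by (auto simp: F_def)
      then have "card (insert x I) \<le> card I" using fin I(2) by simp
      moreover have "x \<notin> I" using n closure_extensive[of I] I assms by (auto simp: F_def)
      moreover have "finite I" using I finS finite_subset by (auto simp: F_def)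
      ultimately show False by simp
    qed
  qed
  then show ?thesis using that I by (auto simp: F_def rank_om_def)
qed

lemma rank_eqI:
  assumes "I \<subseteq> S" "indep_om E L I" "S \<subseteq> closure_om E L I"
  shows "rank_om E L S = card I"
proof -
  have IE: "I \<subseteq> E" using assms by (simp add: indep_om_def)
  have SE: "S \<subseteq> E" using assms closure_subset_ground[OF IE] by blast
  obtain J where J: "J \<subseteq> S" "indep_om E L J" "card J = rank_om E L S" "S \<subseteq> closure_om E L J"
    using basis_exists[OF SE] .
  have fin: "finite I" "finite J" using finite_ground IE J SE by (meson finite_subset subset_trans)+
  have "card I \<le> card J" using indep_card_le[of J I] J assms fin SE by blast
  moreover have "card J \<le> card I" using indep_card_le[of I J] J assms fin SE by blast
  ultimately show ?thesis using J by simp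
qed

text \<open>Eliminating between \<open>V\<close> and \<open>Y\<close> shrinks their separation and creates a new zero inside
  \<open>supp Y\<close>; iterating yields a covector conformal with \<open>Y\<close>.\<close>

lemma conformal_below:
  assumes "V \<in> L" "Y \<in> L" "\<And>h. Y h = 0 \<Longrightarrow> V h = 0" "X \<in> L" "sle X Y" "\<And>h. X h \<noteq> 0 \<Longrightarrow> V h = Y h"
    "V a \<noteq> 0" "X a = 0" "V b = 0" "Y b \<noteq> 0"
  shows "\<exists>U\<in>L. sle X U \<and> sle U Y \<and> U \<noteq> X \<and> U \<noteq> Y"
  using assms
proof (induction "card (sep V Y)" arbitrary: V a b rule: less_induct)
  case less
  show ?case
  proof (cases "sep V Y = {}")
    case True
    have "sle V Y" unfolding sle_def
    proof
      fix h
      have "h \<notin> sep V Y" using True by simp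
      then show "V h = 0 \<or> V h = Y h"
        using less.prems(3)[of h] covector_eq_or_neg[OF less.prems(1,2), of h]
        unfolding sep_def by fastforce
    qed
    moreover have "sle X V" using less.prems(5,6) unfolding sle_def by metis
    moreover have "V \<noteq> X" "V \<noteq> Y" using less.prems(7-10) by auto
    ultimately show ?thesis using less.prems(1) by blast
  next
    case False
    then obtain e where e: "V e = - Y e" "V e \<noteq> 0" by (auto simp: sep_def)
    obtain Z where Z: "Z \<in> L" "Z e = 0"
      "\<And>h. V h \<noteq> - Y h \<or> V h = 0 \<Longrightarrow> Z h = (if V h \<noteq> 0 then V h else Y h)"
      using elimination[OF less.prems(1,2) e] by blast
    have fin: "finite (sep V Y)"
      using covector_outside[OF less.prems(1)]
      by (intro finite_subset[OF _ finite_ground]) (force simp: sep_def)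
    have "sep Z Y \<subset> sep V Y"
    proof
      show "sep Z Y \<subseteq> sep V Y"
      proof
        fix h assume h: "h \<in> sep Z Y"
        show "h \<in> sep V Y"
        proof (rule ccontr)
          assume "h \<notin> sep V Y"
          then have "V h \<noteq> - Y h \<or> V h = 0" by (auto simp: sep_def)
          then show False using Z(3)[of h] h by (auto simp: sep_def split: if_splits)
        qed
      qed
      have "e \<in> sep V Y" "e \<notin> sep Z Y" using e Z(2) by (simp_all add: sep_def)
      then show "sep Z Y \<noteq> sep V Y" by blast
    qed
    then have "card (sep Z Y) < card (sep V Y)" using fin psubset_card_mono by blast
    moreover have "Z b = Y b" using Z(3)[of b] less.prems by simp
    moreover have "X b = 0" using less.prems(6)[of b] less.prems by auto
    moreover have "Z h = 0" if "Y h = 0" for h using Z(3)[of h] that less.prems(3)[of h] by auto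
    moreover have "Z h = Y h" if "X h \<noteq> 0" for h
    proof -
      have "X h = Y h" using that sle_eq[OF less.prems(5)] by simp
      then show ?thesis using Z(3)[of h] that less.prems(6)[of h] by auto
    qed
    moreover have "Y e \<noteq> 0" using e by simp
    ultimately show ?thesis
      using less.hyps[of Z b e] Z(1,2) less.prems(2,4,5,10) by simp
  qed
qed

text \<open>A basis of the zero set of \<open>Y\<close> together with one \<open>e\<close> such that
  \<open>X e = 0\<close> and \<open>Y e\<close> is nonzero is a basis of the zero set of
  \<open>X\<close>: otherwise \<open>conformal_below\<close> would produce a covector strictly
  between \<open>X\<close> and \<open>Y\<close>.\<close>

lemma rank_cover:
  assumes "X \<in> L" "Y \<in> L" "sle X Y" "X \<noteq> Y"
    and cover: "\<And>V. V \<in> L \<Longrightarrow> sle X V \<Longrightarrow> sle V Y \<Longrightarrow> V = X \<or> V = Y"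
  shows "rank_om E L (zset E X) = Suc (rank_om E L (zset E Y))"
proof -
  obtain I where I: "I \<subseteq> zset E Y" "indep_om E L I" "card I = rank_om E L (zset E Y)"
    "zset E Y \<subseteq> closure_om E L I"
    using basis_exists[of "zset E Y"] by (auto simp: zset_def)
  have IE: "I \<subseteq> E" using I(2) by (simp add: indep_om_def)
  obtain e where "X e \<noteq> Y e" using assms(4) by (meson ext)
  then have e: "X e = 0" "Y e \<noteq> 0" using assms(3) unfolding sle_def by metis+
  have eE: "e \<in> E" using e covector_outside[OF assms(2)] by metis
  have enI: "e \<notin> closure_om E L I" using I(1) e assms(2) IE by (auto simp: closure_iff zset_def)
  have "rank_om E L (zset E X) = card (insert e I)"
  proof (rule rank_eqI)
    show "insert e I \<subseteq> zset E X" using I(1) e eE sle_zero[OF assms(3)] by (auto simp: zset_def)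
    show "indep_om E L (insert e I)" using indep_insert I eE enI by blast
    show "zset E X \<subseteq> closure_om E L (insert e I)"
    proof
      fix x assume x: "x \<in> zset E X"
      have "V x = 0" if V: "V \<in> L" "\<forall>s\<in>insert e I. V s = 0" for V
      proof (rule ccontr)
        assume Vx: "V x \<noteq> 0"
        have VY: "V h = 0" if "Y h = 0" for h
        proof (cases "h \<in> E")
          case True
          then have "h \<in> closure_om E L I" using I(4) that by (auto simp: zset_def)
          then show ?thesis using V IE by (auto simp: closure_iff)
        qed (rule covector_outside[OF V(1)])
        \<comment> \<open>Composing with \<open>X\<close> forces agreement with \<open>Y\<close> on
          the support of \<open>X\<close>; \<open>x\<close> and \<open>e\<close> are the
          \<open>a\<close> and \<open>b\<close> of \<open>conformal_below\<close>.\<close>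
        let ?V = "compose X V"
        have XV: "?V \<in> L" using assms V compose_covector by blast
        have "\<exists>U\<in>L. sle X U \<and> sle U Y \<and> U \<noteq> X \<and> U \<noteq> Y"
        proof (rule conformal_below[of ?V])
          show "?V x \<noteq> 0" "X x = 0" "?V e = 0" "Y e \<noteq> 0"
            using Vx x e V by (auto simp: compose_def zset_def)
          show "?V h = 0" if "Y h = 0" for h
            using that VY[of h] sle_zero[OF assms(3), of h] by (simp add: compose_def)
          show "?V h = Y h" if "X h \<noteq> 0" for h
            using that sle_eq[OF assms(3), of h] by (simp add: compose_def)
        qed (use assms XV in auto)
        then show False using cover by blast
      qed
      then show "x \<in> closure_om E L (insert e I)"
        using x IE eE by (auto simp: closure_iff zset_def)
    qed
  qed
  moreover have "e \<notin> I" using enI closure_extensive[OF IE] by blast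
  moreover have "finite I" using IE finite_ground finite_subset by blast
  ultimately show ?thesis using I by simp
qed

text \<open>Composing a maximal \<open>T\<close> with any covector changes nothing, so all covectors
  vanish on the zero set of \<open>T\<close>, which therefore consists of loops.\<close>

lemma rank_tope:
  assumes "T \<in> L" "\<And>V. V \<in> L \<Longrightarrow> sle T V \<Longrightarrow> V = T"
  shows "rank_om E L (zset E T) = 0"
proof -
  have "V x = 0" if "T x = 0" "V \<in> L" for V x
  proof -
    have "compose T V = T"
      using assms that compose_covector by (auto simp: sle_def compose_def)
    then have "compose T V x = T x" by simp
    then show ?thesis using that by (simp add: compose_def)
  qed
  then have "rank_om E L (zset E T) = card ({} :: 'a set)"
    using assms(1) by (intro rank_eqI) (auto simp: indep_empty closure_iff zset_def)
  then show ?thesis by simp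
qed

end

subsection \<open>Graded posets\<close>

lemma chain_iff:
  "reflp_on P le \<Longrightarrow> pred_on.chain P le C \<longleftrightarrow> C \<subseteq> P \<and> (\<forall>x\<in>C. \<forall>y\<in>C. le x y \<or> le y x)"
  by (auto simp: pred_on.chain_def reflp_on_def subset_iff)

lemma maxchainD:
  assumes "reflp_on P le" "pred_on.maxchain P le C"
  shows "C \<subseteq> P" "\<And>x y. x \<in> C \<Longrightarrow> y \<in> C \<Longrightarrow> le x y \<or> le y x"
    "\<And>z. z \<in> P \<Longrightarrow> (\<And>x. x \<in> C \<Longrightarrow> le x z \<or> le z x) \<Longrightarrow> z \<in> C"
proof -
  have C: "pred_on.chain P le C" using assms(2) by (simp add: pred_on.maxchain_def)
  then show sub: "C \<subseteq> P" and cmp: "\<And>x y. x \<in> C \<Longrightarrow> y \<in> C \<Longrightarrow> le x y \<or> le y x"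
    using assms(1) by (auto simp: chain_iff)
  fix z assume z: "z \<in> P" "\<And>x. x \<in> C \<Longrightarrow> le x z \<or> le z x"
  have "le z z" using assms(1) z(1) by (simp add: reflp_on_def)
  then have "pred_on.chain P le (insert z C)"
    using z sub cmp by (auto simp: chain_iff[OF assms(1)])
  then show "z \<in> C" using assms(2) unfolding pred_on.maxchain_def by blast
qed

text \<open>Consecutive elements of a maximal chain are covers, so \<open>h\<close> falls by one at
  each step from \<open>b\<close> to \<open>t\<close>. A falling \<open>h\<close> suits the face
  lattice, where larger faces have smaller zero sets.\<close>

lemma maxchain_card:
  fixes h :: "'b \<Rightarrow> nat"
  assumes fin: "finite P" and refl: "reflp_on P le" and trans: "transp_on P le"
    and anti: "antisymp_on P le"
    and b: "is_least le P b" and t: "is_greatest le P t"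
    and cov: "\<And>x y. covers le P y x \<Longrightarrow> h x = Suc (h y)"
    and C: "pred_on.maxchain P le C"
  shows "card C = Suc (h b) - h t"
proof -
  note CD = maxchainD[OF refl C]
  have finC: "finite C" using CD(1) fin finite_subset by blast
  have bP: "b \<in> P" "\<And>x. x \<in> P \<Longrightarrow> le b x" and tP: "t \<in> P" "\<And>x. x \<in> P \<Longrightarrow> le x t"
    using b t by (auto simp: is_least_def is_greatest_def)
  have bC: "b \<in> C" using CD bP by blast
  have tC: "t \<in> C" using CD tP by blast
  define up where "up x = {y \<in> C. le x y \<and> x \<noteq> y}" for x
  have tr: "le x z" if "le x y" "le y z" "x \<in> P" "y \<in> P" "z \<in> P" for x y z
    using trans that by (auto dest: transp_onD)
  have an: "x = y" if "le x y" "le y x" "x \<in> P" "y \<in> P" for x y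
    using anti that by (auto dest: antisymp_onD)
  have le_refl: "le x x" if "x \<in> P" for x using refl that by (simp add: reflp_on_def)
  have succ: "\<exists>y\<in>C. le x y \<and> h x = Suc (h y) \<and> up x = insert y (up y) \<and> y \<notin> up y"
    if x: "x \<in> C" "x \<noteq> t" for x
  proof -
    have xP: "x \<in> P" using x CD(1) by blast
    have "t \<in> up x" using x tC tP xP by (simp add: up_def)
    moreover have "finite (up x)" using finC by (simp add: up_def)
    moreover have "asymp_on (up x) (\<lambda>a b. le a b \<and> a \<noteq> b)"
    proof (rule asymp_onI)
      fix a b assume "a \<in> up x" "b \<in> up x" "le a b \<and> a \<noteq> b"
      then show "\<not> (le b a \<and> b \<noteq> a)" using an[of a b] CD(1) by (auto simp: up_def)
    qed
    moreover have "transp_on (up x) (\<lambda>a b. le a b \<and> a \<noteq> b)"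
    proof (rule transp_onI)
      fix a b c assume "a \<in> up x" "b \<in> up x" "c \<in> up x" and
        le: "le a b \<and> a \<noteq> b" "le b c \<and> b \<noteq> c"
      then have P: "a \<in> P" "b \<in> P" "c \<in> P" using CD(1) by (auto simp: up_def)
      show "le a c \<and> a \<noteq> c" using tr[of a b c] an[of a b] P le by blast
    qed
    \<comment> \<open>This is the successor of \<open>x\<close> in the chain; maximality of
      \<open>C\<close> will make it a cover of \<open>x\<close> in all of \<open>P\<close>.\<close>
    ultimately have "\<exists>y\<in>up x. \<forall>z\<in>up x. z \<noteq> y \<longrightarrow> \<not> (le z y \<and> z \<noteq> y)"
      by (intro Finite_Set.bex_min_element) auto
    then obtain y where y: "y \<in> C" "le x y" "x \<noteq> y" and ymin: "\<And>z. z \<in> up x \<Longrightarrow> le z y \<Longrightarrow> z = y"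
      unfolding up_def by auto
    have yP: "y \<in> P" using y CD(1) by blast
    have above: "le y z" if "z \<in> up x" for z
      using that ymin[of z] CD(2)[OF y(1), of z] by (auto simp: up_def)
    have "covers le P y x" unfolding covers_def
    proof (intro conjI ballI impI)
      fix z assume z: "z \<in> P" "le x z \<and> le z y"
      have "z \<in> C"
      proof (rule CD(3)[OF z(1)])
        fix w assume w: "w \<in> C"
        then have wP: "w \<in> P" using CD(1) by blast
        show "le w z \<or> le z w"
        proof (cases "le w x")
          case True
          then show ?thesis using tr[of w x z] z xP wP by blast
        next
          case False
          then have "w \<in> up x" using CD(2)[OF w x(1)] w by (auto simp: up_def le_refl xP)
          then show ?thesis using above tr[of z y w] z yP wP by blast
        qed
      qed
      then show "z = x \<or> z = y" using ymin[of z] z by (auto simp: up_def)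
    qed (use xP yP y in auto)
    moreover have "up x = insert y (up y)"
    proof (rule set_eqI)
      fix z
      show "z \<in> up x \<longleftrightarrow> z \<in> insert y (up y)"
      proof
        assume "z \<in> up x"
        then show "z \<in> insert y (up y)" using above[of z] by (auto simp: up_def)
      next
        assume z: "z \<in> insert y (up y)"
        have "z \<in> P" using z yP CD(1) by (auto simp: up_def)
        then show "z \<in> up x"
          using z y xP yP tr[of x y z] an[of x y] by (auto simp: up_def)
      qed
    qed
    moreover have "y \<notin> up y" by (simp add: up_def)
    ultimately show ?thesis using cov y by blast
  qed
  have "h x = h t + card (up x)" if "x \<in> C" for x
    using that
  proof (induction "card (up x)" arbitrary: x rule: less_induct)
    case less
    show ?case
    proof (cases "x = t")
      case True
      have "up t = {}" using tP CD(1) an by (auto simp: up_def)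
      then show ?thesis using True by simp
    next
      case False
      obtain y where y: "y \<in> C" "h x = Suc (h y)" "up x = insert y (up y)" "y \<notin> up y"
        using succ[OF less.prems False] by blast
      have "card (up x) = Suc (card (up y))" using y finC by (simp add: up_def)
      then show ?thesis using less.hyps[of y] y by simp
    qed
  qed
  then have "h b = h t + card (up b)" using bC by blast
  moreover have "C = insert b (up b)" "b \<notin> up b"
    using bC bP CD(1) by (auto simp: up_def)
  moreover have "finite (up b)" using finC by (simp add: up_def)
  ultimately show ?thesis by (metis Suc_diff_le add_diff_cancel_left' card_insert_disjoint le_add1)
qed

lemma poset_length_le_2:
  assumes "finite P" "reflp_on P le" "\<And>C. pred_on.chain P le C \<Longrightarrow> card C \<le> 3"
  shows "poset_length le P \<le> 2"
proof -
  have "{C. pred_on.chain P le C} \<subseteq> Pow P" using assms by (auto simp: chain_iff)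
  then have "finite {C. pred_on.chain P le C}" using assms(1) by (meson finite_Pow_iff finite_subset)
  moreover have "{} \<in> {C. pred_on.chain P le C}" using assms by (simp add: chain_iff)
  ultimately show ?thesis unfolding poset_length_def
    by (subst Max_le_iff) (use assms(3) in \<open>fastforce+\<close>)
qed

subsection \<open>Transport along order isomorphisms\<close>

text \<open>An order embedding of \<open>P\<close>, whose image serves as the isomorphic copy. The
  instances are \<open>glue\<close>, from cells of a link onto an upper interval, and
  \<open>the\<close>, which strips \<open>Some\<close> from the faces of a tope cell.\<close>

locale order_iso =
  fixes le :: "'b \<Rightarrow> 'b \<Rightarrow> bool" and P :: "'b set" and le' :: "'c \<Rightarrow> 'c \<Rightarrow> bool" and \<psi> :: "'b \<Rightarrow> 'c"
  assumes iso: "x \<in> P \<Longrightarrow> y \<in> P \<Longrightarrow> le' (\<psi> x) (\<psi> y) \<longleftrightarrow> le x y"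
    and inj: "inj_on \<psi> P"
begin

lemma eq_iff: "x \<in> P \<Longrightarrow> y \<in> P \<Longrightarrow> \<psi> x = \<psi> y \<longleftrightarrow> x = y"
  using inj by (auto dest: inj_onD)

lemma is_least_image: "x \<in> P \<Longrightarrow> is_least le' (\<psi> ` P) (\<psi> x) \<longleftrightarrow> is_least le P x"
  by (auto simp: is_least_def iso)

lemma is_greatest_image: "x \<in> P \<Longrightarrow> is_greatest le' (\<psi> ` P) (\<psi> x) \<longleftrightarrow> is_greatest le P x"
  by (auto simp: is_greatest_def iso)

lemma covers_image:
  "x \<in> P \<Longrightarrow> y \<in> P \<Longrightarrow> covers le' (\<psi> ` P) (\<psi> y) (\<psi> x) \<longleftrightarrow> covers le P y x"
  by (simp add: covers_def iso eq_iff)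

lemma atoms_image: "atoms le' (\<psi> ` P) = \<psi> ` atoms le P"
proof -
  have "y \<in> atoms le' (\<psi> ` P) \<longleftrightarrow> (\<exists>x\<in>P. y = \<psi> x \<and> x \<in> atoms le P)" for y
  proof
    assume "y \<in> atoms le' (\<psi> ` P)"
    then obtain b where b: "is_least le' (\<psi> ` P) b" "covers le' (\<psi> ` P) y b"
      by (auto simp: atoms_def)
    then obtain b' x where "b' \<in> P" "b = \<psi> b'" "x \<in> P" "y = \<psi> x" by (auto simp: covers_def)
    then show "\<exists>x\<in>P. y = \<psi> x \<and> x \<in> atoms le P"
      using b is_least_image covers_image by (auto simp: atoms_def)
  next
    assume "\<exists>x\<in>P. y = \<psi> x \<and> x \<in> atoms le P"
    then obtain x b where x: "x \<in> P" "y = \<psi> x" "is_least le P b" "covers le P x b"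
      by (auto simp: atoms_def)
    then have "b \<in> P" by (simp add: covers_def)
    then show "y \<in> atoms le' (\<psi> ` P)" using x is_least_image covers_image by (auto simp: atoms_def)
  qed
  moreover have "atoms le P \<subseteq> P" by (auto simp: atoms_def covers_def)
  ultimately show ?thesis by auto
qed

lemma upper_image: "x \<in> P \<Longrightarrow> upper le' (\<psi> ` P) (\<psi> x) = \<psi> ` upper le P x"
  by (auto simp: upper_def iso)

lemma order_iso_subset: "R \<subseteq> P \<Longrightarrow> order_iso le R le' \<psi>"
  using inj by unfold_locales (auto simp: iso subset_iff inj_on_def)

lemma chain_image:
  assumes "C \<subseteq> P"
  shows "pred_on.chain (\<psi> ` P) le' (\<psi> ` C) \<longleftrightarrow> pred_on.chain P le C"
proof -
  have "\<psi> x \<noteq> \<psi> y \<longleftrightarrow> x \<noteq> y" "le' (\<psi> x) (\<psi> y) \<longleftrightarrow> le x y" if "x \<in> C" "y \<in> C" for x y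
    using iso[of x y] eq_iff[of x y] subsetD[OF assms that(1)] subsetD[OF assms that(2)] by auto
  then show ?thesis using assms by (auto simp: pred_on.chain_def)
qed

lemma chain_imageD:
  assumes "pred_on.chain (\<psi> ` P) le' D"
  obtains C where "C \<subseteq> P" "D = \<psi> ` C" "pred_on.chain P le C"
proof -
  have "D \<subseteq> \<psi> ` P" using assms by (simp add: pred_on.chain_def)
  then obtain C where "C \<subseteq> P" "D = \<psi> ` C" by (meson subset_image_iff)
  then show ?thesis using that chain_image assms by auto
qed

lemma card_image': "C \<subseteq> P \<Longrightarrow> card (\<psi> ` C) = card C"
  using inj by (meson card_image inj_on_subset)

lemma maxchain_imageD:
  assumes "pred_on.maxchain (\<psi> ` P) le' D"
  obtains C where "D = \<psi> ` C" "pred_on.maxchain P le C" "C \<subseteq> P"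
proof -
  have "pred_on.chain (\<psi> ` P) le' D" using assms by (simp add: pred_on.maxchain_def)
  then obtain C where C: "C \<subseteq> P" "D = \<psi> ` C" "pred_on.chain P le C" by (rule chain_imageD)
  have "\<not> (pred_on.chain P le S \<and> C \<subset> S)" for S
  proof
    assume S: "pred_on.chain P le S \<and> C \<subset> S"
    then have SP: "S \<subseteq> P" by (simp add: pred_on.chain_def)
    then have "pred_on.chain (\<psi> ` P) le' (\<psi> ` S)" using chain_image S by blast
    moreover have "\<psi> ` C \<subset> \<psi> ` S"
      using S C SP inj inj_on_image_eq_iff[OF inj] by (metis image_mono psubset_eq)
    ultimately show False using assms C by (simp add: pred_on.maxchain_def)
  qed
  then show ?thesis using that C by (simp add: pred_on.maxchain_def)
qed

lemma graded_poset_image: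
  assumes "graded_poset le P"
  shows "graded_poset le' (\<psi> ` P)"
  unfolding graded_poset_def
proof (intro conjI)
  have g: "finite P" "reflp_on P le" "transp_on P le" "antisymp_on P le"
    using assms by (simp_all add: graded_poset_def)
  show "finite (\<psi> ` P)" using g by simp
  show "reflp_on (\<psi> ` P) le'"
  proof (rule reflp_onI, elim imageE)
    fix a x assume "a = \<psi> x" "x \<in> P"
    then show "le' a a" using iso[of x x] reflp_onD[OF g(2)] by simp
  qed
  show "transp_on (\<psi> ` P) le'"
  proof (rule transp_onI, elim imageE)
    fix a b c x y z assume *: "a = \<psi> x" "x \<in> P" "b = \<psi> y" "y \<in> P" "c = \<psi> z" "z \<in> P"
      and "le' a b" "le' b c"
    then have "le x y" "le y z" using iso by simp_all
    then have "le x z" using transp_onD[OF g(3)] * by blast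
    then show "le' a c" using iso * by simp
  qed
  show "antisymp_on (\<psi> ` P) le'"
  proof (rule antisymp_onI, elim imageE)
    fix a b x y assume *: "a = \<psi> x" "x \<in> P" "b = \<psi> y" "y \<in> P" and "le' a b" "le' b a"
    then have "le x y" "le y x" using iso by simp_all
    then show "a = b" using antisymp_onD[OF g(4)] * by blast
  qed
  obtain b t where bt: "is_least le P b" "is_greatest le P t"
    using assms by (auto simp: graded_poset_def)
  then have "b \<in> P" "t \<in> P" by (simp_all add: is_least_def is_greatest_def)
  then show "\<exists>b. is_least le' (\<psi> ` P) b" "\<exists>t. is_greatest le' (\<psi> ` P) t"
    using bt is_least_image is_greatest_image by blast+
  show "\<forall>C D. pred_on.maxchain (\<psi> ` P) le' C \<and> pred_on.maxchain (\<psi> ` P) le' D \<longrightarrow> card C = card D"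
  proof (intro allI impI, elim conjE)
    fix C D assume CD: "pred_on.maxchain (\<psi> ` P) le' C" "pred_on.maxchain (\<psi> ` P) le' D"
    obtain C' where C': "C = \<psi> ` C'" "pred_on.maxchain P le C'" "C' \<subseteq> P"
      using CD(1) by (rule maxchain_imageD)
    obtain D' where D': "D = \<psi> ` D'" "pred_on.maxchain P le D'" "D' \<subseteq> P"
      using CD(2) by (rule maxchain_imageD)
    have "card C' = card D'" using assms C' D' unfolding graded_poset_def by blast
    then show "card C = card D" using C' D' card_image' by simp
  qed
qed

lemma poset_length_image: "poset_length le' (\<psi> ` P) = poset_length le P"
proof -
  have "(\<lambda>C. card C - 1) ` {C. pred_on.chain (\<psi> ` P) le' C} = (\<lambda>C. card C - 1) ` {C. pred_on.chain P le C}"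
    (is "?l = ?r")
  proof (intro subset_antisym subsetI)
    fix n assume "n \<in> ?l"
    then obtain D where D: "pred_on.chain (\<psi> ` P) le' D" "n = card D - 1" by auto
    obtain C where "C \<subseteq> P" "D = \<psi> ` C" "pred_on.chain P le C" using D(1) by (rule chain_imageD)
    then show "n \<in> ?r" using D(2) card_image' by auto
  next
    fix n assume "n \<in> ?r"
    then obtain C where C: "pred_on.chain P le C" "n = card C - 1" by auto
    then have CP: "C \<subseteq> P" by (simp add: pred_on.chain_def)
    have "n = card (\<psi> ` C) - 1" using C(2) card_image'[OF CP] by simp
    moreover have "pred_on.chain (\<psi> ` P) le' (\<psi> ` C)" using C(1) chain_image[OF CP] by simp
    ultimately show "n \<in> ?l" by blast
  qed
  then show ?thesis by (simp add: poset_length_def)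
qed

end

lemma recursive_atom_ordering_image:
  assumes "recursive_atom_ordering le P xs" "order_iso le P le' \<psi>"
  shows "recursive_atom_ordering le' (\<psi> ` P) (map \<psi> xs)"
  using assms
proof (induction rule: recursive_atom_ordering.induct)
  case (1 P xs)
  interpret order_iso le P le' \<psi> by (rule 1)
  have atP: "atoms le R \<subseteq> R" for R by (auto simp: atoms_def covers_def)
  have xsP: "set xs \<subseteq> P" using 1(3) atP by simp
  have up_sub: "upper le P x \<subseteq> P" for x by (auto simp: upper_def)
  have "poset_length le' (\<psi> ` P) \<le> 2 \<or>
   (\<forall>j<length (map \<psi> xs). \<exists>Q \<subseteq> atoms le' (upper le' (\<psi> ` P) (map \<psi> xs ! j)).
      upper le' (\<psi> ` P) (map \<psi> xs ! j) \<inter> (\<Union>i<j. upper le' (\<psi> ` P) (map \<psi> xs ! i)) = (\<Union>y\<in>Q. upper le' (\<psi> ` P) y) \<and>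
      (\<exists>ys. recursive_atom_ordering le' (upper le' (\<psi> ` P) (map \<psi> xs ! j)) ys \<and> Q = set (take (card Q) ys)))"
    using 1(4)
  proof (elim disjE)
    assume "poset_length le P \<le> 2"
    then show ?thesis by (simp add: poset_length_image)
  next
    assume *: "\<forall>j<length xs. \<exists>Q \<subseteq> atoms le (upper le P (xs ! j)).
      upper le P (xs ! j) \<inter> (\<Union>i<j. upper le P (xs ! i)) = (\<Union>y\<in>Q. upper le P y) \<and>
      (\<exists>ys. (recursive_atom_ordering le (upper le P (xs ! j)) ys \<and>
          (order_iso le (upper le P (xs ! j)) le' \<psi> \<longrightarrow>
            recursive_atom_ordering le' (\<psi> ` upper le P (xs ! j)) (map \<psi> ys))) \<and> Q = set (take (card Q) ys))"
    show ?thesis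
    proof (intro disjI2 allI impI)
      fix j assume "j < length (map \<psi> xs)"
      then have j: "j < length xs" by simp
      obtain Q ys where Q: "Q \<subseteq> atoms le (upper le P (xs ! j))"
        "upper le P (xs ! j) \<inter> (\<Union>i<j. upper le P (xs ! i)) = (\<Union>y\<in>Q. upper le P y)"
        and ys: "order_iso le (upper le P (xs ! j)) le' \<psi> \<longrightarrow>
            recursive_atom_ordering le' (\<psi> ` upper le P (xs ! j)) (map \<psi> ys)" "Q = set (take (card Q) ys)"
        using *[rule_format, OF j] by blast
      have xj: "xs ! i \<in> P" if "i \<le> j" for i using xsP j that by auto
      have up: "upper le' (\<psi> ` P) (map \<psi> xs ! i) = \<psi> ` upper le P (xs ! i)" if "i \<le> j" for i
        using upper_image xj that j by simp
      have QP: "Q \<subseteq> P" using Q(1) atP up_sub by blast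
      have iso_up: "order_iso le (upper le P (xs ! j)) le' \<psi>"
        using order_iso_subset up_sub by blast
      have "\<psi> ` Q \<subseteq> atoms le' (upper le' (\<psi> ` P) (map \<psi> xs ! j))"
        using order_iso.atoms_image[OF iso_up] Q(1) up by auto
      moreover have "upper le' (\<psi> ` P) (map \<psi> xs ! j) \<inter> (\<Union>i<j. upper le' (\<psi> ` P) (map \<psi> xs ! i))
          = \<psi> ` (upper le P (xs ! j) \<inter> (\<Union>i<j. upper le P (xs ! i)))"
      proof -
        have "(\<Union>i<j. upper le' (\<psi> ` P) (map \<psi> xs ! i)) = (\<Union>i<j. \<psi> ` upper le P (xs ! i))"
          using up by (intro SUP_cong) auto
        also have "\<dots> = \<psi> ` (\<Union>i<j. upper le P (xs ! i))" by (simp add: image_UN)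
        finally show ?thesis
          using up[of j] inj_on_image_Int[OF inj, of "upper le P (xs ! j)" "\<Union>i<j. upper le P (xs ! i)"] up_sub
          by (simp add: UN_subset_iff)
      qed
      moreover have "\<psi> ` (\<Union>y\<in>Q. upper le P y) = (\<Union>y\<in>\<psi> ` Q. upper le' (\<psi> ` P) y)"
        using QP upper_image by (auto simp: image_UN subset_iff)
      moreover have "\<psi> ` Q = set (take (card (\<psi> ` Q)) (map \<psi> ys))"
        using ys(2) card_image'[OF QP] by (metis set_map take_map)
      ultimately show "\<exists>Q \<subseteq> atoms le' (upper le' (\<psi> ` P) (map \<psi> xs ! j)).
        upper le' (\<psi> ` P) (map \<psi> xs ! j) \<inter> (\<Union>i<j. upper le' (\<psi> ` P) (map \<psi> xs ! i)) = (\<Union>y\<in>Q. upper le' (\<psi> ` P) y) \<and>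
        (\<exists>ys. recursive_atom_ordering le' (upper le' (\<psi> ` P) (map \<psi> xs ! j)) ys \<and> Q = set (take (card Q) ys))"
        using ys(1) iso_up Q(2) up[of j] by (intro exI[of _ "\<psi> ` Q"]) auto
    qed
  qed
  moreover have "distinct (map \<psi> xs)" using 1(2) inj xsP by (simp add: distinct_map inj_on_subset)
  moreover have "set (map \<psi> xs) = atoms le' (\<psi> ` P)" using 1(3) atoms_image by simp
  ultimately show ?case using graded_poset_image[OF 1(1)] by (intro recursive_atom_ordering.intros) auto
qed

text \<open>Topological sorting: an element of \<open>S\<close> without predecessors in
  \<open>S\<close> goes first.\<close>

lemma finite_acyclic_enumeration:
  assumes "finite S" "acyclic r"
  shows "\<exists>xs. distinct xs \<and> set xs = S \<and> (\<forall>j<length xs. \<forall>i<j. (xs ! j, xs ! i) \<notin> r)"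
  using assms(1)
proof (induction "card S" arbitrary: S)
  case 0
  then show ?case by (intro exI[of _ "[]"]) auto
next
  case (Suc n)
  let ?r = "r \<inter> S \<times> S"
  \<comment> \<open>\<open>r\<close> may be infinite, as \<open>earlier\<close> relates arbitrary
    functions; finiteness, and with it well-foundedness, comes from the restriction to
    \<open>S\<close>.\<close>
  have "wf ?r"
    using Suc.prems assms(2) by (intro finite_acyclic_wf) (auto intro: acyclic_subset)
  moreover obtain s where "s \<in> S" using Suc.hyps(2) by fastforce
  ultimately obtain m where m: "m \<in> S" "\<And>y. (y, m) \<in> ?r \<Longrightarrow> y \<notin> S"
    by (metis wfE_min)
  have "n = card (S - {m})" using Suc.hyps(2) m(1) Suc.prems by simp
  then obtain xs where xs: "distinct xs" "set xs = S - {m}" "\<forall>j<length xs. \<forall>i<j. (xs ! j, xs ! i) \<notin> r"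
    using Suc.hyps(1)[of "S - {m}"] Suc.prems by blast
  have "((m # xs) ! j, (m # xs) ! i) \<notin> r" if "j < length (m # xs)" "i < j" for i j
  proof (cases i)
    case 0
    obtain j' where "j = Suc j'" using \<open>i < j\<close> by (auto elim: lessE)
    then have j': "j = Suc j'" "j' < length xs" using that by simp_all
    then have "xs ! j' \<in> S" using xs(2) nth_mem by blast
    then show ?thesis using 0 j'(1) m(1) m(2)[of "xs ! j'"] by auto
  next
    case (Suc i')
    then show ?thesis using that xs(3) by (cases j) auto
  qed
  then show ?case
    by (intro exI[of _ "m # xs"] conjI allI impI) (use xs m(1) in auto)
qed

subsection \<open>Minimal covectors relative to a spanning set\<close>

definition leq_on :: "'a set \<Rightarrow> 'a signvec \<Rightarrow> 'a signvec \<Rightarrow> bool" where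
  "leq_on A X Y \<longleftrightarrow> (\<forall>a\<in>A. X a \<noteq> 0 \<longrightarrow> Y a = X a)"

text \<open>Covectors of the restriction to \<open>A\<close> are represented by covectors of \<open>L\<close>. If \<open>A\<close> spans, a cocircuit
  of the restriction has exactly one such representative.\<close>

definition minimal_on :: "'a signvec set \<Rightarrow> 'a set \<Rightarrow> 'a signvec \<Rightarrow> bool" where
  "minimal_on L A X \<longleftrightarrow> X \<in> L \<and> X \<noteq> zero_vec \<and>
     (\<forall>Y\<in>L. Y \<noteq> zero_vec \<and> leq_on A Y X \<longrightarrow> (\<forall>a\<in>A. Y a = X a))"

definition spans :: "'a signvec set \<Rightarrow> 'a set \<Rightarrow> bool" where
  "spans L A \<longleftrightarrow> (\<forall>X\<in>L. (\<forall>a\<in>A. X a = 0) \<longrightarrow> X = zero_vec)"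

text \<open>The ground set stays \<open>E\<close> and \<open>g\<close> becomes a loop, so iterated
  contractions remain subsets of \<open>L\<close>.\<close>

definition contraction :: "'a signvec set \<Rightarrow> 'a \<Rightarrow> 'a signvec set" where
  "contraction L g = {X \<in> L. X g = 0}"

text \<open>On cocircuits this is the localization of the lexicographic extension along
  \<open>es\<close>: the sign of a sum of the entries with rapidly decreasing positive
  weights.\<close>

primrec lexsign :: "'a list \<Rightarrow> 'a signvec \<Rightarrow> int" where
  "lexsign [] X = 0"
| "lexsign (e # es) X = (if X e \<noteq> 0 then X e else lexsign es X)"

lemma signvec_uminus_uminus [simp]: "- (- X) = (X :: 'a signvec)"
  by (simp add: fun_eq_iff)

lemma leq_onD: "leq_on A X Y \<Longrightarrow> a \<in> A \<Longrightarrow> X a \<noteq> 0 \<Longrightarrow> Y a = X a"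
  by (simp add: leq_on_def)

lemma leq_on_refl: "leq_on A X X"
  by (simp add: leq_on_def)

lemma leq_on_trans: "leq_on A X Y \<Longrightarrow> leq_on A Y Z \<Longrightarrow> leq_on A X Z"
  unfolding leq_on_def by metis

lemma leq_on_uminus: "leq_on A X Y \<Longrightarrow> leq_on A (- X) (- Y)"
  by (simp add: leq_on_def)

lemma sle_iff_leq_on: "sle X Y \<longleftrightarrow> leq_on UNIV X Y"
  unfolding sle_def leq_on_def by (metis UNIV_I)

lemma not_zero_vec: "X \<noteq> zero_vec \<longleftrightarrow> (\<exists>e. X e \<noteq> 0)"
  by (auto simp: zero_vec_def)

lemma lexsign_uminus: "lexsign es (- X) = - lexsign es X"
  by (induction es) auto

lemma lexsign_eq_0_iff: "lexsign es X = 0 \<longleftrightarrow> (\<forall>e\<in>set es. X e = 0)"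
  by (induction es) auto

lemma lexsign_not_zero_vec: "lexsign es X \<noteq> 0 \<Longrightarrow> X \<noteq> zero_vec"
  by (auto simp: lexsign_eq_0_iff zero_vec_def)

text \<open>Elimination acts like a positive combination. At the first element of \<open>es\<close>
  where \<open>X\<close> or \<open>Y\<close> is nonzero, the nonzero entries are all -1; so nothing
  is separated there and \<open>Z\<close> has the entry -1 as well.\<close>

lemma lexsign_elimination:
  assumes "\<And>h. X h \<noteq> - Y h \<or> X h = 0 \<Longrightarrow> Z h = (if X h \<noteq> 0 then X h else Y h)"
    "lexsign es X = 0 \<or> lexsign es X = -1" "lexsign es Y = 0 \<or> lexsign es Y = -1"
    "lexsign es X = -1 \<or> lexsign es Y = -1"
  shows "lexsign es Z = -1"
  using assms(2-)
proof (induction es)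
  case (Cons e es)
  then show ?case using assms(1)[of e] by (auto split: if_splits)
qed simp

context oriented_matroid
begin

lemma spans_nonzero: "spans L A \<Longrightarrow> X \<in> L \<Longrightarrow> X \<noteq> zero_vec \<Longrightarrow> \<exists>a\<in>A. X a \<noteq> 0"
  unfolding spans_def by blast

lemma nonzero_in_ground: "X \<in> L \<Longrightarrow> X e \<noteq> 0 \<Longrightarrow> e \<in> E"
  using covector_outside[of X e] by blast

lemma lexsign_cases: "X \<in> L \<Longrightarrow> lexsign es X = -1 \<or> lexsign es X = 0 \<or> lexsign es X = 1"
proof (induction es)
  case (Cons e es)
  then show ?case using covector_cases[of X e] by auto
qed simp

lemma ext_elimination:
  assumes "X \<in> L" "Y \<in> L" "X \<noteq> - Y"
    and "\<And>h. X h \<noteq> - Y h \<or> X h = 0 \<Longrightarrow> Z h = (if X h \<noteq> 0 then X h else Y h)"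
  shows "Z \<noteq> zero_vec"
proof -
  obtain h where h: "X h \<noteq> - Y h" using assms(3) by fastforce
  then have "Z h \<noteq> 0" using assms(4)[of h] by auto
  then show ?thesis by (auto simp: zero_vec_def)
qed

lemma minimal_on_uminus:
  assumes "minimal_on L A X"
  shows "minimal_on L A (- X)"
  unfolding minimal_on_def
proof (intro conjI ballI impI)
  show "- X \<in> L" "- X \<noteq> zero_vec"
    using assms neg_covector[of X] by (auto simp: minimal_on_def not_zero_vec)
  fix Y a assume Y: "Y \<in> L" "Y \<noteq> zero_vec \<and> leq_on A Y (- X)" and a: "a \<in> A"
  have "leq_on A (- Y) X" using leq_on_uminus[of A Y "- X"] Y(2) by simp
  moreover have "- Y \<in> L" "- Y \<noteq> zero_vec" using Y neg_covector[of Y] by (auto simp: not_zero_vec)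
  ultimately have "(- Y) a = X a" using assms a unfolding minimal_on_def by blast
  then show "Y a = (- X) a" by simp
qed

text \<open>If nothing in \<open>A\<close> separates, \<open>Y\<close> lies below \<open>X\<close>
  on \<open>A\<close>. Otherwise eliminating a separating \<open>e\<close> shrinks the separation;
  unless \<open>Y\<close> is \<open>- X\<close> on \<open>A\<close>, the result is nonzero and by
  induction agrees with \<open>X\<close> or \<open>- X\<close> on \<open>A\<close>, against its zero
  at \<open>e\<close>.\<close>

lemma minimal_on_support:
  assumes X: "minimal_on L A X" and "finite A"
    and "Y \<in> L" "Y \<noteq> zero_vec" "\<And>a. a \<in> A \<Longrightarrow> X a = 0 \<Longrightarrow> Y a = 0"
  shows "(\<forall>a\<in>A. Y a = X a) \<or> (\<forall>a\<in>A. Y a = - X a)"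
  using assms(3-)
proof (induction "card (sep Y X \<inter> A)" arbitrary: Y rule: less_induct)
  case less
  have XL: "X \<in> L" using X by (simp add: minimal_on_def)
  show ?case
  proof (cases "\<exists>e\<in>A. e \<in> sep Y X")
    case False
    have "leq_on A Y X" unfolding leq_on_def
    proof (intro ballI impI)
      fix a assume a: "a \<in> A" "Y a \<noteq> 0"
      then have "a \<notin> sep Y X" "X a \<noteq> 0" using False less.prems(3)[of a] by auto
      then show "X a = Y a"
        using covector_eq_or_neg[OF less.prems(1) XL, of a] a by (auto simp: sep_def)
    qed
    then show ?thesis using X less.prems unfolding minimal_on_def by blast
  next
    case True
    then obtain e where e: "e \<in> A" "Y e = - X e" "Y e \<noteq> 0" by (auto simp: sep_def)
    obtain Z where Z: "Z \<in> L" "Z e = 0"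
      "\<And>h. Y h \<noteq> - X h \<or> Y h = 0 \<Longrightarrow> Z h = (if Y h \<noteq> 0 then Y h else X h)"
      using elimination[OF less.prems(1) XL e(2,3)] by blast
    have "sep Z X \<inter> A \<subset> sep Y X \<inter> A"
    proof
      show "sep Z X \<inter> A \<subseteq> sep Y X \<inter> A"
      proof
        fix h assume h: "h \<in> sep Z X \<inter> A"
        show "h \<in> sep Y X \<inter> A"
        proof (rule ccontr)
          assume "h \<notin> sep Y X \<inter> A"
          then have "Y h \<noteq> - X h \<or> Y h = 0" using h by (auto simp: sep_def)
          then show False using Z(3)[of h] h by (auto simp: sep_def split: if_splits)
        qed
      qed
      have "e \<in> sep Y X \<inter> A" "e \<notin> sep Z X" using e Z(2) by (simp_all add: sep_def)
      then show "sep Z X \<inter> A \<noteq> sep Y X \<inter> A" by blast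
    qed
    then have card: "card (sep Z X \<inter> A) < card (sep Y X \<inter> A)"
      using \<open>finite A\<close> by (intro psubset_card_mono) auto
    show ?thesis
    proof (rule ccontr)
      assume "\<not> ?thesis"
      then obtain h where h: "h \<in> A" "Y h \<noteq> - X h" by blast
      then have "Z h \<noteq> 0" using Z(3)[of h] by auto
      then have "Z \<noteq> zero_vec" by (auto simp: zero_vec_def)
      moreover have "Z a = 0" if "a \<in> A" "X a = 0" for a
        using Z(3)[of a] less.prems(3)[of a] that by auto
      ultimately have "(\<forall>a\<in>A. Z a = X a) \<or> (\<forall>a\<in>A. Z a = - X a)"
        using less.hyps[OF card Z(1)] by blast
      then show False using e Z(2) by auto
    qed
  qed
qed

text \<open>Two different lifts could be subtracted: eliminating an \<open>e\<close> in
  \<open>A\<close> between \<open>- X\<close> and \<open>Y\<close> would leave a nonzero covector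
  that vanishes at \<open>e\<close> and at all zeros of \<open>X\<close> in \<open>A\<close>,
  against \<open>minimal_on_support\<close>.\<close>

lemma minimal_on_unique:
  assumes "spans L A" "finite A" "minimal_on L A X" "Y \<in> L" "\<And>a. a \<in> A \<Longrightarrow> Y a = X a"
  shows "Y = X"
proof (rule ccontr)
  assume ne: "Y \<noteq> X"
  have X: "X \<in> L" "X \<noteq> zero_vec" using assms by (simp_all add: minimal_on_def)
  obtain e where e: "e \<in> A" "X e \<noteq> 0" using spans_nonzero[OF assms(1) X] by blast
  have "(- X) e = - Y e" "(- X) e \<noteq> 0" using e assms(5) by auto
  then obtain Z where Z: "Z \<in> L" "Z e = 0"
    "\<And>h. (- X) h \<noteq> - Y h \<or> (- X) h = 0 \<Longrightarrow> Z h = (if (- X) h \<noteq> 0 then (- X) h else Y h)"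
    using elimination[OF neg_covector[OF X(1)] assms(4)] by blast
  have "- X \<noteq> - Y" using ne by (metis signvec_uminus_uminus)
  then have "Z \<noteq> zero_vec"
    by (rule ext_elimination[OF neg_covector[OF X(1)] assms(4) _ Z(3)])
  moreover have "Z a = 0" if "a \<in> A" "X a = 0" for a
    using Z(3)[of a] assms(5)[of a] that by auto
  ultimately have "(\<forall>a\<in>A. Z a = X a) \<or> (\<forall>a\<in>A. Z a = - X a)"
    using minimal_on_support[OF assms(3,2) Z(1)] by blast
  then show False using e Z(2) by auto
qed

lemma minimal_on_support_eq:
  assumes "spans L A" "finite A" "minimal_on L A X"
    and "Y \<in> L" "Y \<noteq> zero_vec" "\<And>a. a \<in> A \<Longrightarrow> X a = 0 \<Longrightarrow> Y a = 0"
  shows "Y = X \<or> Y = - X"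
proof -
  have "(\<forall>a\<in>A. Y a = X a) \<or> (\<forall>a\<in>A. Y a = - X a)"
    using minimal_on_support[OF assms(3,2,4,5,6)] by blast
  then show ?thesis
  proof
    assume "\<forall>a\<in>A. Y a = X a"
    then show ?thesis using minimal_on_unique[OF assms(1-4)] by blast
  next
    assume "\<forall>a\<in>A. Y a = - X a"
    then show ?thesis
      using minimal_on_unique[OF assms(1,2) minimal_on_uminus[OF assms(3)] assms(4)] by simp
  qed
qed

lemma cocircuit_iff_minimal_on: "cocircuit L X \<longleftrightarrow> minimal_on L E X"
proof -
  have "sle Y X \<longleftrightarrow> leq_on E Y X" if "Y \<in> L" for Y
    using nonzero_in_ground[OF that] unfolding sle_iff_leq_on leq_on_def by blast
  moreover have "Y = X \<longleftrightarrow> (\<forall>a\<in>E. Y a = X a)" if "Y \<in> L" "X \<in> L" for Y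
    using covector_outside[OF that(1)] covector_outside[OF that(2)] by (metis ext)
  ultimately show ?thesis unfolding cocircuit_def minimal_on_def by blast
qed

lemma minimal_on_cocircuit:
  assumes "spans L A" "finite A" "minimal_on L A X"
  shows "cocircuit L X"
  unfolding cocircuit_def
proof (intro conjI ballI impI)
  show "X \<in> L" "X \<noteq> zero_vec" using assms by (simp_all add: minimal_on_def)
  fix Y assume Y: "Y \<in> L" "Y \<noteq> zero_vec \<and> sle Y X"
  then have "leq_on A Y X" unfolding sle_iff_leq_on leq_on_def by blast
  then have "\<forall>a\<in>A. Y a = X a" using assms(3) Y unfolding minimal_on_def by blast
  then show "Y = X" using minimal_on_unique[OF assms Y(1)] by blast
qed

text \<open>The iteration of \<open>conformal_below\<close>, carried out on \<open>A\<close>. The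
  objective stays negative by \<open>lexsign_elimination\<close>, since it is negative on both
  vectors entering each elimination.\<close>

lemma conformal_on_below:
  assumes "finite A" "N \<in> L" "V \<in> L" "lexsign es N = -1" "lexsign es V = -1"
    "\<And>a. a \<in> A \<Longrightarrow> V a = 0 \<Longrightarrow> N a = 0" "b \<in> A" "N b = 0" "V b \<noteq> 0"
  shows "\<exists>U\<in>L. leq_on A U V \<and> lexsign es U = -1 \<and> (\<exists>b\<in>A. U b = 0 \<and> V b \<noteq> 0)"
  using assms
proof (induction "card (sep N V \<inter> A)" arbitrary: N b rule: less_induct)
  case less
  show ?case
  proof (cases "\<exists>e\<in>A. e \<in> sep N V")
    case False
    have "leq_on A N V" unfolding leq_on_def
    proof (intro ballI impI)
      fix a assume a: "a \<in> A" "N a \<noteq> 0"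
      then have "a \<notin> sep N V" "V a \<noteq> 0" using False less.prems(6)[of a] by auto
      then show "V a = N a"
        using covector_eq_or_neg[OF less.prems(2,3), of a] a by (auto simp: sep_def)
    qed
    then show ?thesis using less.prems by blast
  next
    case True
    then obtain e where e: "e \<in> A" "N e = - V e" "N e \<noteq> 0" by (auto simp: sep_def)
    obtain Z where Z: "Z \<in> L" "Z e = 0"
      "\<And>h. N h \<noteq> - V h \<or> N h = 0 \<Longrightarrow> Z h = (if N h \<noteq> 0 then N h else V h)"
      using elimination[OF less.prems(2,3) e(2,3)] by blast
    have "sep Z V \<inter> A \<subset> sep N V \<inter> A"
    proof
      show "sep Z V \<inter> A \<subseteq> sep N V \<inter> A"
      proof
        fix h assume h: "h \<in> sep Z V \<inter> A"
        show "h \<in> sep N V \<inter> A"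
        proof (rule ccontr)
          assume "h \<notin> sep N V \<inter> A"
          then have "N h \<noteq> - V h \<or> N h = 0" using h by (auto simp: sep_def)
          then show False using Z(3)[of h] h by (auto simp: sep_def split: if_splits)
        qed
      qed
      have "e \<in> sep N V \<inter> A" "e \<notin> sep Z V" using e Z(2) by (simp_all add: sep_def)
      then show "sep Z V \<inter> A \<noteq> sep N V \<inter> A" by blast
    qed
    then have card: "card (sep Z V \<inter> A) < card (sep N V \<inter> A)"
      using \<open>finite A\<close> by (intro psubset_card_mono) auto
    have lex: "lexsign es Z = -1"
      using less.prems(4,5) by (intro lexsign_elimination[OF Z(3)]) auto
    have "Z a = 0" if "a \<in> A" "V a = 0" for a
      using Z(3)[of a] less.prems(6)[of a] that by auto
    moreover have "V e \<noteq> 0" using e by simp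
    ultimately show ?thesis
      using less.hyps[OF card less.prems(1) Z(1) less.prems(3) lex less.prems(5) _ e(1) Z(2)] by blast
  qed
qed

text \<open>A cone that contains a descending vector has a descending extreme ray: if \<open>V\<close> descends and
  \<open>U\<close> below \<open>V\<close> does not, then \<open>V - U\<close> descends, and elimination moves it back into the cone.\<close>

lemma negative_minimal:
  assumes "spans L A" "finite A" "V \<in> L" "lexsign es V = -1"
  shows "\<exists>R. minimal_on L A R \<and> leq_on A R V \<and> lexsign es R = -1"
  using assms(3,4)
proof (induction "card {a\<in>A. V a \<noteq> 0}" arbitrary: V rule: less_induct)
  case less
  show ?case
  proof (cases "minimal_on L A V")
    case True
    then show ?thesis using less.prems leq_on_refl by blast
  next
    case False
    have "V \<noteq> zero_vec" using less.prems(2) lexsign_not_zero_vec[of es V] by simp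
    then obtain U where U: "U \<in> L" "U \<noteq> zero_vec" "leq_on A U V" "\<exists>a\<in>A. U a \<noteq> V a"
      using False less.prems unfolding minimal_on_def by blast
    have "\<exists>W\<in>L. leq_on A W V \<and> lexsign es W = -1 \<and> (\<exists>b\<in>A. W b = 0 \<and> V b \<noteq> 0)"
    proof (cases "lexsign es U = -1")
      case True
      obtain a where a: "a \<in> A" "U a \<noteq> V a" using U(4) by blast
      then have "U a = 0" using leq_onD[OF U(3) a(1)] by auto
      then show ?thesis using True U a by metis
    next
      case False
      obtain b where b: "b \<in> A" "U b \<noteq> 0" using spans_nonzero[OF assms(1) U(1,2)] by blast
      then have Vb: "V b = U b" using leq_onD[OF U(3)] by blast
      have "(- U) b = - V b" "(- U) b \<noteq> 0" using b Vb by auto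
      then obtain N where N: "N \<in> L" "N b = 0"
        "\<And>h. (- U) h \<noteq> - V h \<or> (- U) h = 0 \<Longrightarrow> N h = (if (- U) h \<noteq> 0 then (- U) h else V h)"
        using elimination[OF neg_covector[OF U(1)] less.prems(1)] by blast
      have lex: "lexsign es (- U) = 0 \<or> lexsign es (- U) = -1"
        using False lexsign_cases[OF U(1), of es] by (auto simp: lexsign_uminus)
      have N1: "lexsign es N = -1"
        using less.prems(2) by (intro lexsign_elimination[OF N(3) lex]) auto
      have N0: "N a = 0" if "a \<in> A" "V a = 0" for a
        using N(3)[of a] leq_onD[OF U(3) that(1)] that by auto
      show ?thesis
        using conformal_on_below[OF assms(2) N(1) less.prems(1) N1 less.prems(2) N0 b(1) N(2)] b Vb
        by auto
    qed
    then obtain W b where W: "W \<in> L" "leq_on A W V" "lexsign es W = -1" "b \<in> A" "W b = 0" "V b \<noteq> 0"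
      by blast
    have "{a\<in>A. W a \<noteq> 0} \<subset> {a\<in>A. V a \<noteq> 0}"
    proof
      show "{a\<in>A. W a \<noteq> 0} \<subseteq> {a\<in>A. V a \<noteq> 0}"
        using leq_onD[OF W(2)] by auto
      show "{a\<in>A. W a \<noteq> 0} \<noteq> {a\<in>A. V a \<noteq> 0}" using W(4-6) by blast
    qed
    then have "card {a\<in>A. W a \<noteq> 0} < card {a\<in>A. V a \<noteq> 0}"
      using assms(2) by (intro psubset_card_mono) auto
    then show ?thesis using less.hyps[OF _ W(1,3)] leq_on_trans W(2) by blast
  qed
qed

text \<open>Prescribing a sign at \<open>e\<close> amounts to the objective \<open>[e]\<close>, so
  \<open>negative_minimal\<close> applies to whichever of \<open>V\<close> and \<open>- V\<close> is
  negative at \<open>e\<close>.\<close>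

lemma minimal_below:
  assumes "spans L A" "finite A" "V \<in> L" "V e \<noteq> 0"
  shows "\<exists>R. minimal_on L A R \<and> leq_on A R V \<and> R e = V e"
proof (cases "V e = -1")
  case True
  then have "lexsign [e] V = -1" by simp
  then obtain R where R: "minimal_on L A R" "leq_on A R V" "lexsign [e] R = -1"
    using negative_minimal[OF assms(1-3)] by blast
  then have "R e = -1" by (auto split: if_splits)
  then show ?thesis using R True by auto
next
  case False
  then have V: "V e = 1" using covector_cases[OF assms(3), of e] assms(4) by auto
  then have "lexsign [e] (- V) = -1" by simp
  then obtain R where R: "minimal_on L A R" "leq_on A R (- V)" "lexsign [e] R = -1"
    using negative_minimal[OF assms(1,2) neg_covector[OF assms(3)]] by blast
  then have "R e = -1" by (auto split: if_splits)
  moreover have "leq_on A (- R) V" using leq_on_uminus[OF R(2)] by simp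
  ultimately show ?thesis using minimal_on_uminus[OF R(1)] V by (intro exI[of _ "- R"]) simp
qed

subsection \<open>Contraction\<close>

lemma contraction_oriented_matroid: "oriented_matroid E (contraction L g)"
proof
  show "finite E" by (rule finite_ground)
  show "contraction L g \<subseteq> sign_vectors E" using covectors_sign by (auto simp: contraction_def)
  show "zero_vec \<in> contraction L g" using zero_covector by (simp add: contraction_def zero_vec_def)
  show "- X \<in> contraction L g" if "X \<in> contraction L g" for X
    using that neg_covector[of X] by (simp add: contraction_def)
  show "compose X Y \<in> contraction L g" if "X \<in> contraction L g" "Y \<in> contraction L g" for X Y
    using that compose_covector[of X Y] by (simp add: contraction_def) (simp add: compose_def)
  fix X Y e assume XY: "X \<in> contraction L g" "Y \<in> contraction L g" "e \<in> sep X Y"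
  then have XYL: "X \<in> L" "Y \<in> L" by (simp_all add: contraction_def)
  have e: "X e = - Y e" "X e \<noteq> 0" using XY(3) by (simp_all add: sep_def)
  obtain Z where Z: "Z \<in> L" "Z e = 0"
    "\<And>h. X h \<noteq> - Y h \<or> X h = 0 \<Longrightarrow> Z h = (if X h \<noteq> 0 then X h else Y h)"
    using elimination[OF XYL e] by blast
  have "Z g = 0" using Z(3)[of g] XY by (simp add: contraction_def)
  moreover have "Z h = compose X Y h" if "h \<in> E - sep X Y" for h
    using Z(3)[of h] that by (auto simp: sep_def compose_def)
  ultimately show "\<exists>Z\<in>contraction L g. Z e = 0 \<and> (\<forall>h\<in>E - sep X Y. Z h = compose X Y h)"
    using Z by (auto simp: contraction_def)
qed

text \<open>A nonzero covector that vanishes on the zeros of \<open>X\<close> in \<open>A\<close>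
  agrees with \<open>X\<close> or \<open>- X\<close> on \<open>A\<close>, so it is nonzero at
  \<open>g\<close> and does not lie in the contraction.\<close>

lemma spans_contraction:
  assumes "minimal_on L A X" "finite A" "g \<in> A" "X g \<noteq> 0"
    and "spans L A"
  shows "spans (contraction L g) {a\<in>A. X a = 0}"
  unfolding spans_def
proof (intro ballI impI, rule ccontr)
  fix Z assume Z: "Z \<in> contraction L g" "\<forall>a\<in>{a\<in>A. X a = 0}. Z a = 0" "Z \<noteq> zero_vec"
  then have "(\<forall>a\<in>A. Z a = X a) \<or> (\<forall>a\<in>A. Z a = - X a)"
    by (intro minimal_on_support[OF assms(1,2)]) (auto simp: contraction_def)
  then show False using Z(1) assms(3,4) by (auto simp: contraction_def)
qed

text \<open>Directions at a vertex \<open>X\<close> off the hyperplane \<open>g\<close> are points of that hyperplane.\<close>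

lemma contraction_lift:
  assumes "X \<in> L" "X g \<noteq> 0" "V \<in> L"
  shows "\<exists>N\<in>contraction L g. \<forall>h. X h = 0 \<longrightarrow> N h = V h"
proof (cases "V g = 0")
  case True
  then show ?thesis using assms(3) by (auto simp: contraction_def)
next
  case False
  define X' where "X' = (if V g = X g then - X else X)"
  have X': "X' \<in> L" "X' g = - V g" "X' g \<noteq> 0"
    using assms neg_covector[of X] covector_eq_or_neg[OF assms(1,3,2) False] by (auto simp: X'_def)
  obtain N where N: "N \<in> L" "N g = 0"
    "\<And>h. X' h \<noteq> - V h \<or> X' h = 0 \<Longrightarrow> N h = (if X' h \<noteq> 0 then X' h else V h)"
    using elimination[OF X'(1) assms(3) X'(2,3)] by blast
  have "N h = V h" if "X h = 0" for h using N(3)[of h] that by (simp add: X'_def)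
  then show ?thesis using N by (auto simp: contraction_def)
qed

lemma cocircuit_contraction:
  assumes "cocircuit (contraction L g) X"
  shows "cocircuit L X"
  unfolding cocircuit_def
proof (intro conjI ballI impI)
  show "X \<in> L" "X \<noteq> zero_vec" using assms by (simp_all add: cocircuit_def contraction_def)
  have "X g = 0" using assms by (simp add: cocircuit_def contraction_def)
  fix Y assume Y: "Y \<in> L" "Y \<noteq> zero_vec \<and> sle Y X"
  then have "Y \<in> contraction L g" using sle_zero[of Y X g] \<open>X g = 0\<close> by (simp add: contraction_def)
  then show "Y = X" using assms Y unfolding cocircuit_def by blast
qed

lemma spans_ground: "spans L E"
  unfolding spans_def zero_vec_def using covector_outside by (metis ext)

subsection \<open>The sweep\<close>

text \<open>The covering clause is comodularity without ranks, which transfers easily from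
  contractions to \<open>L\<close>; its disjunction makes it invariant under
  \<open>forward_uminus\<close>. The last clause lets \<open>Z\<close> arise by eliminating
  \<open>g\<close> between \<open>- X\<close> and \<open>W\<close>: the condition on
  \<open>h\<close> says that \<open>h\<close> is not in \<open>sep (- X) W\<close>.\<close>

definition forward :: "'a list \<Rightarrow> 'a \<Rightarrow> 'a signvec \<Rightarrow> 'a signvec \<Rightarrow> bool" where
  "forward es g X W \<longleftrightarrow> cocircuit L X \<and> cocircuit L W \<and> X g \<noteq> 0 \<and> W g = X g \<and> X \<noteq> W \<and> conformal X W \<and>
     ((\<forall>V\<in>L. sle W V \<and> sle V (compose W X) \<longrightarrow> V = W \<or> V = compose W X) \<or>
      (\<forall>V\<in>L. sle X V \<and> sle V (compose X W) \<longrightarrow> V = X \<or> V = compose X W)) \<and>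
     (\<exists>Z. cocircuit L Z \<and> Z g = 0 \<and> lexsign es Z = 1 \<and>
       (\<forall>h. X h \<noteq> W h \<or> X h = 0 \<longrightarrow> Z h = (if X h \<noteq> 0 then - X h else W h)))"

abbreviation forward_rel :: "'a list \<Rightarrow> 'a \<Rightarrow> ('a signvec \<times> 'a signvec) set" where
  "forward_rel es g \<equiv> {(X, W). forward es g X W}"

lemma forward_lexsign:
  assumes "forward es g X W" "lexsign es X = 1"
  shows "lexsign es W = 1"
proof (rule ccontr)
  assume n: "lexsign es W \<noteq> 1"
  obtain Z where Z: "lexsign es Z = 1"
    "\<forall>h. X h \<noteq> W h \<or> X h = 0 \<longrightarrow> Z h = (if X h \<noteq> 0 then - X h else W h)"
    using assms(1) unfolding forward_def by blast
  have W: "W \<in> L" using assms(1) unfolding forward_def cocircuit_def by blast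
  have "lexsign es Z = -1"
  proof (rule lexsign_elimination[of "- X" W])
    show "Z h = (if (- X) h \<noteq> 0 then (- X) h else W h)" if "(- X) h \<noteq> - W h \<or> (- X) h = 0" for h
      using Z(2)[rule_format, of h] that by simp
  qed (use assms(2) n lexsign_cases[OF W, of es] in \<open>auto simp: lexsign_uminus\<close>)
  then show False using Z(1) by simp
qed

lemma forward_trancl:
  assumes "(X, W) \<in> (forward_rel es g)\<^sup>+"
  shows "lexsign es X = 1 \<longrightarrow> lexsign es W = 1"
  using assms by (induction rule: trancl_induct) (use forward_lexsign in blast)+

text \<open>If all directions at \<open>X\<close> into the cell \<open>G\<close> ascend, then \<open>X\<close> is the first vertex of \<open>G\<close>:
  any other vertex of \<open>G\<close> has a descending direction towards \<open>X\<close>, hence a descending edge in \<open>G\<close>,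
  and the other end of that edge cannot lie on \<open>g\<close>, where it would be a descending direction at \<open>X\<close>.\<close>

lemma sweep_reachable:
  assumes acyc: "acyclic (forward_rel es g)"
    and X: "cocircuit L X" "X g \<noteq> 0" "leq_on A X G"
    and opt: "\<And>Z. Z \<in> L \<Longrightarrow> Z g = 0 \<Longrightarrow> Z \<noteq> zero_vec \<Longrightarrow>
      (\<And>a. a \<in> A \<Longrightarrow> X a = 0 \<Longrightarrow> Z a \<noteq> 0 \<Longrightarrow> Z a = G a) \<Longrightarrow> lexsign es Z = 1"
    and W: "cocircuit L W" "W g = X g" "leq_on A W G"
  shows "(X, W) \<in> (forward_rel es g)\<^sup>*"
proof -
  have "forward_rel es g \<subseteq> L \<times> L" by (auto simp: forward_def cocircuit_def)
  then have "finite (forward_rel es g)" using finite_covectors by (meson finite_SigmaI finite_subset)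
  then have wf: "wf (forward_rel es g)" using acyc finite_acyclic_wf by blast
  show ?thesis using W
  \<comment> \<open>The induction runs against the arrows: the other end of a descending edge at
    \<open>W\<close> is a predecessor of \<open>W\<close>.\<close>
  proof (induction W rule: wf_induct_rule[OF wf])
    case (1 W)
    show ?case
    proof (cases "W = X")
      case False
      have XL: "X \<in> L" and WL: "W \<in> L" using X 1 by (simp_all add: cocircuit_def)
      have gE: "g \<in> E" using nonzero_in_ground[OF XL X(2)] .
      have Wg: "W g \<noteq> 0" using X 1 by simp
      \<comment> \<open>\<open>V\<close> is the direction from \<open>X\<close> to \<open>W\<close>.
        It enters \<open>G\<close>, so it ascends, and \<open>- V\<close> descends from
        \<open>W\<close> towards \<open>X\<close>.\<close>
      have "(- X) g = - W g" "(- X) g \<noteq> 0" using X 1 by auto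
      then obtain V where V: "V \<in> L" "V g = 0"
        "\<And>h. (- X) h \<noteq> - W h \<or> (- X) h = 0 \<Longrightarrow> V h = (if (- X) h \<noteq> 0 then (- X) h else W h)"
        using elimination[OF neg_covector[OF XL] WL] by blast
      have "- X \<noteq> - W" using False by (metis signvec_uminus_uminus)
      then have "V \<noteq> zero_vec" by (rule ext_elimination[OF neg_covector[OF XL] WL _ V(3)])
      moreover have "V a = G a" if "a \<in> A" "X a = 0" "V a \<noteq> 0" for a
        using V(3)[of a] that leq_onD[OF 1(4) that(1)] by auto
      ultimately have "lexsign es V = 1" using opt[OF V(1,2)] by blast
      then have lexU: "lexsign es (- V) = -1" by (simp add: lexsign_uminus)
      let ?L = "contraction L g" and ?B = "{e\<in>E. W e = 0}"
      interpret C: oriented_matroid E ?L by (rule contraction_oriented_matroid)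
      have Wmin: "minimal_on L E W" using 1(2) cocircuit_iff_minimal_on by blast
      have sp: "spans ?L ?B"
        by (rule spans_contraction[OF Wmin finite_ground gE Wg spans_ground])
      have finB: "finite ?B" using finite_ground by simp
      have U: "- V \<in> ?L" using V neg_covector[of V] by (simp add: contraction_def)
      obtain Z where Z: "minimal_on ?L ?B Z" "leq_on ?B Z (- V)" "lexsign es Z = -1"
        using C.negative_minimal[OF sp finB U lexU] by blast
      have ZL: "Z \<in> L" "Z g = 0" "Z \<in> ?L" "Z \<noteq> zero_vec"
        using Z(1) by (auto simp: minimal_on_def contraction_def)
      have ZV: "Z h = - V h" if "W h = 0" "Z h \<noteq> 0" for h
        using leq_onD[OF Z(2), of h] that nonzero_in_ground[OF ZL(1) that(2)] by simp
      obtain a where a: "W a = 0" "Z a \<noteq> 0" using C.spans_nonzero[OF sp ZL(3,4)] by blast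
      let ?F = "compose W Z"
      have F: "?F \<in> L" "?F a \<noteq> 0" using WL ZL compose_covector[of W Z] a by (auto simp: compose_def)
      obtain W' where W': "minimal_on L E W'" "leq_on E W' ?F" "W' a = ?F a"
        using minimal_below[OF spans_ground finite_ground F] by blast
      have W'L: "W' \<in> L" "cocircuit L W'" "W' a \<noteq> 0"
        using W' F cocircuit_iff_minimal_on by (auto simp: minimal_on_def)
      have W'F: "?F h = W' h" if "W' h \<noteq> 0" for h
        using leq_onD[OF W'(2)] that nonzero_in_ground[OF W'L(1) that] by blast
      \<comment> \<open>The edge at \<open>W\<close> in direction \<open>Z\<close> is
        one-dimensional: on the zeros of \<open>W\<close>, a covector that conforms to
        \<open>Z\<close> and is not zero coincides with \<open>Z\<close>. Minimality of
        \<open>Z\<close> refers to the contraction, hence the lift \<open>N\<close>.\<close>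
      have atom: "\<forall>h. W h = 0 \<longrightarrow> Y h = Z h"
        if Y: "Y \<in> L" "\<And>h. W h = 0 \<Longrightarrow> Y h \<noteq> 0 \<Longrightarrow> Z h = Y h" "W b = 0" "Y b \<noteq> 0" for Y b
      proof -
        obtain N where N: "N \<in> ?L" "\<forall>h. W h = 0 \<longrightarrow> N h = Y h"
          using contraction_lift[OF WL Wg Y(1)] by blast
        have "N \<noteq> zero_vec" using N(2) Y(3,4) by (auto simp: zero_vec_def)
        moreover have "leq_on ?B N Z" using N(2) Y(2) by (auto simp: leq_on_def)
        ultimately have NZ: "\<forall>h\<in>?B. N h = Z h" using Z(1) N(1) unfolding minimal_on_def by blast
        show ?thesis
        proof (intro allI impI)
          fix h assume "W h = 0"
          then show "Y h = Z h"
            using NZ N(2) covector_outside[OF Y(1), of h] covector_outside[OF ZL(1), of h]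
            by (cases "h \<in> E") auto
        qed
      qed
      have W'Z: "W' h = Z h" if "W h = 0" for h
      proof -
        have "Z k = W' k" if "W k = 0" "W' k \<noteq> 0" for k
          using W'F[OF that(2)] that(1) by (simp add: compose_def)
        then show ?thesis using atom[OF W'L(1) _ a(1) W'L(3)] that by blast
      qed
      have W'W: "W' h = W h" if "W h \<noteq> 0" "W' h \<noteq> 0" for h
        using W'F[OF that(2)] that(1) by (simp add: compose_def)
      show ?thesis
      proof (cases "W' g = 0")
        \<comment> \<open>The edge is a ray whose end on \<open>g\<close> is \<open>Z\<close>; then
          \<open>Z\<close> would be a descending direction from \<open>X\<close> into
          \<open>G\<close>.\<close>
        case True
        then have "W' \<in> ?L" using W'L by (simp add: contraction_def)
        then have "W' = Z" using C.minimal_on_unique[OF sp finB Z(1)] W'Z by blast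
        have "Z b = G b" if b: "b \<in> A" "X b = 0" "Z b \<noteq> 0" for b
        proof (cases "W b = 0")
          case True
          then show ?thesis using ZV[of b] V(3)[of b] b by simp
        next
          case False
          then show ?thesis using W'W[of b] \<open>W' = Z\<close> b leq_onD[OF 1(4) b(1)] by simp
        qed
        then have "lexsign es Z = 1" using opt[OF ZL(1,2,4)] by blast
        then show ?thesis using Z(3) by simp
      next
        case False
        have W'g: "W' g = W g" using W'W[OF Wg False] .
        \<comment> \<open>Where \<open>W\<close> vanishes, \<open>W'\<close> agrees with
          \<open>- V\<close>, which is \<open>X\<close> there; elsewhere each nonzero entry of
          \<open>W'\<close> is that of \<open>W\<close>.\<close>
        have W'G: "leq_on A W' G" unfolding leq_on_def
        proof (intro ballI impI)
          fix b assume b: "b \<in> A" "W' b \<noteq> 0"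
          show "G b = W' b"
          proof (cases "W b = 0")
            case True
            have Zb: "Z b \<noteq> 0" "W' b = Z b" using W'Z[OF True] b by auto
            then have "W' b = - V b" using ZV[OF True] by simp
            moreover have "V b = (if X b \<noteq> 0 then - X b else 0)"
              using V(3)[of b] True by auto
            ultimately show ?thesis using leq_onD[OF X(3) b(1)] b(2) by (auto split: if_splits)
          next
            case False
            then show ?thesis using W'W[of b] b leq_onD[OF 1(4) b(1)] by simp
          qed
        qed
        have FW: "compose W W' = ?F" using W'Z by (auto simp: compose_def)
        have "forward es g W' W" unfolding forward_def
        proof (intro conjI exI[of _ "- Z"])
          show "cocircuit L W'" "cocircuit L W" by (fact W'L(2), fact 1(2))
          show "W' g \<noteq> 0" "W g = W' g" using False W'g by auto
          show "W' \<noteq> W" using W'L(3) a by auto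
          show "conformal W' W" using W'W by (force simp: conformal_def sep_def)
          have "V' = W \<or> V' = ?F" if V': "V' \<in> L" "sle W V'" "sle V' ?F" for V'
          proof (cases "\<exists>b. W b = 0 \<and> V' b \<noteq> 0")
            case True
            then obtain b where b: "W b = 0" "V' b \<noteq> 0" by blast
            have "Z h = V' h" if "W h = 0" "V' h \<noteq> 0" for h
              using sle_eq[OF V'(3) that(2)] that(1) by (simp add: compose_def)
            then have "\<forall>h. W h = 0 \<longrightarrow> V' h = Z h" using atom[OF V'(1) _ b] by blast
            then have "V' h = ?F h" for h using sle_eq[OF V'(2), of h] by (simp add: compose_def)
            then show ?thesis by blast
          next
            case False
            then have "V' h = W h" for h using sle_eq[OF V'(2), of h] by (cases "W h = 0") auto
            then show ?thesis by blast
          qed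
          then show "(\<forall>V\<in>L. sle W V \<and> sle V (compose W W') \<longrightarrow> V = W \<or> V = compose W W') \<or>
            (\<forall>V\<in>L. sle W' V \<and> sle V (compose W' W) \<longrightarrow> V = W' \<or> V = compose W' W)"
            unfolding FW by blast
          have "cocircuit ?L (- Z)"
            using C.minimal_on_cocircuit[OF sp finB] C.minimal_on_uminus[OF Z(1)] by blast
          then show "cocircuit L (- Z)" by (rule cocircuit_contraction)
          show "(- Z) g = 0" "lexsign es (- Z) = 1" using ZL Z(3) by (simp_all add: lexsign_uminus)
          \<comment> \<open>The elimination \<open>M\<close> agrees with \<open>Z\<close> on the
            zeros of \<open>W\<close>, which span the contraction. So \<open>M\<close> is
            \<open>Z\<close>, and this fixes the entries of \<open>Z\<close> on the support of
            \<open>W\<close>.\<close>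
          have "(- W) g = - W' g" "(- W) g \<noteq> 0" using Wg W'g by auto
          then obtain M where M: "M \<in> L" "M g = 0"
            "\<And>h. (- W) h \<noteq> - W' h \<or> (- W) h = 0 \<Longrightarrow> M h = (if (- W) h \<noteq> 0 then (- W) h else W' h)"
            using elimination[OF neg_covector[OF WL] W'L(1)] by blast
          have "M \<in> ?L" using M by (simp add: contraction_def)
          moreover have "M h = Z h" if "h \<in> ?B" for h using M(3)[of h] W'Z[of h] that by simp
          ultimately have MZ: "M = Z" using C.minimal_on_unique[OF sp finB Z(1)] by blast
          show "\<forall>h. W' h \<noteq> W h \<or> W' h = 0 \<longrightarrow> (- Z) h = (if W' h \<noteq> 0 then - W' h else W h)"
          proof (intro allI impI)
            fix h assume h: "W' h \<noteq> W h \<or> W' h = 0"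
            show "(- Z) h = (if W' h \<noteq> 0 then - W' h else W h)"
            proof (cases "W h = 0")
              case True
              then show ?thesis using W'Z[of h] by simp
            next
              case False
              then have "W' h = 0" using h W'W[of h] by blast
              then show ?thesis using M(3)[of h] MZ False by simp
            qed
          qed
        qed
        moreover from this have "(X, W') \<in> (forward_rel es g)\<^sup>*"
          using 1(1)[of W'] W'L(2) W'g 1(3) W'G by simp
        ultimately show ?thesis by (meson CollectI case_prodI rtrancl.rtrancl_into_rtrancl)
      qed
    qed simp
  qed
qed

end

subsection \<open>Cells\<close>

definition restrict_vec :: "'a set \<Rightarrow> 'a signvec \<Rightarrow> 'a signvec" where
  "restrict_vec A X = (\<lambda>e. if e \<in> A then X e else 0)"

text \<open>\<open>T = None\<close> gives the whole face lattice of the restriction, and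
  \<open>T = Some t\<close> the cell below \<open>t\<close>, so one recursion proves both claims of
  the theorem.\<close>

definition cells :: "'a signvec set \<Rightarrow> 'a set \<Rightarrow> 'a signvec option \<Rightarrow> 'a signvec option set" where
  "cells L A T = {y \<in> face_lattice (restrict_vec A ` L). face_le y T}"

lemma restrict_vec_eq_iff: "restrict_vec A X = restrict_vec A Y \<longleftrightarrow> (\<forall>a\<in>A. X a = Y a)"
  by (auto simp: restrict_vec_def fun_eq_iff)

lemma restrict_vec_eq_zero_iff: "restrict_vec A X = zero_vec \<longleftrightarrow> (\<forall>a\<in>A. X a = 0)"
  by (auto simp: restrict_vec_def zero_vec_def fun_eq_iff)

lemma restrict_vec_zero: "restrict_vec A zero_vec = zero_vec"
  by (simp add: restrict_vec_def zero_vec_def)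

lemma sle_restrict_vec: "sle (restrict_vec A X) (restrict_vec A Y) \<longleftrightarrow> leq_on A X Y"
  by (auto simp: sle_iff_leq_on leq_on_def restrict_vec_def)

lemma sle_refl: "sle X X"
  by (simp add: sle_def)

lemma sle_trans: "sle X Y \<Longrightarrow> sle Y Z \<Longrightarrow> sle X Z"
  unfolding sle_iff_leq_on by (rule leq_on_trans)

lemma sle_antisym:
  assumes "sle X Y" "sle Y X"
  shows "X = Y"
proof
  fix e
  show "X e = Y e" using sle_eq[OF assms(1), of e] sle_eq[OF assms(2), of e] by (cases "X e = 0") auto
qed

lemma face_le_None: "face_le y None"
  by (cases y) auto

lemma face_le_zero: "face_le (Some zero_vec) y"
  by (cases y) (auto simp: sle_def zero_vec_def)

lemma face_le_refl: "face_le y y"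
  by (cases y) (auto simp: sle_refl)

lemma face_le_trans: "face_le x y \<Longrightarrow> face_le y z \<Longrightarrow> face_le x z"
  by (cases x; cases y; cases z) (auto intro: sle_trans)

lemma face_le_antisym: "face_le x y \<Longrightarrow> face_le y x \<Longrightarrow> x = y"
  by (cases x; cases y) (auto intro: sle_antisym)

context oriented_matroid
begin

lemma restriction_oriented_matroid:
  assumes "A \<subseteq> E"
  shows "oriented_matroid E (restrict_vec A ` L)"
proof
  show "finite E" by (rule finite_ground)
  show "restrict_vec A ` L \<subseteq> sign_vectors E"
  proof (intro subsetI, elim imageE)
    fix Y X assume "Y = restrict_vec A X" "X \<in> L"
    then show "Y \<in> sign_vectors E"
      using covector_cases[of X] covector_outside[of X] unfolding sign_vectors_def restrict_vec_def by auto
  qed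
  show "zero_vec \<in> restrict_vec A ` L" using zero_covector restrict_vec_zero by (metis imageI)
  show "- X \<in> restrict_vec A ` L" if X: "X \<in> restrict_vec A ` L" for X
  proof -
    obtain Y where Y: "Y \<in> L" "X = restrict_vec A Y" using X by blast
    have "- X = restrict_vec A (- Y)" using Y(2) by (auto simp: restrict_vec_def fun_eq_iff)
    then show ?thesis using neg_covector[OF Y(1)] by blast
  qed
  show "compose X Y \<in> restrict_vec A ` L" if XY: "X \<in> restrict_vec A ` L" "Y \<in> restrict_vec A ` L" for X Y
  proof -
    obtain X' Y' where *: "X' \<in> L" "X = restrict_vec A X'" "Y' \<in> L" "Y = restrict_vec A Y'" using XY by blast
    have "compose X Y = restrict_vec A (compose X' Y')"
      using * by (auto simp: restrict_vec_def compose_def fun_eq_iff)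
    then show ?thesis using compose_covector[OF *(1,3)] by blast
  qed
  fix X Y e assume XY: "X \<in> restrict_vec A ` L" "Y \<in> restrict_vec A ` L" and e: "e \<in> sep X Y"
  obtain X' Y' where *: "X' \<in> L" "X = restrict_vec A X'" "Y' \<in> L" "Y = restrict_vec A Y'" using XY by blast
  have "X' e = - Y' e" "X' e \<noteq> 0" using e * by (auto simp: sep_def restrict_vec_def split: if_splits)
  then obtain Z where Z: "Z \<in> L" "Z e = 0"
    "\<And>h. X' h \<noteq> - Y' h \<or> X' h = 0 \<Longrightarrow> Z h = (if X' h \<noteq> 0 then X' h else Y' h)"
    using elimination[OF *(1,3)] by blast
  have "restrict_vec A Z h = compose X Y h" if "h \<in> E - sep X Y" for h
    using Z(3)[of h] that * by (auto simp: restrict_vec_def compose_def sep_def)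
  moreover have "restrict_vec A Z e = 0" using Z(2) by (simp add: restrict_vec_def)
  ultimately show "\<exists>Z\<in>restrict_vec A ` L. Z e = 0 \<and> (\<forall>h\<in>E - sep X Y. Z h = compose X Y h)"
    using Z(1) by blast
qed

lemma graded_cells_full:
  assumes "T \<in> face_lattice L"
  shows "graded_poset face_le {y \<in> face_lattice L. face_le y T}" (is "graded_poset _ ?P")
proof -
  \<comment> \<open>The zero set of a tope has rank 0; the \<open>Suc\<close> leaves the value 0 for
    the adjoined top.\<close>
  define h where "h y = (case y of None \<Rightarrow> 0 | Some X \<Rightarrow> Suc (rank_om E L (zset E X)))" for y
  have fin: "finite ?P" using finite_covectors by (simp add: face_lattice_def)
  have refl: "reflp_on ?P face_le" by (rule reflp_onI) (rule face_le_refl)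
  have trans: "transp_on ?P face_le" by (rule transp_onI) (rule face_le_trans)
  have anti: "antisymp_on ?P face_le" by (rule antisymp_onI) (rule face_le_antisym)
  have b: "is_least face_le ?P (Some zero_vec)"
    using zero_covector by (auto simp: is_least_def face_lattice_def face_le_zero)
  have t: "is_greatest face_le ?P T" using assms face_le_refl by (auto simp: is_greatest_def)
  have cov: "h x = Suc (h y)" if "covers face_le ?P y x" for x y
  proof -
    have x: "x \<in> ?P" "y \<in> ?P" "face_le x y" "x \<noteq> y"
      and between: "\<And>z. z \<in> ?P \<Longrightarrow> face_le x z \<Longrightarrow> face_le z y \<Longrightarrow> z = x \<or> z = y"
      using that unfolding covers_def by blast+
    obtain X where X: "x = Some X" "X \<in> L"
      using x by (cases x; cases y) (auto simp: face_lattice_def)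
    have down: "Some V \<in> ?P" if "V \<in> L" "face_le (Some V) y" for V
      using that x(2) face_le_trans[of "Some V" y T] by (auto simp: face_lattice_def)
    show ?thesis
    proof (cases y)
      case None
      have "V = X" if "V \<in> L" "sle X V" for V
        using between[OF down[OF that(1)]] that(2) X None by simp
      then show ?thesis using rank_tope[OF X(2)] X None by (simp add: h_def)
    next
      case (Some Y)
      then have Y: "Y \<in> L" using x(2) by (auto simp: face_lattice_def)
      have "rank_om E L (zset E X) = Suc (rank_om E L (zset E Y))"
      proof (rule rank_cover[OF X(2) Y])
        show "sle X Y" "X \<noteq> Y" using x X Some by auto
        show "V = X \<or> V = Y" if "V \<in> L" "sle X V" "sle V Y" for V
          using between[OF down[OF that(1)]] that X Some by simp
      qed
      then show ?thesis using X Some by (simp add: h_def)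
    qed
  qed
  have "card C = Suc (h (Some zero_vec)) - h T" if "pred_on.maxchain ?P face_le C" for C
    by (rule maxchain_card[OF fin refl trans anti b t cov that])
  then have "\<forall>C D. pred_on.maxchain ?P face_le C \<and> pred_on.maxchain ?P face_le D \<longrightarrow> card C = card D"
    by simp
  moreover have "\<exists>b. is_least face_le ?P b" "\<exists>t. is_greatest face_le ?P t" using b t by blast+
  ultimately show ?thesis using fin refl trans anti unfolding graded_poset_def by (intro conjI)
qed

lemma graded_cells:
  assumes "A \<subseteq> E" "T \<in> face_lattice (restrict_vec A ` L)"
  shows "graded_poset face_le (cells L A T)"
proof -
  interpret R: oriented_matroid E "restrict_vec A ` L"
    by (rule restriction_oriented_matroid[OF assms(1)])
  show ?thesis using R.graded_cells_full[OF assms(2)] by (simp add: cells_def)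
qed

lemma cells_cases:
  assumes "y \<in> cells L A T"
  obtains "y = None" "T = None" | X where "X \<in> L" "y = Some (restrict_vec A X)"
  using assms by (cases T; cases y) (auto simp: cells_def face_lattice_def)

lemma Some_in_cells:
  "X \<in> L \<Longrightarrow> face_le (Some (restrict_vec A X)) T \<Longrightarrow> Some (restrict_vec A X) \<in> cells L A T"
  by (auto simp: cells_def face_lattice_def)

text \<open>\<open>X0\<close> excludes the oriented matroid whose only covector is zero: there the
  adjoined top would itself be an atom. Spanning keeps nonzero covectors nonzero under
  restriction.\<close>

lemma atoms_cells:
  assumes "spans L A" "X0 \<in> L" "X0 \<noteq> zero_vec"
  shows "atoms face_le (cells L A T) =
    (\<lambda>X. Some (restrict_vec A X)) ` {X. minimal_on L A X \<and> face_le (Some (restrict_vec A X)) T}"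
    (is "?l = ?r")
proof -
  let ?v = "\<lambda>X. Some (restrict_vec A X)"
  note res0 = restrict_vec_zero[of A]
  have zle: "face_le (Some zero_vec) y" for y :: "'a signvec option" by (rule face_le_zero)
  have z: "Some zero_vec \<in> cells L A T"
    using Some_in_cells[OF zero_covector, of A T] res0 zle by simp
  have least: "is_least face_le (cells L A T) b \<longleftrightarrow> b = Some zero_vec" for b
    using z zle face_le_antisym unfolding is_least_def by blast
  have nonzero: "restrict_vec A Y \<noteq> zero_vec" if "Y \<in> L" "Y \<noteq> zero_vec" for Y
    using spans_nonzero[OF assms(1) that] by (auto simp: restrict_vec_eq_zero_iff)
  show ?thesis
  proof (intro subset_antisym subsetI)
    fix y assume "y \<in> ?l"
    then have y: "y \<in> cells L A T" "y \<noteq> Some zero_vec"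
      and between: "\<And>z. z \<in> cells L A T \<Longrightarrow> face_le z y \<Longrightarrow> z = Some zero_vec \<or> z = y"
      using least zle by (auto simp: atoms_def covers_def)
    from y(1) show "y \<in> ?r"
    proof (cases rule: cells_cases)
      case 1
      then show ?thesis
        using between[of "?v X0"] Some_in_cells[OF assms(2), of A T] nonzero[OF assms(2,3)]
        by (simp add: face_le_None)
    next
      case (2 X)
      have le: "face_le (?v X) T" using y(1) 2 by (simp add: cells_def)
      have "X \<noteq> zero_vec" using y(2) 2 res0 by auto
      moreover have "\<forall>a\<in>A. Y a = X a" if Y: "Y \<in> L" "Y \<noteq> zero_vec" "leq_on A Y X" for Y
      proof -
        have Yy: "face_le (?v Y) y" using Y(3) 2 by (simp add: sle_restrict_vec)
        then have "?v Y \<in> cells L A T"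
          using Some_in_cells[OF Y(1)] face_le_trans le 2 by blast
        then have "?v Y = y" using between Yy nonzero[OF Y(1,2)] by blast
        then show ?thesis using 2 by (simp add: restrict_vec_eq_iff)
      qed
      ultimately have "minimal_on L A X" using 2(1) unfolding minimal_on_def by blast
      then show ?thesis using 2 le by blast
    qed
  next
    fix y assume "y \<in> ?r"
    then obtain X where X: "minimal_on L A X" "face_le (?v X) T" "y = ?v X" by blast
    then have XL: "X \<in> L" "X \<noteq> zero_vec" by (simp_all add: minimal_on_def)
    have "covers face_le (cells L A T) y (Some zero_vec)"
      unfolding covers_def
    proof (intro conjI ballI impI)
      show "Some zero_vec \<in> cells L A T" "y \<in> cells L A T" "face_le (Some zero_vec) y" "Some zero_vec \<noteq> y"
        using z zle[of y] X Some_in_cells[OF XL(1) X(2)] nonzero[OF XL] by (simp_all only:) auto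
      fix z assume z: "z \<in> cells L A T" "face_le (Some zero_vec) z \<and> face_le z y"
      from z(1) show "z = Some zero_vec \<or> z = y"
      proof (cases rule: cells_cases)
        case 1
        then show ?thesis using z(2) X by simp
      next
        case (2 Y)
        then have "leq_on A Y X" using z(2) X by (simp add: sle_restrict_vec)
        then show ?thesis
          using X(1) 2 res0 unfolding minimal_on_def X(3) by (metis restrict_vec_eq_iff)
      qed
    qed
    then show "y \<in> ?l" using least by (auto simp: atoms_def)
  qed
qed

text \<open>Base of the recursion: if all nonzero covectors are minimal, a chain contains at most
  the bottom, one vertex and the adjoined top.\<close>

lemma poset_length_cells:
  assumes "A \<subseteq> E" "T \<in> face_lattice (restrict_vec A ` L)"
    and "\<And>X. X \<in> L \<Longrightarrow> X \<noteq> zero_vec \<Longrightarrow> minimal_on L A X" and "spans L A"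
  shows "poset_length face_le (cells L A T) \<le> 2"
proof (rule poset_length_le_2)
  let ?v = "\<lambda>X. Some (restrict_vec A X)"
  show "finite (cells L A T)" using finite_covectors by (simp add: cells_def face_lattice_def)
  show refl: "reflp_on (cells L A T) face_le" by (rule reflp_onI) (rule face_le_refl)
  fix C assume C: "pred_on.chain (cells L A T) face_le C"
  have sub: "C \<subseteq> cells L A T" and cmp: "\<And>x y. x \<in> C \<Longrightarrow> y \<in> C \<Longrightarrow> face_le x y \<or> face_le y x"
    using C by (auto simp: chain_iff[OF refl])
  note res0 = restrict_vec_zero[of A]
  have eq: "y = y'"
    if y: "y \<in> C" "y' \<in> C" "y \<noteq> None" "y' \<noteq> None" "y \<noteq> Some zero_vec" "y' \<noteq> Some zero_vec" for y y'
  proof -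
    obtain Y where Y: "Y \<in> L" "y = ?v Y" using y sub by (blast elim: cells_cases)
    obtain Y' where Y': "Y' \<in> L" "y' = ?v Y'" using y sub by (blast elim: cells_cases)
    have nz: "Y \<noteq> zero_vec" "Y' \<noteq> zero_vec" using y Y Y' res0 by auto
    have "leq_on A Y Y' \<or> leq_on A Y' Y"
      using cmp[OF y(1,2)] Y Y' by (simp add: sle_restrict_vec)
    then have "\<forall>a\<in>A. Y a = Y' a"
      using assms(3)[OF Y(1) nz(1)] assms(3)[OF Y'(1) nz(2)] Y(1) Y'(1) nz unfolding minimal_on_def by metis
    then show ?thesis using Y Y' by (simp add: restrict_vec_eq_iff)
  qed
  obtain s where "C \<subseteq> {None, Some zero_vec, s}"
  proof (cases "\<exists>s\<in>C. s \<noteq> None \<and> s \<noteq> Some zero_vec")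
    case True
    then obtain s where "s \<in> C" "s \<noteq> None" "s \<noteq> Some zero_vec" by blast
    then have "C \<subseteq> {None, Some zero_vec, s}" using eq by blast
    then show ?thesis using that by blast
  next
    case False
    then show ?thesis using that by blast
  qed
  then have "card C \<le> card {None, Some zero_vec, s}" by (intro card_mono) auto
  also have "\<dots> \<le> 3" by (simp add: card_insert_if)
  finally show "card C \<le> 3" .
qed

end

subsection \<open>The vertex order\<close>

text \<open>The value is \<open>length gs\<close> if all entries vanish, hence the bound on
  \<open>k\<close> in \<open>le_first_iff\<close>.\<close>

primrec first :: "'a list \<Rightarrow> 'a signvec \<Rightarrow> nat" where
  "first [] X = 0"
| "first (g # gs) X = (if X g \<noteq> 0 then 0 else Suc (first gs X))"

text \<open>The sign reverses the order of the blocks on the negative side; the \<open>+ 1\<close>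
  keeps it visible at index 0.\<close>

definition key :: "'a list \<Rightarrow> 'a list \<Rightarrow> 'a signvec \<Rightarrow> int" where
  "key es gs X = lexsign es X * (int (first gs X) + 1)"

lemma le_first_iff: "k \<le> length gs \<Longrightarrow> k \<le> first gs X \<longleftrightarrow> (\<forall>g\<in>set (take k gs). X g = 0)"
proof (induction gs arbitrary: k)
  case (Cons g gs)
  then show ?case by (cases k) auto
qed simp

lemma first_nonzero:
  "\<exists>g\<in>set gs. X g \<noteq> 0 \<Longrightarrow> first gs X < length gs \<and> X (gs ! first gs X) \<noteq> 0"
  by (induction gs) auto

lemma sorted_initial_segment:
  fixes f :: "'b \<Rightarrow> int"
  assumes "sorted_wrt (\<lambda>x y. f x \<le> f y) ys"
  shows "\<exists>m. set (take m ys) = {y \<in> set ys. f y < c}"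
  using assms
proof (induction ys)
  case (Cons y ys)
  then obtain m where m: "set (take m ys) = {y \<in> set ys. f y < c}" by auto
  show ?case
  proof (cases "f y < c")
    case True
    then show ?thesis using m by (intro exI[of _ "Suc m"]) auto
  next
    case False
    then show ?thesis using Cons.prems by (intro exI[of _ 0]) auto
  qed
qed simp

lemma recursive_atom_orderingD:
  "recursive_atom_ordering le P xs \<Longrightarrow> distinct xs \<and> set xs = atoms le P"
  by (auto elim: recursive_atom_ordering.cases)

context oriented_matroid
begin

text \<open>A covector below \<open>compose X W\<close> vanishes where both \<open>X\<close> and
  \<open>W\<close> do, in particular at \<open>g'\<close>. So whatever \<open>L\<close> could put
  between them is already in the contraction, and covers there are covers in
  \<open>L\<close>.\<close>

lemma forward_contraction:
  assumes "oriented_matroid.forward (contraction L g') es g X W"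
  shows "forward es g X W"
proof -
  interpret C: oriented_matroid E "contraction L g'" by (rule contraction_oriented_matroid)
  note C = assms[unfolded C.forward_def]
  have XW: "X g' = 0" "W g' = 0" using C by (simp_all add: cocircuit_def contraction_def)
  have mem: "V \<in> contraction L g'" if "V \<in> L" "sle V (compose X W) \<or> sle V (compose W X)" for V
    using that XW sle_zero[of V "compose X W" g'] sle_zero[of V "compose W X" g']
    by (auto simp: contraction_def compose_def)
  show ?thesis unfolding forward_def
    using C mem cocircuit_contraction by blast
qed

end

text \<open>These properties pass to the contraction at a vertex. Euclideanness enters as acyclicity
  for every \<open>g\<close>, and genericity directs every edge of every link.\<close>

locale sweep = oriented_matroid E L for E :: "'a set" and L +
  fixes gs es :: "'a list"
  assumes gs_ground: "set gs \<subseteq> E"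
    and spanning: "spans L (set gs)"
    and generic: "X \<in> L \<Longrightarrow> X \<noteq> zero_vec \<Longrightarrow> lexsign es X \<noteq> 0"
    and acyclic_forward: "acyclic (forward_rel es g)"
begin

text \<open>For nonzero covectors equal keys force equal \<open>first\<close>. Demanding this
  explicitly makes the relation transitive on all functions, also where \<open>lexsign\<close> is
  0.\<close>

definition earlier :: "('a signvec \<times> 'a signvec) set" where
  "earlier = {(X, W). key es gs X < key es gs W \<or>
     key es gs X = key es gs W \<and> first gs X = first gs W \<and> (X, W) \<in> (forward_rel es (gs ! first gs X))\<^sup>+}"

lemma acyclic_earlier: "acyclic earlier"
proof -
  have "trans earlier"
    unfolding earlier_def by (rule transI) (auto intro: trancl_trans)
  moreover have "(X, X) \<notin> earlier" for X
    using acyclic_forward unfolding earlier_def acyclic_def by blast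
  ultimately show ?thesis by (simp add: acyclic_def trancl_id)
qed

abbreviation vertex :: "'a signvec \<Rightarrow> bool" where
  "vertex \<equiv> minimal_on L (set gs)"

lemma sweep_contraction:
  assumes "vertex X" "g \<in> set gs" "X g \<noteq> 0"
  shows "sweep E (contraction L g) (filter (\<lambda>a. X a = 0) gs) es"
proof -
  interpret C: oriented_matroid E "contraction L g" by (rule contraction_oriented_matroid)
  show ?thesis
  proof
    show "set (filter (\<lambda>a. X a = 0) gs) \<subseteq> E" using gs_ground by auto
    show "spans (contraction L g) (set (filter (\<lambda>a. X a = 0) gs))"
      using spans_contraction[OF assms(1) _ assms(2,3) spanning] by simp
    show "lexsign es Z \<noteq> 0" if "Z \<in> contraction L g" "Z \<noteq> zero_vec" for Z
      using that generic by (simp add: contraction_def)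
    show "acyclic (C.forward_rel es h)" for h
      using forward_contraction by (intro acyclic_subset[OF acyclic_forward[of h]]) auto
  qed
qed

end

text \<open>The interval above \<open>X\<close> is modelled by the covectors of the contraction at \<open>g\<close> restricted to
  \<open>gs'\<close>: the covector \<open>Z\<close> stands for the direction that leads from \<open>X\<close> to \<open>compose X Z\<close>.\<close>

locale vertex_link = sweep E L gs es for E :: "'a set" and L gs es +
  fixes X :: "'a signvec"
  assumes vertex: "minimal_on L (set gs) X"
begin

definition k where "k = first gs X"
definition g where "g = gs ! k"
definition gs' where "gs' = filter (\<lambda>a. X a = 0) gs"

abbreviation "link \<equiv> contraction L g"
abbreviation "link_vertex \<equiv> minimal_on link (set gs')"

lemma X: "X \<in> L" "X \<noteq> zero_vec"
  using vertex by (simp_all add: minimal_on_def)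

lemma k: "k < length gs" "X g \<noteq> 0" "g \<in> set gs"
  using first_nonzero[of gs X] spans_nonzero[OF spanning X] by (auto simp: k_def g_def)

sublocale C: sweep E link gs' es
  unfolding gs'_def by (rule sweep_contraction[OF vertex k(3,2)])

lemma k_le_first_iff: "k \<le> first gs Y \<longleftrightarrow> (\<forall>a\<in>set (take k gs). Y a = 0)"
  using k by (intro le_first_iff) simp

lemma X_take: "a \<in> set (take k gs) \<Longrightarrow> X a = 0"
  using le_first_iff[of k gs X] k by (simp add: k_def)

lemma in_gs': "a \<in> set gs' \<longleftrightarrow> a \<in> set gs \<and> X a = 0"
  by (auto simp: gs'_def)

lemma take_in_gs': "a \<in> set (take k gs) \<Longrightarrow> a \<in> set gs'"
  using X_take in_gs' in_set_takeD by fast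

lemma gs'_prefix: "k \<le> length gs'" "take k gs' = take k gs"
proof -
  have "filter (\<lambda>a. X a = 0) (take k gs) = take k gs"
    using X_take by (simp add: filter_id_conv)
  moreover have "gs' = filter (\<lambda>a. X a = 0) (take k gs) @ filter (\<lambda>a. X a = 0) (drop k gs)"
    unfolding gs'_def by (metis append_take_drop_id filter_append)
  ultimately have *: "gs' = take k gs @ filter (\<lambda>a. X a = 0) (drop k gs)" by simp
  have len: "length (take k gs) = k" using k by simp
  show "k \<le> length gs'" using arg_cong[OF *, of length] len by simp
  show "take k gs' = take k gs" unfolding * using len by simp
qed

lemma linkD: "Z \<in> link \<Longrightarrow> Z \<in> L" "Z \<in> link \<Longrightarrow> Z g = 0"
  by (simp_all add: contraction_def)

section \<open>Descending directions at a vertex\<close>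

lemma lexsign_pm: "Y \<in> L \<Longrightarrow> Y \<noteq> zero_vec \<Longrightarrow> lexsign es Y = 1 \<or> lexsign es Y = -1"
  using lexsign_cases[of Y es] generic[of Y] by auto

lemma lexsign_X: "lexsign es X = 1 \<or> lexsign es X = -1"
  using lexsign_pm X by blast

text \<open>This is \<open>k + 1\<close> for positive and \<open>- k\<close> for negative
  \<open>X\<close>. The \<open>+ 1\<close> in the negative case admits negative directions of index
  \<open>k\<close>, which belongs to a later element because \<open>g\<close> has dropped out of
  \<open>gs'\<close>.\<close>

definition threshold where
  "threshold = (if lexsign es X = 1 then key es gs X else key es gs X + 1)"

lemma below_threshold_iff:
  assumes "Z \<in> link" "Z \<noteq> zero_vec"
  shows "key es gs' Z < threshold \<longleftrightarrow>
    (if \<forall>a\<in>set (take k gs). Z a = 0 then lexsign es Z = -1 else lexsign es X = 1)"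
proof -
  have "(\<forall>a\<in>set (take k gs). Z a = 0) \<longleftrightarrow> k \<le> first gs' Z"
    using le_first_iff[OF gs'_prefix(1), of Z] gs'_prefix(2) by simp
  moreover have "lexsign es Z = 1 \<or> lexsign es Z = -1"
    using lexsign_pm linkD(1) assms by blast
  ultimately show ?thesis
    using lexsign_X by (auto simp: threshold_def key_def k_def)
qed

lemma agree_eq: "link_vertex Z \<Longrightarrow> Y \<in> link \<Longrightarrow> (\<And>a. a \<in> set gs' \<Longrightarrow> Y a = Z a) \<Longrightarrow> Y = Z"
  using C.minimal_on_unique[OF C.spanning] by blast

text \<open>A vertex below \<open>compose X Z\<close> that is nonzero at some \<open>a\<close> in
  the support of \<open>Z\<close> conforms to \<open>Z\<close> on \<open>gs'\<close>; lifted to the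
  link, it equals \<open>Z\<close> there by minimality.\<close>

lemma link_edge_end:
  assumes "link_vertex Z"
  shows "\<exists>W. vertex W \<and> W \<noteq> X \<and> leq_on (set gs) W (compose X Z) \<and> (\<forall>a\<in>set gs'. W a = Z a)"
proof -
  have Z: "Z \<in> link" "Z \<noteq> zero_vec" using assms by (simp_all add: minimal_on_def)
  obtain a where a: "a \<in> set gs'" "Z a \<noteq> 0" using C.spans_nonzero[OF C.spanning Z] by blast
  let ?F = "compose X Z"
  have F: "?F \<in> L" "?F a \<noteq> 0" using X Z linkD compose_covector[of X Z] a by (auto simp: compose_def)
  obtain W where W: "vertex W" "leq_on (set gs) W ?F" "W a = ?F a"
    using minimal_below[OF spanning _ F] by blast
  have WL: "W \<in> L" using W by (simp add: minimal_on_def)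
  obtain N where N: "N \<in> link" "\<forall>h. X h = 0 \<longrightarrow> N h = W h"
    using contraction_lift[OF X(1) k(2) WL] by blast
  have "N a \<noteq> 0" using N(2) a W(3) F(2) in_gs' by simp
  then have "N \<noteq> zero_vec" by (auto simp: zero_vec_def)
  moreover have "leq_on (set gs') N Z" unfolding leq_on_def
  proof (intro ballI impI)
    fix b assume b: "b \<in> set gs'" "N b \<noteq> 0"
    then have "W b \<noteq> 0" "X b = 0" "b \<in> set gs" using N(2) in_gs' by auto
    then have "?F b = W b" using leq_onD[OF W(2)] by blast
    then show "Z b = N b" using \<open>X b = 0\<close> N(2) by (simp add: compose_def)
  qed
  ultimately have "\<forall>b\<in>set gs'. N b = Z b" using assms N(1) unfolding minimal_on_def by blast
  then have "\<forall>b\<in>set gs'. W b = Z b" using N(2) in_gs' by auto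
  moreover have "W \<noteq> X" using a W(3) F(2) in_gs' by auto
  ultimately show ?thesis using W by blast
qed

text \<open>Passing to a descending extreme ray keeps the zeros before index \<open>k\<close>, and a
  negative direction with these zeros is below the threshold for either sign of
  \<open>X\<close>.\<close>

lemma descending_link_vertex:
  assumes "N \<in> link" "lexsign es N = -1" "\<And>a. a \<in> set (take k gs) \<Longrightarrow> N a = 0"
  shows "\<exists>Z. link_vertex Z \<and> leq_on (set gs') Z N \<and> key es gs' Z < threshold"
proof -
  obtain Z where Z: "link_vertex Z" "leq_on (set gs') Z N" "lexsign es Z = -1"
    using C.negative_minimal[OF C.spanning _ assms(1,2)] by blast
  have "Z a = 0" if "a \<in> set (take k gs)" for a
    using leq_onD[OF Z(2) take_in_gs'[OF that]] assms(3)[OF that] by auto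
  then have "key es gs' Z < threshold"
    using below_threshold_iff[of Z] Z by (simp add: minimal_on_def)
  then show ?thesis using Z by blast
qed

text \<open>The edge at \<open>X\<close> in direction \<open>Z\<close> has a second vertex, which is earlier: if it lies on \<open>g\<close> it is
  \<open>Z\<close> itself, and otherwise it is the first vertex of the edge by \<open>sweep_reachable\<close>.\<close>

lemma earlier_end:
  assumes Z: "link_vertex Z" "key es gs' Z < threshold"
  shows "\<exists>W. vertex W \<and> leq_on (set gs) W (compose X Z) \<and> (W, X) \<in> earlier"
proof -
  have ZL: "Z \<in> link" "Z \<noteq> zero_vec" using Z by (simp_all add: minimal_on_def)
  obtain W where W: "vertex W" "W \<noteq> X" "leq_on (set gs) W (compose X Z)" "\<forall>a\<in>set gs'. W a = Z a"
    using link_edge_end[OF Z(1)] by blast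
  have WL: "W \<in> L" "W \<noteq> zero_vec" using W by (simp_all add: minimal_on_def)
  have lW: "lexsign es W = 1 \<or> lexsign es W = -1" using lexsign_pm WL by blast
  have "(W, X) \<in> earlier"
  proof (cases "\<forall>a\<in>set (take k gs). Z a = 0")
    \<comment> \<open>\<open>W\<close> lies in an earlier block of \<open>gs\<close> than the
      positive \<open>X\<close>, so its key is smaller for either sign of \<open>W\<close>.\<close>
    case False
    then have lX: "lexsign es X = 1" using below_threshold_iff[OF ZL] Z(2) by simp
    have "\<not> (\<forall>a\<in>set (take k gs). W a = 0)" using False W(4) take_in_gs' by auto
    then have "first gs W < k" using k_le_first_iff[of W] by (metis not_le)
    then have "key es gs W < key es gs X" using lX lW by (auto simp: key_def k_def)
    then show ?thesis by (simp add: earlier_def)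
  next
    case True
    then have lZ: "lexsign es Z = -1" using below_threshold_iff[OF ZL] Z(2) by simp
    have Wk: "\<forall>a\<in>set (take k gs). W a = 0" using True W(4) take_in_gs' by auto
    then have kW: "k \<le> first gs W" using k_le_first_iff[of W] by (metis not_le)
    show ?thesis
    proof (cases "W g = 0")
      \<comment> \<open>The end on \<open>g\<close> is negative and has an index above
        \<open>k\<close>, so its key is less than \<open>- (k + 1)\<close>.\<close>
      case True
      then have "W \<in> link" using WL by (simp add: contraction_def)
      then have "W = Z" using agree_eq[OF Z(1)] W(4) by blast
      have "first gs W \<noteq> k" using first_nonzero[of gs W] spans_nonzero[OF spanning WL] True
        by (auto simp: g_def)
      then have "key es gs W < key es gs X"
        using kW lexsign_X lZ \<open>W = Z\<close> by (auto simp: key_def k_def)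
      then show ?thesis by (simp add: earlier_def)
    next
      case False
      have "compose X Z g = X g" using k by (simp add: compose_def)
      then have Wg: "X g = W g" using leq_onD[OF W(3) k(3) False] by simp
      have "Suc k \<le> length gs" using k by simp
      moreover have "\<not> (\<forall>a\<in>set (take (Suc k) gs). W a = 0)"
        using False k(1) by (auto simp: g_def take_Suc_conv_app_nth)
      ultimately have fW: "first gs W = k" using kW le_first_iff[of "Suc k" gs W] by auto
      have "(- X) g = - W g" "(- X) g \<noteq> 0" using Wg k by auto
      then obtain M where M: "M \<in> L" "M g = 0"
        "\<And>h. (- X) h \<noteq> - W h \<or> (- X) h = 0 \<Longrightarrow> M h = (if (- X) h \<noteq> 0 then (- X) h else W h)"
        using elimination[OF neg_covector[OF X(1)] WL(1)] by blast
      have "M \<in> link" using M by (simp add: contraction_def)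
      moreover have "M a = Z a" if "a \<in> set gs'" for a
        using M(3)[of a] W(4) that in_gs' by simp
      ultimately have MZ: "M = Z" using agree_eq[OF Z(1)] by blast
      \<comment> \<open>Seen from \<open>W\<close>, the edge has only the directions
        \<open>Z\<close> and \<open>- Z\<close>. \<open>Z\<close> leaves it, being opposite to
        \<open>X\<close> at some \<open>b\<close> where \<open>W\<close> vanishes; there remains
        \<open>- Z\<close>, which ascends.\<close>
      have opt: "lexsign es Y = 1"
        if Y: "Y \<in> L" "Y g = 0" "Y \<noteq> zero_vec"
          "\<And>a. a \<in> set gs \<Longrightarrow> W a = 0 \<Longrightarrow> Y a \<noteq> 0 \<Longrightarrow> Y a = compose X Z a" for Y
      proof -
        have "Y a = 0" if "a \<in> set gs'" "Z a = 0" for a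
          using Y(4)[of a] W(4) that in_gs' by (auto simp: compose_def)
        moreover have YL: "Y \<in> link" using Y by (simp add: contraction_def)
        ultimately have "Y = Z \<or> Y = - Z"
          using C.minimal_on_support_eq[OF C.spanning _ Z(1) YL Y(3)] by blast
        moreover have "Y \<noteq> Z"
        proof
          assume YZ: "Y = Z"
          have "spans link {a\<in>set gs. W a = 0}"
            by (rule spans_contraction[OF W(1) _ k(3) False spanning]) simp
          then obtain b where b: "b \<in> set gs" "W b = 0" "Z b \<noteq> 0"
            using C.spans_nonzero ZL by blast
          have Xb: "X b \<noteq> 0" using b W(4) in_gs' by auto
          then have "Z b = - X b" using M(3)[of b] MZ b by simp
          moreover have "Z b = X b" using Y(4)[of b] YZ b Xb by (simp add: compose_def)
          ultimately show False using Xb by simp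
        qed
        ultimately show ?thesis using lZ by (simp add: lexsign_uminus)
      qed
      have "(W, X) \<in> (forward_rel es g)\<^sup>*"
      proof (rule sweep_reachable[where A = "set gs" and G = "compose X Z", OF acyclic_forward])
        show "cocircuit L W" "cocircuit L X"
          using minimal_on_cocircuit[OF spanning] W(1) vertex by blast+
        show "leq_on (set gs) X (compose X Z)" by (simp add: leq_on_def compose_def)
      qed (use False Wg W opt in auto)
      then have path: "(W, X) \<in> (forward_rel es g)\<^sup>+" using W(2) by (meson rtranclD)
      show ?thesis
      proof (cases "lexsign es W = lexsign es X")
        case True
        then show ?thesis using path fW by (simp add: earlier_def key_def k_def g_def)
      next
        \<comment> \<open>No forward path leads from a positive to a negative vertex, so
          \<open>W\<close> is the negative one.\<close>
        case False
        then have "lexsign es W = -1" "lexsign es X = 1"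
          using forward_trancl[OF path] lW lexsign_X by auto
        then show ?thesis by (simp add: earlier_def key_def)
      qed
    qed
  qed
  then show ?thesis using W by blast
qed

text \<open>The simplex argument for condition (i). If all directions into \<open>V\<close> ascended
  and \<open>W\<close> were off \<open>g\<close> in the block of \<open>X\<close>, then
  \<open>sweep_reachable\<close> would make \<open>X\<close> earlier than \<open>W\<close>; in the
  other cases the keys decide.\<close>

lemma descending_edge:
  assumes W: "vertex W" "W \<noteq> X" "(X, W) \<notin> earlier"
    and V: "V \<in> L" "leq_on (set gs) X V" "leq_on (set gs) W V"
  shows "\<exists>Z. link_vertex Z \<and> key es gs' Z < threshold \<and> leq_on (set gs') Z V"
proof (cases "lexsign es X = 1 \<and> (\<exists>a\<in>set (take k gs). V a \<noteq> 0)")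
  \<comment> \<open>At a positive \<open>X\<close>, every direction that is nonzero before index
    \<open>k\<close> is below the threshold, whatever its sign.\<close>
  case True
  then obtain a where a: "a \<in> set (take k gs)" "V a \<noteq> 0" by blast
  obtain N where N: "N \<in> link" "\<forall>h. X h = 0 \<longrightarrow> N h = V h"
    using contraction_lift[OF X(1) k(2) V(1)] by blast
  have "N a \<noteq> 0" using N a X_take by simp
  then obtain Z where Z: "link_vertex Z" "leq_on (set gs') Z N" "Z a = N a"
    using C.minimal_below[OF C.spanning _ N(1)] by blast
  have nz: "\<not> (\<forall>a\<in>set (take k gs). Z a = 0)" using Z(3) \<open>N a \<noteq> 0\<close> a(1) by metis
  have "Z \<in> link" "Z \<noteq> zero_vec" using Z(1) by (simp_all add: minimal_on_def)
  then have "key es gs' Z < threshold"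
    using below_threshold_iff[of Z] True by (simp only: nz) simp
  moreover have "leq_on (set gs') Z V" unfolding leq_on_def
    using leq_onD[OF Z(2)] N(2) in_gs' by auto
  ultimately show ?thesis using Z by blast
next
  case no_up: False
  have WL: "W \<in> L" "W \<noteq> zero_vec" using W by (simp_all add: minimal_on_def)
  have lW: "lexsign es W = 1 \<or> lexsign es W = -1" using lexsign_pm WL by blast
  have key: "key es gs W \<le> key es gs X" using W(3) by (auto simp: earlier_def)
  have Wk: "\<forall>a\<in>set (take k gs). W a = 0"
  proof (cases "lexsign es X = 1")
    case True
    then have "\<forall>a\<in>set (take k gs). V a = 0" using no_up by blast
    then show ?thesis using leq_onD[OF V(3)] by (metis in_set_takeD)
  next
    case False
    then have "k \<le> first gs W" using lexsign_X lW key by (auto simp: key_def k_def)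
    then show ?thesis using k_le_first_iff[of W] by (metis not_le)
  qed
  then have kW: "k \<le> first gs W" using k_le_first_iff[of W] by (metis not_le)
  have "\<exists>N\<in>link. lexsign es N = -1 \<and> (\<forall>a\<in>set (take k gs). N a = 0) \<and> leq_on (set gs') N V"
  proof (rule ccontr)
    assume none: "\<not> ?thesis"
    show False
    proof (cases "W g = 0")
      \<comment> \<open>\<open>W\<close> is itself a direction at \<open>X\<close>. If it ascended,
        it would be positive with an index above \<open>k\<close>, and its key would exceed that of
        \<open>X\<close>.\<close>
      case True
      then have "W \<in> link" using WL by (simp add: contraction_def)
      moreover have "leq_on (set gs') W V" using V(3) in_gs' by (simp add: leq_on_def)
      ultimately have "lexsign es W = 1" using none Wk lW by blast
      moreover have "first gs W \<noteq> k" using first_nonzero[of gs W] spans_nonzero[OF spanning WL] True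
        by (auto simp: g_def)
      ultimately show False using key kW lexsign_X by (auto simp: key_def k_def)
    next
      case False
      have Wg: "W g = X g"
        using leq_onD[OF V(2) k(3,2)] leq_onD[OF V(3) k(3) False] by simp
      have "Suc k \<le> length gs" using k by simp
      moreover have "\<not> (\<forall>a\<in>set (take (Suc k) gs). W a = 0)"
        using False k(1) by (auto simp: g_def take_Suc_conv_app_nth)
      ultimately have fW: "first gs W = k" using kW le_first_iff[of "Suc k" gs W] by auto
      have WV: "W a = X a" if "a \<in> set gs" "W a \<noteq> 0" "X a \<noteq> 0" for a
        using leq_onD[OF V(2) that(1,3)] leq_onD[OF V(3) that(1,2)] by simp
      \<comment> \<open>A direction into the face \<open>compose X W\<close> conforms to
        \<open>W\<close> on the zeros of \<open>X\<close>; so it leads into \<open>V\<close>,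
        vanishes before index \<open>k\<close>, and must ascend by \<open>none\<close>.\<close>
      have opt: "lexsign es Y = 1"
        if Y: "Y \<in> L" "Y g = 0" "Y \<noteq> zero_vec"
          "\<And>a. a \<in> set gs \<Longrightarrow> X a = 0 \<Longrightarrow> Y a \<noteq> 0 \<Longrightarrow> Y a = compose X W a" for Y
      proof (rule ccontr)
        assume "lexsign es Y \<noteq> 1"
        then have "lexsign es Y = -1" using lexsign_pm Y by blast
        moreover have "Y \<in> link" using Y by (simp add: contraction_def)
        moreover have YW: "Y a = W a" if "a \<in> set gs'" "Y a \<noteq> 0" for a
          using Y(4)[of a] that in_gs' by (simp add: compose_def)
        then have "leq_on (set gs') Y V"
          using leq_onD[OF V(3)] in_gs' by (metis leq_on_def)
        moreover have "\<forall>a\<in>set (take k gs). Y a = 0" using YW Wk take_in_gs' by metis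
        ultimately show False using none by blast
      qed
      have "(X, W) \<in> (forward_rel es g)\<^sup>*"
      proof (rule sweep_reachable[where A = "set gs" and G = "compose X W", OF acyclic_forward])
        show "cocircuit L W" "cocircuit L X"
          using minimal_on_cocircuit[OF spanning] W(1) vertex by blast+
        show "leq_on (set gs) X (compose X W)" by (simp add: leq_on_def compose_def)
        show "leq_on (set gs) W (compose X W)" using WV unfolding leq_on_def compose_def by metis
      qed (use k Wg opt in auto)
      then have path: "(X, W) \<in> (forward_rel es g)\<^sup>+" using W(2) by (metis rtranclD)
      then have "lexsign es W = lexsign es X"
        using forward_trancl[OF path] lW lexsign_X key by (auto simp: key_def)
      then show False using W(3) path fW by (simp add: earlier_def key_def k_def g_def)
    qed
  qed
  then obtain N where N: "N \<in> link" "lexsign es N = -1" "\<forall>a\<in>set (take k gs). N a = 0" "leq_on (set gs') N V"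
    by blast
  then show ?thesis using descending_link_vertex[of N] leq_on_trans by blast
qed

text \<open>The counterpart of \<open>descending_edge\<close> for the adjoined top. For positive
  \<open>X\<close> any link vertex or its negative is below the threshold, and \<open>Y\<close>
  provides a link vertex; for negative \<open>X\<close> a suitable direction comes from
  \<open>W\<close>.\<close>

lemma descending_edge_exists:
  assumes W: "vertex W" "W \<noteq> X" "(X, W) \<notin> earlier"
    and Y: "Y \<in> L" "Y \<noteq> zero_vec" "\<not> vertex Y"
  shows "\<exists>Z. link_vertex Z \<and> key es gs' Z < threshold"
proof (cases "lexsign es X = 1")
  case True
  have "\<exists>a\<in>set gs'. Y a \<noteq> 0"
  proof (rule ccontr)
    assume "\<not> ?thesis"
    then have "Y = X \<or> Y = - X"
      using minimal_on_support_eq[OF spanning _ vertex Y(1,2)] in_gs' by auto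
    then show False using Y(3) vertex minimal_on_uminus by blast
  qed
  then obtain a where a: "a \<in> set gs'" "Y a \<noteq> 0" by blast
  obtain N where N: "N \<in> link" "\<forall>h. X h = 0 \<longrightarrow> N h = Y h"
    using contraction_lift[OF X(1) k(2) Y(1)] by blast
  have "N a \<noteq> 0" using N a in_gs' by simp
  then obtain Z where Z: "link_vertex Z" using C.minimal_below[OF C.spanning _ N(1)] by blast
  have Z': "link_vertex (- Z)" using C.minimal_on_uminus[OF Z] .
  have ZL: "Z \<in> link" "Z \<noteq> zero_vec" "- Z \<in> link" "- Z \<noteq> zero_vec"
    using Z Z' by (simp_all add: minimal_on_def)
  have "key es gs' Z < threshold \<or> key es gs' (- Z) < threshold"
    using below_threshold_iff[OF ZL(1,2)] below_threshold_iff[OF ZL(3,4)] True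
      lexsign_pm[OF linkD(1)[OF ZL(1)] ZL(2)] by (auto simp: lexsign_uminus)
  then show ?thesis using Z Z' by blast
next
  case False
  then have lX: "lexsign es X = -1" using lexsign_X by blast
  have WL: "W \<in> L" "W \<noteq> zero_vec" using W by (simp_all add: minimal_on_def)
  have lW: "lexsign es W = 1 \<or> lexsign es W = -1" using lexsign_pm WL by blast
  have key: "key es gs W \<le> key es gs X" using W(3) by (auto simp: earlier_def)
  then have lW: "lexsign es W = -1" using lW lX by (auto simp: key_def)
  have "k \<le> first gs W" using lX lW key by (auto simp: key_def k_def)
  then have Wk: "\<forall>a\<in>set (take k gs). W a = 0" using k_le_first_iff[of W] by (metis not_le)
  have "\<exists>N\<in>link. N \<noteq> zero_vec \<and> (\<forall>a\<in>set (take k gs). N a = 0)"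
  proof (cases "W g = 0")
    case True
    then show ?thesis using WL Wk by (auto simp: contraction_def)
  next
    case False
    \<comment> \<open>The sign makes \<open>X'\<close> and \<open>W\<close> separated at
      \<open>g\<close>. They are not opposite, as \<open>X\<close> and \<open>W\<close> are distinct
      and both negative.\<close>
    define X' where "X' = (if W g = X g then - X else X)"
    have X': "X' \<in> L" "X' g = - W g" "X' g \<noteq> 0"
      using X neg_covector[of X] covector_eq_or_neg[OF X(1) WL(1) k(2) False] k by (auto simp: X'_def)
    have X'k: "X' a = 0" if "a \<in> set (take k gs)" for a using X_take[OF that] by (simp add: X'_def)
    obtain N where N: "N \<in> L" "N g = 0"
      "\<And>h. X' h \<noteq> - W h \<or> X' h = 0 \<Longrightarrow> N h = (if X' h \<noteq> 0 then X' h else W h)"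
      using elimination[OF X'(1) WL(1) X'(2,3)] by blast
    have "X \<noteq> - W" using lX lW lexsign_uminus[of es W] by auto
    moreover have "- X \<noteq> - W" using W(2) by (metis signvec_uminus_uminus)
    ultimately have "X' \<noteq> - W" by (simp add: X'_def)
    then have "N \<noteq> zero_vec" by (rule ext_elimination[OF X'(1) WL(1) _ N(3)])
    moreover have "N a = 0" if "a \<in> set (take k gs)" for a
      using N(3)[of a] X'k[OF that] Wk that by simp
    ultimately show ?thesis using N by (auto simp: contraction_def)
  qed
  then obtain N where N: "N \<in> link" "N \<noteq> zero_vec" "\<forall>a\<in>set (take k gs). N a = 0" by blast
  have "- N \<in> link" using C.neg_covector[OF N(1)] .
  moreover have "lexsign es N = -1 \<or> lexsign es (- N) = -1"
    using lexsign_pm[OF linkD(1)[OF N(1)] N(2)] by (auto simp: lexsign_uminus)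
  ultimately show ?thesis
    using descending_link_vertex[of N] descending_link_vertex[of "- N"] N by auto
qed

end

section \<open>The interval above a vertex as cells of its link\<close>

context vertex_link
begin

abbreviation face :: "'a signvec \<Rightarrow> 'a signvec option" where
  "face Y \<equiv> Some (restrict_vec (set gs) Y)"

text \<open>On \<open>gs\<close>, \<open>X\<close> overwrites all entries outside
  \<open>gs'\<close>, so \<open>compose X Z\<close> depends only on the restriction of
  \<open>Z\<close> to \<open>gs'\<close>, the form in which faces of the link are given.\<close>

definition glue :: "'a signvec option \<Rightarrow> 'a signvec option" where
  "glue = map_option (compose (restrict_vec (set gs) X))"

lemma glue_Some: "glue (Some (restrict_vec (set gs') Z)) = face (compose X Z)"
  by (auto simp: glue_def restrict_vec_def compose_def in_gs')

lemma glue_None: "glue None = None"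
  by (simp add: glue_def)

lemma leq_on_compose: "leq_on (set gs) (compose X Y) (compose X Z) \<longleftrightarrow> leq_on (set gs') Y Z"
  by (auto simp: leq_on_def compose_def in_gs')

lemma compose_leq_on_iff:
  assumes "leq_on (set gs) X V"
  shows "leq_on (set gs) (compose X Z) V \<longleftrightarrow> leq_on (set gs') Z V"
  using leq_onD[OF assms] unfolding leq_on_def compose_def Ball_def in_gs' by metis

lemma restrict_top:
  assumes T: "T \<in> face_lattice (restrict_vec (set gs) ` L)" "face_le (face X) T"
  defines "T' \<equiv> map_option (restrict_vec (set gs')) T"
  shows "T' \<in> face_lattice (restrict_vec (set gs') ` link)"
    and "face_le (face (compose X Z)) T \<longleftrightarrow> face_le (Some (restrict_vec (set gs') Z)) T'"
proof -
  have "T' \<in> face_lattice (restrict_vec (set gs') ` link) \<and>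
    (face_le (face (compose X Z)) T \<longleftrightarrow> face_le (Some (restrict_vec (set gs') Z)) T')"
  proof (cases T)
    case None
    then show ?thesis by (simp add: T'_def face_lattice_def)
  next
    case (Some t)
    then obtain V where V: "V \<in> L" "T = face V" using T(1) by (auto simp: face_lattice_def)
    have XV: "leq_on (set gs) X V" using T(2) V by (simp add: sle_restrict_vec)
    have T': "T' = Some (restrict_vec (set gs') V)"
      using V by (auto simp: T'_def restrict_vec_def fun_eq_iff in_gs')
    \<comment> \<open>\<open>V\<close> itself agrees with \<open>X\<close> at \<open>g\<close> and
      is not in the link; \<open>N\<close> has the same restriction to \<open>gs'\<close>.\<close>
    obtain N where N: "N \<in> link" "\<forall>h. X h = 0 \<longrightarrow> N h = V h"
      using contraction_lift[OF X(1) k(2) V(1)] by blast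
    have "restrict_vec (set gs') V = restrict_vec (set gs') N"
      using N(2) in_gs' by (simp add: restrict_vec_eq_iff)
    then have "T' \<in> face_lattice (restrict_vec (set gs') ` link)"
      using N(1) T' by (auto simp: face_lattice_def)
    then show ?thesis using V T' compose_leq_on_iff[OF XV] by (simp add: sle_restrict_vec)
  qed
  then show "T' \<in> face_lattice (restrict_vec (set gs') ` link)"
    "face_le (face (compose X Z)) T \<longleftrightarrow> face_le (Some (restrict_vec (set gs') Z)) T'"
    by simp_all
qed

lemma link_iso:
  assumes T: "T \<in> face_lattice (restrict_vec (set gs) ` L)" "face_le (face X) T"
  defines "T' \<equiv> map_option (restrict_vec (set gs')) T"
  shows "order_iso face_le (cells link (set gs') T') face_le glue"
    and "glue ` cells link (set gs') T' = upper face_le (cells L (set gs) T) (face X)"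
proof -
  have iso: "face_le (glue x) (glue y) \<longleftrightarrow> face_le x y"
    if xy: "x \<in> cells link (set gs') T'" "y \<in> cells link (set gs') T'" for x y
  proof (cases x)
    case None
    show ?thesis using xy(2) unfolding None
      by (cases rule: C.cells_cases) (auto simp: glue_None glue_Some)
  next
    case (Some x')
    then obtain Z where Z: "x = Some (restrict_vec (set gs') Z)"
      using C.cells_cases[OF xy(1)] by auto
    show ?thesis using xy(2) unfolding Z
      by (cases rule: C.cells_cases)
        (auto simp: glue_None glue_Some sle_restrict_vec leq_on_compose)
  qed
  show "order_iso face_le (cells link (set gs') T') face_le glue"
  proof
    show "inj_on glue (cells link (set gs') T')"
    proof (rule inj_onI)
      fix x y assume *: "x \<in> cells link (set gs') T'" "y \<in> cells link (set gs') T'" "glue x = glue y"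
      then have "face_le (glue x) (glue y)" "face_le (glue y) (glue x)" by (simp_all add: face_le_refl)
      then show "x = y" using iso * face_le_antisym by blast
    qed
  qed (rule iso)
  show "glue ` cells link (set gs') T' = upper face_le (cells L (set gs) T) (face X)"
  proof (intro subset_antisym subsetI)
    fix y assume "y \<in> glue ` cells link (set gs') T'"
    then obtain x where x: "x \<in> cells link (set gs') T'" "y = glue x" by blast
    from x(1) show "y \<in> upper face_le (cells L (set gs) T) (face X)"
    proof (cases rule: C.cells_cases)
      case 1
      then have "T = None" by (simp add: T'_def)
      then show ?thesis using 1 x by (auto simp: glue_None upper_def cells_def face_lattice_def)
    next
      case (2 Z)
      then have "face_le (face (compose X Z)) T"
        using x(1) restrict_top(2)[OF T, of Z] by (simp add: cells_def T'_def)
      then have "face (compose X Z) \<in> cells L (set gs) T"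
        using Some_in_cells[OF compose_covector[OF X(1) linkD(1)[OF 2(1)]]] by blast
      moreover have "leq_on (set gs) X (compose X Z)" by (simp add: leq_on_def compose_def)
      ultimately show ?thesis using 2 x by (simp add: glue_Some upper_def sle_restrict_vec)
    qed
  next
    fix y assume "y \<in> upper face_le (cells L (set gs) T) (face X)"
    then have y: "y \<in> cells L (set gs) T" "face_le (face X) y" by (simp_all add: upper_def)
    from y(1) show "y \<in> glue ` cells link (set gs') T'"
    proof (cases rule: cells_cases)
      case 1
      then have "None \<in> cells link (set gs') T'" by (simp add: cells_def face_lattice_def T'_def)
      then show ?thesis using 1 glue_None by force
    next
      case (2 Y)
      have XY: "leq_on (set gs) X Y" using y(2) 2 by (simp add: sle_restrict_vec)
      obtain N where N: "N \<in> link" "\<forall>h. X h = 0 \<longrightarrow> N h = Y h"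
        using contraction_lift[OF X(1) k(2) 2(1)] by blast
      have eq: "y = face (compose X N)"
        using 2 N(2) leq_onD[OF XY] by (simp add: restrict_vec_eq_iff compose_def)
      then have "face_le (Some (restrict_vec (set gs') N)) T'"
        using y(1) restrict_top(2)[OF T, of N] by (simp add: cells_def T'_def)
      then have "Some (restrict_vec (set gs') N) \<in> cells link (set gs') T'"
        using C.Some_in_cells[OF N(1)] by blast
      then show ?thesis using eq glue_Some by (metis imageI)
    qed
  qed
qed

end

section \<open>The recursion over links\<close>

context sweep
begin

text \<open>\<open>Q\<close> consists of the edges \<open>compose X Z\<close> with \<open>Z\<close>
  below the threshold, a prefix since the link is sorted by \<open>key\<close>. Condition (i)
  combines \<open>descending_edge\<close> (for the top, \<open>descending_edge_exists\<close>) with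
  \<open>earlier_end\<close>.\<close>

lemma recursive_atom_ordering_step:
  fixes xs :: "'a signvec list"
  defines "face \<equiv> \<lambda>Y. Some (restrict_vec (set gs) Y)"
  assumes T: "T \<in> face_lattice (restrict_vec (set gs) ` L)"
    and xs: "set xs = {X. vertex X \<and> face_le (face X) T}" "distinct xs"
      "\<forall>j<length xs. \<forall>i<j. (xs ! j, xs ! i) \<notin> earlier"
    and Y: "Y \<in> L" "Y \<noteq> zero_vec" "\<not> vertex Y"
    and j: "j < length xs"
    and IH: "\<And>T'. \<lbrakk>T' \<in> face_lattice (restrict_vec (set (vertex_link.gs' gs (xs ! j))) ` contraction L (vertex_link.g gs (xs ! j)))\<rbrakk>
      \<Longrightarrow> \<exists>ys. recursive_atom_ordering face_le
          (cells (contraction L (vertex_link.g gs (xs ! j))) (set (vertex_link.gs' gs (xs ! j))) T')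
          (map (\<lambda>Z. Some (restrict_vec (set (vertex_link.gs' gs (xs ! j))) Z)) ys) \<and>
        set ys = {Z. minimal_on (contraction L (vertex_link.g gs (xs ! j))) (set (vertex_link.gs' gs (xs ! j))) Z \<and>
          face_le (Some (restrict_vec (set (vertex_link.gs' gs (xs ! j))) Z)) T'} \<and>
        sorted_wrt (\<lambda>Z Z'. key es (vertex_link.gs' gs (xs ! j)) Z \<le> key es (vertex_link.gs' gs (xs ! j)) Z') ys"
  defines "K \<equiv> cells L (set gs) T"
  shows "\<exists>Q \<subseteq> atoms face_le (upper face_le K (map face xs ! j)).
      upper face_le K (map face xs ! j) \<inter> (\<Union>i<j. upper face_le K (map face xs ! i)) = (\<Union>y\<in>Q. upper face_le K y) \<and>
      (\<exists>ys. recursive_atom_ordering face_le (upper face_le K (map face xs ! j)) ys \<and> Q = set (take (card Q) ys))"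
proof -
  define X where "X = xs ! j"
  have "X \<in> set xs" using j by (simp add: X_def)
  then have X: "vertex X" "face_le (face X) T" using xs(1) by simp_all
  interpret N: vertex_link E L gs es X by unfold_locales (rule X(1))
  note topT = N.restrict_top[OF T X(2)[unfolded face_def]]
  define T' where "T' = map_option (restrict_vec (set N.gs')) T"
  obtain ys where ys: "recursive_atom_ordering face_le (cells N.link (set N.gs') T')
        (map (\<lambda>Z. Some (restrict_vec (set N.gs') Z)) ys)"
      "set ys = {Z. N.link_vertex Z \<and> face_le (Some (restrict_vec (set N.gs') Z)) T'}"
      "sorted_wrt (\<lambda>Z Z'. key es N.gs' Z \<le> key es N.gs' Z') ys"
    using IH[of T', folded X_def] topT(1) unfolding T'_def by blast
  define zs where "zs = map (\<lambda>Z. face (compose X Z)) ys"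
  have up: "glue ` C = upper face_le K (face X)"
    if "glue = N.glue" "C = cells N.link (set N.gs') T'" for glue C
    using N.link_iso(2)[OF T X(2)[unfolded face_def]] that unfolding T'_def K_def face_def by simp
  have "recursive_atom_ordering face_le (N.glue ` cells N.link (set N.gs') T')
      (map N.glue (map (\<lambda>Z. Some (restrict_vec (set N.gs') Z)) ys))"
    using recursive_atom_ordering_image[OF ys(1) N.link_iso(1)[OF T X(2)[unfolded face_def], folded T'_def]] .
  then have zs: "recursive_atom_ordering face_le (upper face_le K (face X)) zs"
    using up[OF refl refl] by (simp add: zs_def face_def N.glue_Some comp_def)
  obtain m where m: "set (take m ys) = {Z \<in> set ys. key es N.gs' Z < N.threshold}"
    using sorted_initial_segment[OF ys(3)] by blast
  define Q where "Q = set (take m zs)"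
  have Q: "y \<in> Q \<longleftrightarrow> (\<exists>Z. N.link_vertex Z \<and> key es N.gs' Z < N.threshold \<and>
      face_le (face (compose X Z)) T \<and> y = face (compose X Z))" for y
  proof -
    have "Q = (\<lambda>Z. face (compose X Z)) ` set (take m ys)" by (simp add: Q_def zs_def take_map)
    then show ?thesis
      unfolding m ys(2) using topT(2) unfolding T'_def face_def by auto
  qed
  have xj: "map face xs ! i = face (xs ! i)" if "i \<le> j" for i using that j by simp
  have casesK: "\<exists>V\<in>L. F = face V \<and> face_le F T" if "F \<in> K" "F \<noteq> None" for F
    using that unfolding K_def face_def by (auto simp: cells_def face_lattice_def)
  have le_face: "face_le (face V) (face W) \<longleftrightarrow> leq_on (set gs) V W" for V W
    by (simp add: face_def sle_restrict_vec)
  have distinct: "distinct zs" "set zs = atoms face_le (upper face_le K (face X))"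
    using recursive_atom_orderingD[OF zs] by simp_all
  \<comment> \<open>Nothing bounds \<open>m\<close> by the length of the list; beyond it,
    \<open>Q\<close> is the set of all atoms.\<close>
  have "Q = set (take (card Q) zs)"
  proof (cases "m \<le> length zs")
    case True
    then have "card Q = m" using distinct(1) by (simp add: Q_def distinct_card)
    then show ?thesis by (simp add: Q_def)
  next
    case False
    then have "Q = set zs" by (simp add: Q_def)
    then show ?thesis using distinct(1) by (simp add: distinct_card)
  qed
  moreover have "Q \<subseteq> atoms face_le (upper face_le K (face X))"
    using distinct(2) by (auto simp: Q_def dest: in_set_takeD)
  moreover have "upper face_le K (face X) \<inter> (\<Union>i<j. upper face_le K (map face xs ! i)) = (\<Union>y\<in>Q. upper face_le K y)"
  proof (intro subset_antisym subsetI)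
    fix F assume F: "F \<in> upper face_le K (face X) \<inter> (\<Union>i<j. upper face_le K (map face xs ! i))"
    then obtain i where i: "i < j" "F \<in> upper face_le K (map face xs ! i)" by blast
    define W where "W = xs ! i"
    have FK: "F \<in> K" "face_le (face X) F" "face_le (face W) F"
      using F i xj[of i] by (auto simp: upper_def W_def)
    have "W \<in> set xs" using i j by (simp add: W_def)
    then have W: "vertex W" using xs(1) by simp
    have WX: "W \<noteq> X" using i j xs(2) by (simp add: W_def X_def nth_eq_iff_index_eq)
    have late: "(X, W) \<notin> earlier" using xs(3) i j by (simp add: W_def X_def)
    have "\<exists>Z. N.link_vertex Z \<and> key es N.gs' Z < N.threshold \<and> face_le (face (compose X Z)) F"
    proof (cases "F = None")
      case True
      then show ?thesis using N.descending_edge_exists[OF W WX late Y] by (auto simp: face_le_None)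
    next
      case False
      then obtain V where V: "V \<in> L" "F = face V" using casesK[OF FK(1)] by blast
      then have le: "leq_on (set gs) X V" "leq_on (set gs) W V" using FK le_face by simp_all
      then show ?thesis
        using N.descending_edge[OF W WX late V(1) le] N.compose_leq_on_iff[OF le(1)] V(2) le_face by auto
    qed
    then obtain Z where Z: "N.link_vertex Z" "key es N.gs' Z < N.threshold" "face_le (face (compose X Z)) F"
      by blast
    have "face_le F T" using FK(1) by (simp add: K_def cells_def)
    then have "face (compose X Z) \<in> Q" using Q Z face_le_trans by blast
    then show "F \<in> (\<Union>y\<in>Q. upper face_le K y)" using Z(3) FK(1) by (auto simp: upper_def)
  next
    fix F assume "F \<in> (\<Union>y\<in>Q. upper face_le K y)"
    then obtain Z where Z: "N.link_vertex Z" "key es N.gs' Z < N.threshold"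
      "face_le (face (compose X Z)) T" "face_le (face (compose X Z)) F" "F \<in> K"
      using Q by (auto simp: upper_def)
    obtain W where W: "vertex W" "leq_on (set gs) W (compose X Z)" "(W, X) \<in> earlier"
      using N.earlier_end[OF Z(1,2)] by blast
    have le: "face_le (face W) F" "face_le (face W) T"
      using face_le_trans Z(3,4) W(2) le_face by blast+
    then have "W \<in> set xs" using xs(1) W(1) by simp
    then obtain i where i: "i < length xs" "W = xs ! i" by (metis in_set_conv_nth)
    have "(X, X) \<notin> earlier" using acyclic_earlier unfolding acyclic_def by blast
    then have "i \<noteq> j" using W(3) i by (auto simp: X_def)
    moreover have "\<not> j < i" using xs(3) i W(3) by (auto simp: X_def)
    ultimately have "i < j" by simp
    moreover have "leq_on (set gs) X (compose X Z)" by (simp add: leq_on_def compose_def)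
    then have "face_le (face X) F" using face_le_trans Z(4) le_face by blast
    moreover have "F \<in> upper face_le K (map face xs ! i)"
      using le(1) i(2) xj[of i] \<open>i < j\<close> Z(5) by (simp add: upper_def)
    ultimately show "F \<in> upper face_le K (face X) \<inter> (\<Union>i<j. upper face_le K (map face xs ! i))"
      using Z(5) by (auto simp: upper_def)
  qed
  ultimately show ?thesis using zs xj[of j] unfolding X_def by auto
qed

end

text \<open>Sortedness by \<open>key\<close> strengthens the induction: one level up, it turns
  \<open>Q\<close> into a prefix. \<open>gs\<close> gets shorter because \<open>g\<close> is
  filtered out.\<close>

lemma sweep_recursive_atom_ordering:
  assumes "sweep E L gs es" "\<exists>X\<in>L. X \<noteq> zero_vec" "T \<in> face_lattice (restrict_vec (set gs) ` L)"
  shows "\<exists>xs. recursive_atom_ordering face_le (cells L (set gs) T) (map (\<lambda>X. Some (restrict_vec (set gs) X)) xs) \<and>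
    set xs = {X. minimal_on L (set gs) X \<and> face_le (Some (restrict_vec (set gs) X)) T} \<and>
    sorted_wrt (\<lambda>X Y. key es gs X \<le> key es gs Y) xs"
  using assms
proof (induction "length gs" arbitrary: L gs T rule: less_induct)
  case less
  interpret sweep E L gs es by (rule less.prems)
  let ?face = "\<lambda>X. Some (restrict_vec (set gs) X)"
  let ?S = "{X. vertex X \<and> face_le (?face X) T}"
  have "?S \<subseteq> L" by (auto simp: minimal_on_def)
  then have "finite ?S" using finite_covectors finite_subset by blast
  then obtain xs where xs: "distinct xs" "set xs = ?S" "\<forall>j<length xs. \<forall>i<j. (xs ! j, xs ! i) \<notin> earlier"
    using finite_acyclic_enumeration[OF _ acyclic_earlier] by blast
  have sorted: "sorted_wrt (\<lambda>X Y. key es gs X \<le> key es gs Y) xs"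
    unfolding sorted_wrt_iff_nth_less
  proof (intro allI impI)
    fix i j assume "i < j" "j < length xs"
    then have "(xs ! j, xs ! i) \<notin> earlier" using xs(3) by blast
    then show "key es gs (xs ! i) \<le> key es gs (xs ! j)" by (auto simp: earlier_def)
  qed
  have "inj_on ?face (set xs)"
  proof (rule inj_onI)
    fix X Y assume "X \<in> set xs" "Y \<in> set xs" "?face X = ?face Y"
    then have "vertex X" "Y \<in> L" "\<forall>a\<in>set gs. Y a = X a"
      using xs(2) by (auto simp: minimal_on_def restrict_vec_eq_iff)
    then show "X = Y" using minimal_on_unique[OF spanning] by blast
  qed
  then have "distinct (map ?face xs)" using xs(1) by (simp add: distinct_map)
  moreover have "set (map ?face xs) = atoms face_le (cells L (set gs) T)"
    using atoms_cells[OF spanning] less.prems(2) xs(2) by auto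
  moreover have "graded_poset face_le (cells L (set gs) T)"
    using graded_cells[OF gs_ground less.prems(3)] .
  moreover have "poset_length face_le (cells L (set gs) T) \<le> 2 \<or>
   (\<forall>j<length (map ?face xs). \<exists>Q \<subseteq> atoms face_le (upper face_le (cells L (set gs) T) (map ?face xs ! j)).
      upper face_le (cells L (set gs) T) (map ?face xs ! j) \<inter> (\<Union>i<j. upper face_le (cells L (set gs) T) (map ?face xs ! i))
        = (\<Union>y\<in>Q. upper face_le (cells L (set gs) T) y) \<and>
      (\<exists>ys. recursive_atom_ordering face_le (upper face_le (cells L (set gs) T) (map ?face xs ! j)) ys \<and> Q = set (take (card Q) ys)))"
  proof (cases "\<forall>Y\<in>L. Y \<noteq> zero_vec \<longrightarrow> vertex Y")
    case True
    then show ?thesis using poset_length_cells[OF gs_ground less.prems(3) _ spanning] by blast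
  next
    case False
    then obtain Y where Y: "Y \<in> L" "Y \<noteq> zero_vec" "\<not> vertex Y" by blast
    show ?thesis
    proof (intro disjI2 allI impI)
      fix j assume "j < length (map ?face xs)"
      then have j: "j < length xs" by simp
      then have "xs ! j \<in> set xs" by simp
      then have X: "vertex (xs ! j)" using xs(2) by simp
      interpret N: vertex_link E L gs es "xs ! j" by unfold_locales (rule X)
      have len: "length N.gs' < length gs"
        unfolding N.gs'_def using N.k(2,3) by (intro length_filter_less) auto
      \<comment> \<open>The induction hypothesis asks for a nonzero covector of the link: the
        non-minimal \<open>Y\<close> does not vanish on all zeros of the vertex in
        \<open>gs\<close>, and can be lifted.\<close>
      have "\<exists>a\<in>set N.gs'. Y a \<noteq> 0"
      proof (rule ccontr)
        assume "\<not> ?thesis"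
        then have "Y = xs ! j \<or> Y = - (xs ! j)"
          using minimal_on_support_eq[OF spanning _ X Y(1,2)] N.in_gs' by auto
        then show False using Y(3) X minimal_on_uminus by blast
      qed
      then obtain a where a: "a \<in> set N.gs'" "Y a \<noteq> 0" by blast
      obtain V where V: "V \<in> N.link" "\<forall>h. (xs ! j) h = 0 \<longrightarrow> V h = Y h"
        using contraction_lift[OF N.X(1) N.k(2) Y(1)] by blast
      have "V a \<noteq> 0" using V a N.in_gs' by simp
      then have "\<exists>V\<in>N.link. V \<noteq> zero_vec" using V(1) not_zero_vec by blast
      then show "\<exists>Q \<subseteq> atoms face_le (upper face_le (cells L (set gs) T) (map ?face xs ! j)).
        upper face_le (cells L (set gs) T) (map ?face xs ! j) \<inter> (\<Union>i<j. upper face_le (cells L (set gs) T) (map ?face xs ! i))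
          = (\<Union>y\<in>Q. upper face_le (cells L (set gs) T) y) \<and>
        (\<exists>ys. recursive_atom_ordering face_le (upper face_le (cells L (set gs) T) (map ?face xs ! j)) ys \<and> Q = set (take (card Q) ys))"
        using less.hyps[OF len N.C.sweep_axioms]
        by (intro recursive_atom_ordering_step[OF less.prems(3) xs(2,1,3) Y j]) blast
    qed
  qed
  ultimately show ?case
    using xs(2) sorted by (intro exI[of _ xs] conjI recursive_atom_ordering.intros) auto
qed

subsection \<open>Euclidean programs\<close>

text \<open>A shortest closed walk repeats no vertex, as a repetition would cut out a shorter
  one.\<close>

lemma not_acyclic_cycle:
  assumes "\<not> acyclic r"
  shows "\<exists>c. c \<noteq> [] \<and> distinct c \<and> (\<forall>i<length c. (c ! i, c ! ((i + 1) mod length c)) \<in> r)"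
proof -
  let ?P = "\<lambda>n. 0 < n \<and> (\<exists>x. (x, x) \<in> r ^^ n)"
  obtain x where "(x, x) \<in> r\<^sup>+" using assms by (auto simp: acyclic_def)
  then obtain l where "?P l" unfolding trancl_power by blast
  then obtain n where "?P n" and least: "\<And>m. ?P m \<Longrightarrow> n \<le> m"
    using ex_has_least_nat[of ?P l "\<lambda>n. n"] by meson
  then obtain x where "0 < n" "(x, x) \<in> r ^^ n" by blast
  then obtain f where f: "f 0 = x" "f n = x" "\<And>i. i < n \<Longrightarrow> (f i, f (Suc i)) \<in> r"
    unfolding relpow_fun_conv by blast
  have "f i \<noteq> f j" if "i < j" "j < n" for i j
  proof
    assume "f i = f j"
    then have "(f i, f i) \<in> r ^^ (j - i)"
      unfolding relpow_fun_conv using that f(3) by (intro exI[of _ "\<lambda>l. f (i + l)"]) auto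
    then have "n \<le> j - i" using least[of "j - i"] that by auto
    then show False using that \<open>0 < n\<close> by simp
  qed
  then have "inj_on f {0..<n}" by (intro linorder_inj_onI) auto
  then have "distinct (map f [0..<n])" by (simp add: distinct_map)
  moreover have "(map f [0..<n] ! i, map f [0..<n] ! ((i + 1) mod n)) \<in> r" if "i < n" for i
  proof (cases "Suc i = n")
    case True
    then show ?thesis using f(1,2) f(3)[OF that] \<open>0 < n\<close> that by simp
  next
    case False
    then show ?thesis using f(3)[OF that] that by simp
  qed
  ultimately show ?thesis using \<open>0 < n\<close> by (intro exI[of _ "map f [0..<n]"]) auto
qed

lemma lexsign_first: "lexsign es X \<noteq> 0 \<Longrightarrow> first es X < length es \<and> X (es ! first es X) = lexsign es X"
  by (induction es) auto

lemma below_first: "j < first es X \<Longrightarrow> j < length es \<Longrightarrow> X (es ! j) = 0"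
proof (induction es arbitrary: j)
  case (Cons e es)
  then show ?case by (cases j) (auto split: if_splits)
qed simp

context oriented_matroid
begin

text \<open>Negation reverses arrows: the step from \<open>- W\<close> to \<open>- X\<close> has the
  same direction \<open>Z\<close>, and the two disjuncts of the covering clause change
  places.\<close>

lemma forward_uminus:
  assumes "forward es g X W"
  shows "forward es g (- W) (- X)"
proof -
  have XW: "cocircuit L X" "cocircuit L W" "X g \<noteq> 0" "W g = X g" "X \<noteq> W" "conformal X W"
    and cov: "(\<forall>V\<in>L. sle W V \<and> sle V (compose W X) \<longrightarrow> V = W \<or> V = compose W X) \<or>
      (\<forall>V\<in>L. sle X V \<and> sle V (compose X W) \<longrightarrow> V = X \<or> V = compose X W)"
    using assms unfolding forward_def by blast+
  obtain Z where Z: "cocircuit L Z" "Z g = 0" "lexsign es Z = 1"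
    "\<And>h. X h \<noteq> W h \<or> X h = 0 \<Longrightarrow> Z h = (if X h \<noteq> 0 then - X h else W h)"
    using assms unfolding forward_def by blast
  have cocircuit_uminus: "cocircuit L (- Y)" if "cocircuit L Y" for Y
    using that minimal_on_uminus by (simp add: cocircuit_iff_minimal_on)
  have compose_uminus: "compose (- Y) (- Y') = - compose Y Y'" for Y Y' :: "'a signvec"
    by (auto simp: compose_def)
  have sle_uminus: "sle (- Y) (- V) \<longleftrightarrow> sle Y V" for Y V :: "'a signvec"
    by (simp add: sle_def)
  have cover_uminus: "\<forall>V\<in>L. sle (- Y) V \<and> sle V (compose (- Y) (- Y')) \<longrightarrow> V = - Y \<or> V = compose (- Y) (- Y')"
    if "\<forall>V\<in>L. sle Y V \<and> sle V (compose Y Y') \<longrightarrow> V = Y \<or> V = compose Y Y'" for Y Y'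
  proof (intro ballI impI)
    fix V assume V: "V \<in> L" "sle (- Y) V \<and> sle V (compose (- Y) (- Y'))"
    then have "sle (- Y) (- (- V))" "sle (- (- V)) (- compose Y Y')" by (simp_all add: compose_uminus)
    then have "sle Y (- V)" "sle (- V) (compose Y Y')" unfolding sle_uminus by blast+
    then have "- V = Y \<or> - V = compose Y Y'" using that neg_covector[OF V(1)] by blast
    then show "V = - Y \<or> V = compose (- Y) (- Y')"
      unfolding compose_uminus by (metis signvec_uminus_uminus)
  qed
  have conf: "X h = 0 \<or> W h = 0 \<or> X h = W h" for h
  proof -
    have "h \<notin> sep X W" using XW(6) by (simp add: conformal_def)
    then have "X h \<noteq> - W h \<or> X h = 0" by (auto simp: sep_def)
    then show ?thesis
      using covector_eq_or_neg[of X W h] XW(1,2) by (auto simp: cocircuit_def)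
  qed
  show ?thesis unfolding forward_def
  proof (intro conjI exI[of _ Z])
    show "cocircuit L (- W)" "cocircuit L (- X)" using XW cocircuit_uminus by blast+
    show "(- W) g \<noteq> 0" "(- X) g = (- W) g" using XW by auto
    show "- W \<noteq> - X" using XW(5) by (metis signvec_uminus_uminus)
    show "conformal (- W) (- X)" using XW(6) by (auto simp: conformal_def sep_def)
    show "(\<forall>V\<in>L. sle (- X) V \<and> sle V (compose (- X) (- W)) \<longrightarrow> V = - X \<or> V = compose (- X) (- W)) \<or>
      (\<forall>V\<in>L. sle (- W) V \<and> sle V (compose (- W) (- X)) \<longrightarrow> V = - W \<or> V = compose (- W) (- X))"
      using cov cover_uminus by blast
    show "\<forall>h. (- W) h \<noteq> (- X) h \<or> (- W) h = 0 \<longrightarrow> Z h = (if (- W) h \<noteq> 0 then - (- W) h else (- X) h)"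
    proof (intro allI impI)
      fix h assume "(- W) h \<noteq> (- X) h \<or> (- W) h = 0"
      then show "Z h = (if (- W) h \<noteq> 0 then - (- W) h else (- X) h)"
        using Z(4)[of h] conf[of h] by auto
    qed
  qed (use Z in auto)
qed

text \<open>Two successive covers, from \<open>zero_vec\<close> to a cocircuit and on to the
  composition, so \<open>rank_cover\<close> lowers the rank twice.\<close>

lemma forward_Gf_edge:
  assumes "forward es g X W" "X g = 1"
  shows "Gf_edge E L g X W"
proof -
  have XW: "cocircuit L X" "cocircuit L W" "W g = 1" "X \<noteq> W" "conformal X W"
    and cov: "(\<forall>V\<in>L. sle W V \<and> sle V (compose W X) \<longrightarrow> V = W \<or> V = compose W X) \<or>
      (\<forall>V\<in>L. sle X V \<and> sle V (compose X W) \<longrightarrow> V = X \<or> V = compose X W)"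
    using assms unfolding forward_def by auto
  have L: "X \<in> L" "W \<in> L" using XW by (simp_all add: cocircuit_def)
  have rank_step: "rank_om E L (zset E (compose Y Y')) + 2 = rank_om E L E"
    if Y: "cocircuit L Y" "cocircuit L Y'" "Y \<noteq> Y'" "conformal Y Y'"
      "\<forall>V\<in>L. sle Y V \<and> sle V (compose Y Y') \<longrightarrow> V = Y \<or> V = compose Y Y'" for Y Y'
  proof -
    have YL: "Y \<in> L" "Y' \<in> L" "Y \<noteq> zero_vec" using Y by (simp_all add: cocircuit_def)
    have "compose Y Y' \<noteq> Y"
    proof
      assume eq: "compose Y Y' = Y"
      have "sle Y' Y" unfolding sle_def
      proof
        fix h
        have "compose Y Y' h = Y h" using eq by simp
        then have "Y h \<noteq> 0 \<or> Y' h = 0" by (auto simp: compose_def)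
        moreover have "h \<notin> sep Y Y'" using Y(4) by (simp add: conformal_def)
        then have "Y h \<noteq> - Y' h \<or> Y h = 0" by (auto simp: sep_def)
        ultimately show "Y' h = 0 \<or> Y' h = Y h"
          using covector_eq_or_neg[OF YL(2,1), of h] by fastforce
      qed
      then show False using Y(1,2,3) unfolding cocircuit_def by metis
    qed
    moreover have "sle Y (compose Y Y')" by (simp add: sle_def compose_def)
    ultimately have 1: "rank_om E L (zset E Y) = Suc (rank_om E L (zset E (compose Y Y')))"
      using Y(5) compose_covector[OF YL(1,2)] YL(1) by (intro rank_cover) auto
    have "rank_om E L (zset E zero_vec) = Suc (rank_om E L (zset E Y))"
    proof (rule rank_cover[OF zero_covector YL(1)])
      show "sle zero_vec Y" "zero_vec \<noteq> Y" using YL(3) by (auto simp: sle_def zero_vec_def)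
      show "V = zero_vec \<or> V = Y" if "V \<in> L" "sle zero_vec V" "sle V Y" for V
        using Y(1) that unfolding cocircuit_def by blast
    qed
    moreover have "zset E zero_vec = E" by (auto simp: zset_def zero_vec_def)
    ultimately show ?thesis using 1 by simp
  qed
  have "zset E (compose W X) = zset E (compose X W)" by (auto simp: zset_def compose_def)
  moreover have "sep W X = sep X W" by (force simp: sep_def)
  then have "conformal W X" using XW(5) by (simp add: conformal_def)
  ultimately have "rank_om E L (zset E (compose X W)) + 2 = rank_om E L E"
    using cov rank_step[OF XW(1,2,4,5)] rank_step[OF XW(2,1) XW(4)[symmetric]] by auto
  moreover have "flat E L (zset E (compose X W))"
    using compose_covector[OF L] by (auto simp: flat_def)
  moreover have "X \<noteq> - W" using assms(2) XW(3) by auto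
  ultimately show ?thesis
    using XW assms(2) by (simp add: Gf_edge_def Gf_vertex_def comodular_def)
qed

lemma forward_eliminates:
  assumes "forward es g X W"
  obtains Z where "eliminates L g (- X) W Z" "lexsign es Z = 1" "Z \<in> L"
    "\<And>h. X h = 0 \<Longrightarrow> W h = 0 \<Longrightarrow> Z h = 0"
proof -
  obtain Z where Z: "cocircuit L Z" "Z g = 0" "lexsign es Z = 1"
    "\<And>h. X h \<noteq> W h \<or> X h = 0 \<Longrightarrow> Z h = (if X h \<noteq> 0 then - X h else W h)"
    using assms unfolding forward_def by blast
  have L: "X \<in> L" "W \<in> L" "Z \<in> L" using assms Z(1) by (simp_all add: forward_def cocircuit_def)
  have zero: "Z h = 0" if "X h = 0" "W h = 0" for h using Z(4)[of h] that by simp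
  \<comment> \<open>If \<open>X h = W h\<close> is nonzero, then \<open>0\<close>,
    \<open>- X h\<close> and \<open>W h\<close> are all three signs.\<close>
  have "Z h \<in> {0, (- X) h, W h}" for h
    using Z(4)[of h] covector_cases[OF L(1), of h] covector_cases[OF L(2), of h] covector_cases[OF L(3), of h]
    by (cases "X h \<noteq> W h \<or> X h = 0") auto
  moreover have "supp Z \<subseteq> supp (compose (- X) W) - {g}"
    using zero Z(2) by (auto simp: supp_def compose_def)
  ultimately show ?thesis using that[of Z] Z zero L by (simp add: eliminates_def)
qed

text \<open>A coloop carries a covector supported on it alone. Suitably signed, it lies below any
  cocircuit nonzero at \<open>e\<close>, which then equals it and vanishes at
  \<open>g\<close>.\<close>

lemma coloop_cocircuit:
  assumes "coloop_om E L e" "cocircuit L X" "X g \<noteq> 0" "g \<noteq> e"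
  shows "X e = 0"
proof (rule ccontr)
  assume Xe: "X e \<noteq> 0"
  have XL: "X \<in> L" using assms by (simp add: cocircuit_def)
  obtain V where V: "V \<in> L" "\<forall>s\<in>E - {e}. V s = 0" "V e \<noteq> 0"
    using assms(1) by (auto simp: coloop_om_def closure_iff)
  have V0: "V h = 0" if "h \<noteq> e" for h using V(2) that covector_outside[OF V(1), of h] by auto
  define V' where "V' = (if V e = X e then V else - V)"
  have V': "V' \<in> L" "V' e = X e" "\<And>h. h \<noteq> e \<Longrightarrow> V' h = 0"
    using V(1) neg_covector[OF V(1)] covector_eq_or_neg[OF V(1) XL V(3) Xe] V0 by (auto simp: V'_def)
  have "sle V' X" unfolding sle_def using V'(2,3) by metis
  moreover have "V' \<noteq> zero_vec" using V'(2) Xe not_zero_vec by metis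
  ultimately have "V' = X" using assms(2) V'(1) unfolding cocircuit_def by blast
  then show False using V'(3)[of g] assms(3,4) by auto
qed

text \<open>A directed cycle for the lexicographic objective is a directed cycle for the first element of
  \<open>es\<close> on which some edge direction of the cycle does not vanish.\<close>

lemma euclidean_acyclic_positive:
  assumes "euclidean E L"
  shows "acyclic {(X, W). forward es g X W \<and> X g = 1}"
proof (rule ccontr)
  assume "\<not> ?thesis"
  then obtain c where c: "c \<noteq> []" "distinct c"
    "\<And>i. i < length c \<Longrightarrow> forward es g (c ! i) (c ! ((i + 1) mod length c)) \<and> (c ! i) g = 1"
    by (blast dest: not_acyclic_cycle)
  let ?n = "length c" and ?s = "\<lambda>i. (i + 1) mod length c"
  have "\<forall>i. i < ?n \<longrightarrow> (\<exists>Z. eliminates L g (- (c ! i)) (c ! ?s i) Z \<and> lexsign es Z = 1 \<and> Z \<in> L \<and>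
      (\<forall>h. (c ! i) h = 0 \<and> (c ! ?s i) h = 0 \<longrightarrow> Z h = 0))"
    using c(3) by (metis forward_eliminates)
  then obtain Z where Z: "\<And>i. i < ?n \<Longrightarrow> eliminates L g (- (c ! i)) (c ! ?s i) (Z i) \<and>
      lexsign es (Z i) = 1 \<and> Z i \<in> L \<and> (\<forall>h. (c ! i) h = 0 \<and> (c ! ?s i) h = 0 \<longrightarrow> Z i h = 0)"
    by metis
  \<comment> \<open>The minimum over the cycle makes every \<open>Z i\<close> zero or positive at
    \<open>e\<close>, so no arrow of the cycle is reversed in the program with objective
    \<open>e\<close>.\<close>
  obtain i0 where i0: "i0 < ?n" "\<And>i. i < ?n \<Longrightarrow> first es (Z i0) \<le> first es (Z i)"
    using ex_has_least_nat[of "\<lambda>i. i < ?n" 0 "\<lambda>i. first es (Z i)"] c(1) by auto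
  define m where "m = first es (Z i0)"
  define e where "e = es ! m"
  have Z0e: "m < length es" "Z i0 e = 1"
    using lexsign_first[of es "Z i0"] Z[OF i0(1)] by (auto simp: m_def e_def)
  have Ze: "Z i e = 0 \<or> Z i e = 1" if "i < ?n" for i
  proof (cases "first es (Z i) = m")
    case True
    then show ?thesis using lexsign_first[of es "Z i"] Z[OF that] by (auto simp: e_def)
  next
    case False
    then have "m < first es (Z i)" using i0(2)[OF that] by (simp add: m_def)
    then show ?thesis using below_first[OF _ Z0e(1)] by (simp add: e_def)
  qed
  have X: "cocircuit L (c ! i)" "c ! i \<in> L" "(c ! i) g \<noteq> 0" if "i < ?n" for i
    using c(3)[OF that] by (auto simp: forward_def cocircuit_def)
  have s: "?s i < ?n" for i using c(1) by simp
  have "g \<in> E" using nonzero_in_ground X(2,3)[OF i0(1)] by blast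
  moreover have "e \<in> E" using nonzero_in_ground[of "Z i0" e] Z[OF i0(1)] Z0e(2) by auto
  moreover have ge: "g \<noteq> e" using Z[OF i0(1)] Z0e(2) by (auto simp: eliminates_def)
  moreover have "\<not> loop_om E L g"
    using X(2,3)[OF i0(1)] by (auto simp: loop_om_def closure_iff)
  \<comment> \<open>Vertices off \<open>g\<close> vanish at a coloop, and so would
    \<open>Z i0\<close>.\<close>
  moreover have "\<not> coloop_om E L e"
  proof
    assume co: "coloop_om E L e"
    have "(c ! i0) e = 0" "(c ! ?s i0) e = 0"
      using coloop_cocircuit[OF co X(1,3)[OF i0(1)] ge] coloop_cocircuit[OF co X(1,3)[OF s] ge] by blast+
    then show False using Z[OF i0(1)] Z0e(2) by auto
  qed
  ultimately have "om_program E L g e" by (simp add: om_program_def)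
  then have no_cycle: "\<not> directed_cycle E L g e c"
    using assms by (simp add: euclidean_def euclidean_program_def)
  have edge: "Gf_edge E L g (c ! i) (c ! ?s i)" if "i < ?n" for i
    using forward_Gf_edge c(3)[OF that] by blast
  have "Gf_forward E L g e (c ! i) (c ! ?s i) \<or> Gf_undirected E L g e (c ! i) (c ! ?s i)" if "i < ?n" for i
    using edge[OF that] Z[OF that] Ze[OF that] unfolding Gf_forward_def Gf_undirected_def by blast
  moreover have "Gf_forward E L g e (c ! i0) (c ! ?s i0)"
    using edge[OF i0(1)] Z[OF i0(1)] Z0e(2) unfolding Gf_forward_def by blast
  ultimately have "directed_cycle E L g e c"
    using c(2) i0(1) unfolding directed_cycle_def by blast
  then show False using no_cycle by simp
qed

text \<open>The value at \<open>g\<close> is constant along arrows, and a cycle with negative value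
  becomes, negated and reversed, one with positive value.\<close>

lemma euclidean_acyclic_forward:
  assumes "euclidean E L"
  shows "acyclic (forward_rel es g)"
proof -
  let ?r = "{(X, W). forward es g X W \<and> X g = 1}"
  have pos: "(X, X) \<notin> (forward_rel es g)\<^sup>+" if "X g = 1" for X
  proof
    assume "(X, X) \<in> (forward_rel es g)\<^sup>+"
    moreover have "(X, Y) \<in> ?r\<^sup>+ \<and> Y g = 1" if "(X, Y) \<in> (forward_rel es g)\<^sup>+" for Y
      using that
    proof (induction rule: trancl_induct)
      case (base Y)
      then have "forward es g X Y" by simp
      moreover from this have "Y g = 1" using \<open>X g = 1\<close> by (simp add: forward_def)
      ultimately show ?case using \<open>X g = 1\<close> by auto
    next
      case (step Y W)
      then have "forward es g Y W" by simp
      moreover from this have "W g = 1" using step by (simp add: forward_def)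
      ultimately show ?case using step by (auto intro: trancl_into_trancl)
    qed
    ultimately show False using euclidean_acyclic_positive[OF assms] unfolding acyclic_def by blast
  qed
  have "(X, X) \<notin> (forward_rel es g)\<^sup>+" for X
  proof
    assume a: "(X, X) \<in> (forward_rel es g)\<^sup>+"
    then obtain W where "forward es g X W" by (auto dest: tranclD)
    then have "X \<in> L" "X g \<noteq> 0" by (auto simp: forward_def cocircuit_def)
    then have X: "X g = 1 \<or> (- X) g = 1" using covector_cases[of X g] by auto
    have "(- W, - X) \<in> (forward_rel es g)\<^sup>+" if "(X, W) \<in> (forward_rel es g)\<^sup>+" for X W
      using that
    proof (induction rule: trancl_induct)
      case (base Y)
      then have "(- Y, - X) \<in> forward_rel es g" using forward_uminus[of es g X Y] by simp
      then show ?case by (rule r_into_trancl)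
    next
      case (step Y W)
      then have "(- W, - Y) \<in> forward_rel es g" using forward_uminus[of es g Y W] by simp
      then show ?case using step.IH by (rule trancl_into_trancl2)
    qed
    then show False using a X pos by blast
  qed
  then show ?thesis by (simp add: acyclic_def)
qed

end

subsection \<open>Vertex-shellability\<close>

lemma has_recursive_atom_ordering_image:
  "has_recursive_atom_ordering le P \<Longrightarrow> order_iso le P le' \<psi> \<Longrightarrow> has_recursive_atom_ordering le' (\<psi> ` P)"
  unfolding has_recursive_atom_ordering_def using recursive_atom_ordering_image by blast

context sweep
begin

lemma has_recursive_atom_ordering_cells:
  assumes "T \<in> face_lattice (restrict_vec (set gs) ` L)"
  shows "has_recursive_atom_ordering face_le (cells L (set gs) T)"
proof (cases "\<exists>X\<in>L. X \<noteq> zero_vec")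
  case True
  then show ?thesis
    using sweep_recursive_atom_ordering[OF sweep_axioms _ assms] unfolding has_recursive_atom_ordering_def by blast
next
  \<comment> \<open>Without nonzero covectors the length is at most 2, and any enumeration of the
    atoms will do.\<close>
  case False
  have "atoms face_le (cells L (set gs) T) \<subseteq> cells L (set gs) T" by (auto simp: atoms_def covers_def)
  moreover have "finite (cells L (set gs) T)"
    using graded_cells[OF gs_ground assms] by (simp add: graded_poset_def)
  ultimately obtain xs where "distinct xs" "set xs = atoms face_le (cells L (set gs) T)"
    using finite_distinct_list finite_subset by metis
  moreover have "poset_length face_le (cells L (set gs) T) \<le> 2"
    using poset_length_cells[OF gs_ground assms _ spanning] False by blast
  ultimately show ?thesis
    using graded_cells[OF gs_ground assms] recursive_atom_ordering.intros
    unfolding has_recursive_atom_ordering_def by blast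
qed

lemma vertex_shellable_restriction:
  "vertex_shellable (restrict_vec (set gs) ` L)"
proof -
  have "None \<in> face_lattice (restrict_vec (set gs) ` L)" by (simp add: face_lattice_def)
  moreover have "cells L (set gs) None = face_lattice (restrict_vec (set gs) ` L)"
    by (auto simp: cells_def face_le_None)
  ultimately show ?thesis
    using has_recursive_atom_ordering_cells unfolding vertex_shellable_def by metis
qed

lemma vertex_shellable_cell_restriction:
  assumes "T \<in> restrict_vec (set gs) ` L"
  shows "vertex_shellable_cell (restrict_vec (set gs) ` L) T"
proof -
  have "Some T \<in> face_lattice (restrict_vec (set gs) ` L)" using assms by (simp add: face_lattice_def)
  then have "has_recursive_atom_ordering face_le (cells L (set gs) (Some T))"
    by (rule has_recursive_atom_ordering_cells)
  moreover have cells: "cells L (set gs) (Some T) = Some ` tope_cell (restrict_vec (set gs) ` L) T"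
    by (auto simp: cells_def tope_cell_def face_lattice_def)
  moreover have "order_iso face_le (Some ` tope_cell (restrict_vec (set gs) ` L) T) sle the"
    by unfold_locales (auto simp: inj_on_def)
  ultimately have "has_recursive_atom_ordering sle (the ` Some ` tope_cell (restrict_vec (set gs) ` L) T)"
    using has_recursive_atom_ordering_image by metis
  then show ?thesis by (simp add: vertex_shellable_cell_def image_image)
qed

end

theorem theorem1p4:
  fixes E :: "'a set" and L :: "'a signvec set" and f :: 'a
  assumes "oriented_matroid E L"
    and "euclidean E L"
    and "f \<in> E"
    and "general_position E L f"
  shows "vertex_shellable (deletion L f) \<and>
    (\<forall>T. tope (deletion L f) T \<longrightarrow> vertex_shellable_cell (deletion L f) T)"
proof -
  interpret oriented_matroid E L by (rule assms)
  obtain es where es: "set es = E" using finite_ground finite_list by blast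
  obtain gs where gs: "set gs = E - {f}" using finite_ground finite_list[of "E - {f}"] by auto
  have generic: "lexsign es X \<noteq> 0" if "X \<in> L" "X \<noteq> zero_vec" for X
    using spans_nonzero[OF spans_ground that] es by (simp add: lexsign_eq_0_iff)
  have restrict: "X(f := 0) = restrict_vec (set gs) X" if "X \<in> L" for X
    using covector_outside[OF that] gs by (auto simp: restrict_vec_def fun_eq_iff)
  then have deletion: "deletion L f = restrict_vec (set gs) ` L" by (simp add: deletion_def)
  obtain M where M: "sweep E M gs es" "deletion L f = restrict_vec (set gs) ` M"
  proof (cases "coloop_om E L f")
    case False
    have "spans L (set gs)" unfolding spans_def
    proof (intro ballI impI)
      fix X assume X: "X \<in> L" "\<forall>a\<in>set gs. X a = 0"
      then have "X f = 0"
        using False assms(3) gs by (auto simp: coloop_om_def closure_iff)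
      then have "\<forall>a\<in>E. X a = 0" using X(2) gs by auto
      then show "X = zero_vec" using X(1) spans_ground unfolding spans_def by blast
    qed
    then have "sweep E L gs es"
      using gs generic euclidean_acyclic_forward[OF assms(2)] by unfold_locales auto
    then show ?thesis using that deletion by blast
  next
    case True
    let ?M = "contraction L f"
    interpret M: oriented_matroid E ?M by (rule contraction_oriented_matroid)
    have "spans ?M (set gs)" unfolding spans_def
    proof (intro ballI impI)
      fix X assume X: "X \<in> ?M" "\<forall>a\<in>set gs. X a = 0"
      then have "\<forall>a\<in>E. X a = 0" using gs by (auto simp: contraction_def)
      then show "X = zero_vec" using X(1) M.spans_ground unfolding spans_def by blast
    qed
    moreover have "acyclic (M.forward_rel es g)" for g
      using forward_contraction by (intro acyclic_subset[OF euclidean_acyclic_forward[OF assms(2), of es g]]) auto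
    moreover have "lexsign es X \<noteq> 0" if "X \<in> ?M" "X \<noteq> zero_vec" for X
      using generic that by (simp add: contraction_def)
    ultimately have "sweep E ?M gs es" using gs by unfold_locales auto
    moreover have "restrict_vec (set gs) ` L = restrict_vec (set gs) ` ?M"
    proof (intro subset_antisym subsetI)
      \<comment> \<open>\<open>V\<close> is supported on the coloop \<open>f\<close> alone, so
        \<open>contraction_lift\<close> sets the entry of \<open>X\<close> at \<open>f\<close> to
        zero and keeps all others.\<close>
      obtain V where V: "V \<in> L" "\<forall>s\<in>E - {f}. V s = 0" "V f \<noteq> 0"
        using True by (auto simp: coloop_om_def closure_iff)
      fix Y assume "Y \<in> restrict_vec (set gs) ` L"
      then obtain X where X: "X \<in> L" "Y = restrict_vec (set gs) X" by blast
      obtain N where N: "N \<in> ?M" "\<forall>h. V h = 0 \<longrightarrow> N h = X h"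
        using contraction_lift[OF V(1,3) X(1)] by blast
      then have "Y = restrict_vec (set gs) N" using X V(2) gs by (simp add: restrict_vec_eq_iff)
      then show "Y \<in> restrict_vec (set gs) ` ?M" using N(1) by blast
    qed (auto simp: contraction_def)
    ultimately show ?thesis using that deletion by metis
  qed
  interpret M: sweep E M gs es by (rule M(1))
  show ?thesis
    unfolding M(2) using M.vertex_shellable_restriction M.vertex_shellable_cell_restriction
    by (auto simp: tope_def)
qed

end
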